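(* Let $M$ be a $G$-graded $R$-module, let $\Gamma$ be the submonoid of $\mathcal{C}$ generated by the degrees of (nonzero homogeneous) elements of $B$, and take $\mathfrak{S} \subset G$ such that $\mathfrak{S}+\mathcal{C}=\mathfrak{S}$. Set $N:=M_{\mathfrak{S}}$, let $R_\Gamma$ be the subring of $R$ of elements of degree in $\Gamma$, and let $\mathbf{Z}\Gamma \subseteq G$ be the subgroup generated by $\Gamma$. If the $R_\Gamma$-module $M_{\mathfrak{S} +\mathbf{Z}\Gamma}/M_{\mathfrak{S}}$ is $B$-torsion, then: (1) $H^i_B(M)_\gamma =H^i_B(M_{\gamma +\mathbf{Z}\Gamma})_\gamma$, for every $i$ and $\gamma\in G$. (2) $H^i_B(N)_\gamma =0$, for all $i$, if $\gamma\not\in \mathfrak{S} +\mathbf{Z}\Gamma$. (3) $H^i_B(N)_\gamma =H^i_B(M)_\gamma$ for $i\geq 2$ and $\gamma\in \mathfrak{S} +\mathbf{Z}\Gamma$. (4) For $\gamma\in \mathfrak{S} +\mathbf{Z}\Gamma$, $$H^1_B(N)_\gamma \neq 0 \iff H^1_B(M)_\gamma\neq 0 \ \mbox{ or }\ \gamma\in \mathrm{Supp}_G(M/H^0_B(M))\setminus \mathfrak{S}.$$ (5) $\mathrm{Supp}_G(H_B^0(N))=\mathrm{Supp}_G(H_B^0(M))\cap \mathfrak{S}$, and $H_B^0(N)_\gamma=H_B^0(M)_\gamma$ if $H_B^0(N)_\gamma \not= 0$.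
   Context: $G$ is an abelian group, $S$ is a commutative ring, $R=S[X_1,\ldots,X_n]$ is $G$-graded with $\deg(X_i)=\gamma_i\in G$ and $\deg(s)=0$ for $s\in S$, $\mathcal{C}$ is the submonoid of $G$ generated by $\gamma_1,\ldots,\gamma_n$, and $B\subseteq (X_1,\ldots,X_n)$ is a finitely generated graded ideal. $H^i_B$ denotes cohomology of the Čech complex on a finite set of homogeneous generators of $B$ (these generators lie in $R_\Gamma$, so the complex makes sense for graded $R_\Gamma$-modules). For $A\subseteq G$, $M_A:=\bigoplus_{\gamma\in A}M_\gamma$. $\mathrm{Supp}_G(M):=\{\gamma\in G: M_\gamma\neq 0\}$. A module is $B$-torsion if each of its elements is annihilated by a power of every one of the chosen generators of $B$ (i.e. it equals its $H^0_B$). The equalities of cohomology groups are via the natural maps (induced by the inclusions of submodules of $M$). *)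

theory Defs
  imports "HOL-Algebra.Indexed_Polynomials"
begin

text \<open>
  Groups, rings and modules are records with explicit carriers, as in HOL-Algebra; the group of
  degrees is therefore written multiplicatively: a sum of degrees is a product in \<open>G\<close>, the
  set \<open>A + B\<close> is \<open>A <#>\<^bsub>G\<^esub> B\<close>, and \<open>\<gamma> + H\<close> is \<open>\<gamma> <#\<^bsub>G\<^esub> H\<close>.
\<close>

section \<open>Graded modules\<close>

record ('a, 'b, 'g) gmodule = "('a, 'b) module" +
  hpart :: "'g \<Rightarrow> 'b set"

definition submonoid_gen :: "('g, 'x) monoid_scheme \<Rightarrow> 'g set \<Rightarrow> 'g set" where
  "submonoid_gen G A = \<Inter> {H. submonoid H G \<and> A \<subseteq> H}"

locale graded_module = comm_group G + module R M
  for G :: "('g, 'x) monoid_scheme"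
    and R :: "('a, 'r, 'g) gmodule"
    and M :: "('r, 'm, 'g) gmodule" +
  assumes hpart_subgroup:
      "\<gamma> \<in> carrier G \<Longrightarrow> additive_subgroup (hpart M \<gamma>) M"
    and hpart_decomposition:
      "x \<in> carrier M \<Longrightarrow>
        \<exists>!c. c \<in> (\<Pi>\<^sub>E \<gamma> \<in> carrier G. hpart M \<gamma>) \<and>
             finite {\<gamma> \<in> carrier G. c \<gamma> \<noteq> \<zero>\<^bsub>M\<^esub>} \<and>
             x = finsum M c {\<gamma> \<in> carrier G. c \<gamma> \<noteq> \<zero>\<^bsub>M\<^esub>}"
    and hpart_smult:
      "\<lbrakk> \<gamma> \<in> carrier G; \<delta> \<in> carrier G; a \<in> hpart R \<gamma>; x \<in> hpart M \<delta> \<rbrakk>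
        \<Longrightarrow> a \<odot>\<^bsub>M\<^esub> x \<in> hpart M (\<gamma> \<otimes>\<^bsub>G\<^esub> \<delta>)"

text \<open>
  The part \<open>M\<^sub>A\<close> of a graded module, the sum of the \<open>M\<^sub>\<gamma>\<close> with \<open>\<gamma> \<in> A\<close>. Applied to a graded ring
  and a submonoid \<open>\<Gamma>\<close> of the group of degrees it yields the subring \<open>R\<^sub>\<Gamma>\<close>.
\<close>
definition degree_part :: "('a, 'b, 'g) gmodule \<Rightarrow> 'g set \<Rightarrow> ('a, 'b, 'g) gmodule" where
  "degree_part M A = M
    \<lparr>carrier := {finsum M c F | c F. finite F \<and> F \<subseteq> A \<and> c \<in> (\<Pi> \<gamma> \<in> F. hpart M \<gamma>)},
     hpart := (\<lambda>\<gamma>. if \<gamma> \<in> A then hpart M \<gamma> else {\<zero>\<^bsub>M\<^esub>})\<rparr>"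

definition hgroup :: "('a, 'b, 'g) gmodule \<Rightarrow> 'g \<Rightarrow> 'b monoid" where
  "hgroup M \<gamma> = \<lparr>carrier = hpart M \<gamma>, monoid.mult = add M, one = \<zero>\<^bsub>M\<^esub>\<rparr>"

definition Supp :: "('g, 'x) monoid_scheme \<Rightarrow> ('a, 'b, 'g) gmodule \<Rightarrow> 'g set" where
  "Supp G M = {\<gamma> \<in> carrier G. hpart M \<gamma> \<noteq> {\<zero>\<^bsub>M\<^esub>}}"

text \<open>
  The quotient of a graded module by a graded submodule. Module records extend ring records; the
  fields \<open>monoid.mult\<close> and \<open>one\<close> of a module play no role and are left undefined, here and below.
\<close>
definition quot_module :: "('a, 'b, 'g) gmodule \<Rightarrow> 'b set \<Rightarrow> ('a, 'b set, 'g) gmodule" where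
  "quot_module M N =
    \<lparr>carrier = a_rcosets\<^bsub>M\<^esub> N,
     monoid.mult = undefined, one = undefined,
     zero = N,
     add = set_add M,
     smult = (\<lambda>a U. \<Union>x \<in> U. N +>\<^bsub>M\<^esub> (a \<odot>\<^bsub>M\<^esub> x)),
     hpart = (\<lambda>\<gamma>. {N +>\<^bsub>M\<^esub> x | x. x \<in> hpart M \<gamma>})\<rparr>"


section \<open>Graded polynomial rings\<close>

definition monom_deg :: "('g, 'x) monoid_scheme \<Rightarrow> (nat \<Rightarrow> 'g) \<Rightarrow> nat multiset \<Rightarrow> 'g" where
  "monom_deg G \<gamma> m = finprod G (\<lambda>i. \<gamma> i [^]\<^bsub>G\<^esub> count m i) (set_mset m)"

text \<open>
  The \<open>G\<close>-graded \<open>S\<close>-algebra \<open>S[X\<^sub>1, \<dots>, X\<^sub>n]\<close> with \<open>deg X\<^sub>i = \<gamma> i\<close> and \<open>deg s = 0\<close> for \<open>s\<close> in \<open>S\<close>. As in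
  the library, a monomial is the multiset of its variables and a polynomial maps monomials
  to coefficients.
\<close>
definition graded_poly_ring ::
  "('g, 'x) monoid_scheme \<Rightarrow> (nat \<Rightarrow> 'g) \<Rightarrow> ('s, 'y) ring_scheme \<Rightarrow> nat \<Rightarrow>
    ('s, nat multiset \<Rightarrow> 's, 'g) gmodule" where
  "graded_poly_ring G \<gamma> S n =
    \<lparr>carrier = ring.indexed_pset S {1..n} (carrier S),
     monoid.mult = (\<lambda>P Q m. finsum S (\<lambda>a. P a \<otimes>\<^bsub>S\<^esub> Q (m - a)) {a. a \<subseteq># m}),
     one = ring.indexed_const S \<one>\<^bsub>S\<^esub>,
     zero = ring.indexed_const S \<zero>\<^bsub>S\<^esub>,
     add = ring.indexed_padd S,
     smult = (\<lambda>s P m. s \<otimes>\<^bsub>S\<^esub> P m),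
     hpart = (\<lambda>\<delta>. {P \<in> ring.indexed_pset S {1..n} (carrier S).
                      \<forall>m. P m \<noteq> \<zero>\<^bsub>S\<^esub> \<longrightarrow> monom_deg G \<gamma> m = \<delta>})\<rparr>"


section \<open>Localization at one element\<close>

text \<open>
  The pair \<open>(m, k)\<close> represents the fraction \<open>m / g\<^sup>k\<close> in the localization of \<open>M\<close> at \<open>g\<close>.
\<close>
definition frac_rel ::
  "('a, 'r, 'g) gmodule \<Rightarrow> 'r \<Rightarrow> ('r, 'm, 'g) gmodule \<Rightarrow> (('m \<times> nat) \<times> ('m \<times> nat)) set" where
  "frac_rel A g M =
    {((m, k), (m', k')) | m k m' k'. m \<in> carrier M \<and> m' \<in> carrier M \<and>
       (\<exists>l::nat. (g [^]\<^bsub>A\<^esub> (l + k')) \<odot>\<^bsub>M\<^esub> m = (g [^]\<^bsub>A\<^esub> (l + k)) \<odot>\<^bsub>M\<^esub> m')}"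

definition frac ::
  "('a, 'r, 'g) gmodule \<Rightarrow> 'r \<Rightarrow> ('r, 'm, 'g) gmodule \<Rightarrow> 'm \<Rightarrow> nat \<Rightarrow> ('m \<times> nat) set" where
  "frac A g M m k = frac_rel A g M `` {(m, k)}"

text \<open>
  Degrees: \<open>m / g\<^sup>k\<close> has degree \<open>\<gamma>\<close> if \<open>m\<close> has degree \<open>\<gamma> + \<epsilon>\<close> where \<open>\<epsilon>\<close> is a degree of \<open>g\<^sup>k\<close>.
  This \<open>\<epsilon>\<close> is not unique only if \<open>g\<^sup>k = 0\<close>, and then the localization is zero.
\<close>
definition localize ::
  "('g, 'x) monoid_scheme \<Rightarrow> ('a, 'r, 'g) gmodule \<Rightarrow> 'r \<Rightarrow> ('r, 'm, 'g) gmodule \<Rightarrow>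
    ('r, ('m \<times> nat) set, 'g) gmodule" where
  "localize G A g M =
    \<lparr>carrier = {frac A g M m k | m k. m \<in> carrier M},
     monoid.mult = undefined, one = undefined,
     zero = frac A g M \<zero>\<^bsub>M\<^esub> 0,
     add = (\<lambda>U V. \<Union>(m, k) \<in> U. \<Union>(m', k') \<in> V.
        frac A g M (((g [^]\<^bsub>A\<^esub> k') \<odot>\<^bsub>M\<^esub> m) \<oplus>\<^bsub>M\<^esub> ((g [^]\<^bsub>A\<^esub> k) \<odot>\<^bsub>M\<^esub> m')) (k + k')),
     smult = (\<lambda>a U. \<Union>(m, k) \<in> U. frac A g M (a \<odot>\<^bsub>M\<^esub> m) k),
     hpart = (\<lambda>\<gamma>. {frac A g M m k | m k \<epsilon>. \<epsilon> \<in> carrier G \<and>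
        g [^]\<^bsub>A\<^esub> k \<in> hpart A \<epsilon> \<and> m \<in> hpart M (\<gamma> \<otimes>\<^bsub>G\<^esub> \<epsilon>)})\<rparr>"

text \<open>
  The map from the localization at \<open>g\<close> to the localization at \<open>h\<close> when \<open>h = g g'\<close>:
  \<open>m / g\<^sup>k\<close> goes to \<open>g'\<^sup>k m / h\<^sup>k\<close>.
\<close>
definition localize_more ::
  "('a, 'r, 'g) gmodule \<Rightarrow> ('r, 'm, 'g) gmodule \<Rightarrow> 'r \<Rightarrow> 'r \<Rightarrow> ('m \<times> nat) set \<Rightarrow> ('m \<times> nat) set"
  where
  "localize_more A M g' h U = (\<Union>(m, k) \<in> U. frac A h M ((g' [^]\<^bsub>A\<^esub> k) \<odot>\<^bsub>M\<^esub> m) k)"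

text \<open>The map of localizations induced by a homomorphism \<open>\<phi>\<close> into the module \<open>M\<close> over \<open>A\<close>.\<close>
definition localize_map ::
  "('n \<Rightarrow> 'm) \<Rightarrow> ('a, 'r, 'g) gmodule \<Rightarrow> ('r, 'm, 'g) gmodule \<Rightarrow> 'r \<Rightarrow>
    ('n \<times> nat) set \<Rightarrow> ('m \<times> nat) set" where
  "localize_map \<phi> A M g U = (\<Union>(m, k) \<in> U. frac A g M (\<phi> m) k)"


section \<open>Cech cohomology\<close>

text \<open>
  The Cech complex of a graded module \<open>M\<close> over a graded ring \<open>A\<close>, on the finite family
  \<open>f 0, \<dots>, f (r - 1)\<close> of homogeneous elements of \<open>A\<close>. In degree \<open>p\<close> it is the product of the localizations
  of \<open>M\<close> at \<open>\<Prod>j\<in>J. f j\<close>, over the subsets \<open>J\<close> of \<open>{..<r}\<close> with \<open>p\<close> elements; for \<open>p = 0\<close> this is the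
  localization of \<open>M\<close> at 1.
\<close>
definition cech_index :: "nat \<Rightarrow> nat \<Rightarrow> nat set set" where
  "cech_index r p = {J. J \<subseteq> {..<r} \<and> card J = p}"

abbreviation cech_loc ::
  "('g, 'x) monoid_scheme \<Rightarrow> ('a, 'r, 'g) gmodule \<Rightarrow> ('r, 'm, 'g) gmodule \<Rightarrow> (nat \<Rightarrow> 'r) \<Rightarrow>
    nat set \<Rightarrow> ('r, ('m \<times> nat) set, 'g) gmodule" where
  "cech_loc G A M f J \<equiv> localize G A (finprod A f J) M"

definition cech_cochains ::
  "('g, 'x) monoid_scheme \<Rightarrow> ('a, 'r, 'g) gmodule \<Rightarrow> ('r, 'm, 'g) gmodule \<Rightarrow> (nat \<Rightarrow> 'r) \<Rightarrow>
    nat \<Rightarrow> nat \<Rightarrow> ('r, nat set \<Rightarrow> ('m \<times> nat) set, 'g) gmodule" where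
  "cech_cochains G A M f r p =
    \<lparr>carrier = (\<Pi>\<^sub>E J \<in> cech_index r p. carrier (cech_loc G A M f J)),
     monoid.mult = undefined, one = undefined,
     zero = (\<lambda>J \<in> cech_index r p. \<zero>\<^bsub>cech_loc G A M f J\<^esub>),
     add = (\<lambda>x y. \<lambda>J \<in> cech_index r p. x J \<oplus>\<^bsub>cech_loc G A M f J\<^esub> y J),
     smult = (\<lambda>a x. \<lambda>J \<in> cech_index r p. a \<odot>\<^bsub>cech_loc G A M f J\<^esub> x J),
     hpart = (\<lambda>\<gamma>. \<Pi>\<^sub>E J \<in> cech_index r p. hpart (cech_loc G A M f J) \<gamma>)\<rparr>"

definition cech_diff ::
  "('g, 'x) monoid_scheme \<Rightarrow> ('a, 'r, 'g) gmodule \<Rightarrow> ('r, 'm, 'g) gmodule \<Rightarrow> (nat \<Rightarrow> 'r) \<Rightarrow>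
    nat \<Rightarrow> nat \<Rightarrow> (nat set \<Rightarrow> ('m \<times> nat) set) \<Rightarrow> (nat set \<Rightarrow> ('m \<times> nat) set)" where
  "cech_diff G A M f r p x =
    (\<lambda>J \<in> cech_index r (Suc p).
      finsum (cech_loc G A M f J)
        (\<lambda>j. let y = localize_more A M (f j) (finprod A f J) (x (J - {j}))
             in if even (card {i \<in> J. i < j}) then y else \<ominus>\<^bsub>cech_loc G A M f J\<^esub> y)
        J)"

definition cech_cocycles ::
  "('g, 'x) monoid_scheme \<Rightarrow> ('a, 'r, 'g) gmodule \<Rightarrow> ('r, 'm, 'g) gmodule \<Rightarrow> (nat \<Rightarrow> 'r) \<Rightarrow>
    nat \<Rightarrow> nat \<Rightarrow> ('r, nat set \<Rightarrow> ('m \<times> nat) set, 'g) gmodule" where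
  "cech_cocycles G A M f r p =
    (let C = cech_cochains G A M f r p;
         Z = {x \<in> carrier C. cech_diff G A M f r p x = \<zero>\<^bsub>cech_cochains G A M f r (Suc p)\<^esub>}
     in C\<lparr>carrier := Z, hpart := (\<lambda>\<gamma>. hpart C \<gamma> \<inter> Z)\<rparr>)"

definition cech_coboundaries ::
  "('g, 'x) monoid_scheme \<Rightarrow> ('a, 'r, 'g) gmodule \<Rightarrow> ('r, 'm, 'g) gmodule \<Rightarrow> (nat \<Rightarrow> 'r) \<Rightarrow>
    nat \<Rightarrow> nat \<Rightarrow> (nat set \<Rightarrow> ('m \<times> nat) set) set" where
  "cech_coboundaries G A M f r p =
    (case p of
       0 \<Rightarrow> {\<zero>\<^bsub>cech_cochains G A M f r 0\<^esub>}
     | Suc q \<Rightarrow> cech_diff G A M f r q ` carrier (cech_cochains G A M f r q))"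

definition cech_cohomology ::
  "('g, 'x) monoid_scheme \<Rightarrow> ('a, 'r, 'g) gmodule \<Rightarrow> ('r, 'm, 'g) gmodule \<Rightarrow> (nat \<Rightarrow> 'r) \<Rightarrow>
    nat \<Rightarrow> nat \<Rightarrow> ('r, (nat set \<Rightarrow> ('m \<times> nat) set) set, 'g) gmodule" where
  "cech_cohomology G A M f r p =
    quot_module (cech_cocycles G A M f r p) (cech_coboundaries G A M f r p)"

text \<open>
  The map on cohomology induced by a homomorphism \<open>\<phi>\<close> into the module \<open>M\<close> over \<open>A\<close>. Only
  the target enters the formula; the source may be a module over a graded subring of \<open>A\<close>
  containing the elements \<open>f j\<close>.
\<close>
definition cech_cohomology_map ::
  "('n \<Rightarrow> 'm) \<Rightarrow> ('g, 'x) monoid_scheme \<Rightarrow> ('a, 'r, 'g) gmodule \<Rightarrow> ('r, 'm, 'g) gmodule \<Rightarrow>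
    (nat \<Rightarrow> 'r) \<Rightarrow> nat \<Rightarrow> nat \<Rightarrow>
    (nat set \<Rightarrow> ('n \<times> nat) set) set \<Rightarrow> (nat set \<Rightarrow> ('m \<times> nat) set) set" where
  "cech_cohomology_map \<phi> G A M f r p U =
    (\<Union>x \<in> U. cech_coboundaries G A M f r p
        +>\<^bsub>cech_cocycles G A M f r p\<^esub>
          (\<lambda>J \<in> cech_index r p. localize_map \<phi> A M (finprod A f J) (x J)))"

text \<open>
  \<open>H\<^sup>0\<close> as a submodule of \<open>M\<close>: the kernel of the first differential, where \<open>m\<close> in \<open>M\<close> is identified
  with the 0-cochain \<open>m / 1\<close>.
\<close>
definition cech_H0_submodule ::
  "('g, 'x) monoid_scheme \<Rightarrow> ('a, 'r, 'g) gmodule \<Rightarrow> ('r, 'm, 'g) gmodule \<Rightarrow> (nat \<Rightarrow> 'r) \<Rightarrow>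
    nat \<Rightarrow> 'm set" where
  "cech_H0_submodule G A M f r =
    {m \<in> carrier M. (\<lambda>J \<in> cech_index r 0. frac A (finprod A f J) M m 0)
                       \<in> carrier (cech_cocycles G A M f r 0)}"

definition ideal_torsion ::
  "('a, 'r, 'g) gmodule \<Rightarrow> ('r, 'm, 'g) gmodule \<Rightarrow> (nat \<Rightarrow> 'r) \<Rightarrow> nat \<Rightarrow> bool" where
  "ideal_torsion A M f r \<longleftrightarrow>
    (\<forall>m \<in> carrier M. \<forall>j<r. \<exists>k::nat. (f j [^]\<^bsub>A\<^esub> k) \<odot>\<^bsub>M\<^esub> m = \<zero>\<^bsub>M\<^esub>)"

end

theory Submission
  imports Defs
begin

text \<open>
  Let \<open>g\<close> be a product of some of the \<open>f j\<close>. A fraction \<open>m / g\<^sup>k\<close> of degree \<open>\<gamma>\<close> has its numerator in degree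
  \<open>\<gamma> + k deg g\<close>. The nonzero \<open>f j\<close> have degrees in \<open>\<Gamma>\<close>, and those that are zero can be given
  degree 0, so only the part of a module with degrees in \<open>\<gamma> + \<Gamma>\<close> enters the Cech complex in degree \<open>\<gamma>\<close>.
  All claims result from comparing, in one degree \<open>\<gamma>\<close>, the complex of \<open>M\<close> with that of a submodule \<open>L\<close>.

  The map on cochains is injective. Hence it induces an isomorphism on \<open>H\<^sup>i\<close> in degree \<open>\<gamma>\<close> once it is
  onto in degree \<open>\<gamma>\<close> for the localizations with \<open>i - 1\<close> and \<open>i\<close> factors (\<open>cohomology_iso\<close>), and for this it
  suffices that powers of the denominators move numerators into \<open>L\<close> (\<open>loc_incl_onto\<close>). Cohomology of
  degree \<open>\<gamma>\<close> is formed modulo the coboundaries of all degrees; projecting a primitive to its part of degree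
  \<open>\<gamma>\<close> shows that a homogeneous coboundary has a homogeneous primitive (\<open>homogeneous_preimage\<close>).

  For \<open>L = M\<^sub>\<gamma>\<^sub>+\<^sub>Z\<^sub>\<Gamma>\<close> nothing changes in degree \<open>\<gamma>\<close>, which is (1). Let \<open>L = N = M\<^sub>\<SS>\<close>. If \<open>\<gamma>\<close> is not in \<open>\<SS> + Z\<Gamma>\<close>, then
  \<open>\<gamma> + \<Gamma>\<close> does not meet \<open>\<SS>\<close> and the cochains of \<open>N\<close> vanish, which is (2). If \<open>\<gamma>\<close> lies in \<open>\<SS>\<close>, so does all of \<open>\<gamma> + \<Gamma>\<close>,
  and the two complexes agree in degree \<open>\<gamma>\<close>. For \<open>\<gamma>\<close> in \<open>\<SS> + Z\<Gamma>\<close> but not in \<open>\<SS>\<close> there are no 0-cochains of \<open>N\<close>,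
  while the torsion hypothesis makes the cochains with at least one factor in the denominator agree
  (\<open>loc_incl_onto_torsion\<close>). This gives (3) and (5). It also identifies \<open>H\<^sup>1(N)\<close> with the 1-cocycles
  of \<open>M\<close>: these are nonzero if and only if \<open>H\<^sup>1(M)\<close> is nonzero or some element of degree \<open>\<gamma>\<close> has
  nonzero differential, that is, does not lie in \<open>H\<^sup>0(M)\<close> (\<open>H1_nontrivial_iff\<close>). This is (4).
\<close>

section \<open>Localization at one element\<close>

locale localization = module A M
  for A :: "('a, 'r, 'g) gmodule" and M :: "('r, 'm, 'g) gmodule" +
  fixes g :: 'r
  assumes g_closed [simp]: "g \<in> carrier A"
begin

lemma pow_smult_pow:
  "m \<in> carrier M \<Longrightarrow>
    (g [^]\<^bsub>A\<^esub> (i::nat)) \<odot>\<^bsub>M\<^esub> ((g [^]\<^bsub>A\<^esub> (j::nat)) \<odot>\<^bsub>M\<^esub> m) = (g [^]\<^bsub>A\<^esub> (i + j)) \<odot>\<^bsub>M\<^esub> m"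
  by (simp add: smult_assoc1 [symmetric] R.nat_pow_mult)

lemma pow_smult_closed: "m \<in> carrier M \<Longrightarrow> (g [^]\<^bsub>A\<^esub> (k::nat)) \<odot>\<^bsub>M\<^esub> m \<in> carrier M"
  by simp

lemma frac_rel_iff:
  "((m, k), (m', k')) \<in> frac_rel A g M \<longleftrightarrow> m \<in> carrier M \<and> m' \<in> carrier M \<and>
    (\<exists>l::nat. (g [^]\<^bsub>A\<^esub> (l + k')) \<odot>\<^bsub>M\<^esub> m = (g [^]\<^bsub>A\<^esub> (l + k)) \<odot>\<^bsub>M\<^esub> m')"
  by (auto simp: frac_rel_def)

lemma equiv_frac_rel: "equiv (carrier M \<times> UNIV) (frac_rel A g M)"
proof (rule equivI)
  show "frac_rel A g M \<subseteq> (carrier M \<times> UNIV) \<times> (carrier M \<times> UNIV)"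
    by (auto simp: frac_rel_def)
  show "refl_on (carrier M \<times> UNIV) (frac_rel A g M)"
    by (auto simp: refl_on_def frac_rel_iff)
  show "sym (frac_rel A g M)"
  proof (rule symI)
    fix u v assume "(u, v) \<in> frac_rel A g M"
    then show "(v, u) \<in> frac_rel A g M"
      by (cases u; cases v) (simp add: frac_rel_iff, metis)
  qed
  show "trans (frac_rel A g M)"
  proof (rule transI)
    fix u v w
    assume "(u, v) \<in> frac_rel A g M" "(v, w) \<in> frac_rel A g M"
    moreover obtain m k m' k' m'' k'' where u: "u = (m, k)" "v = (m', k')" "w = (m'', k'')"
      by (metis surj_pair)
    ultimately obtain l l' :: nat where m: "m \<in> carrier M" "m' \<in> carrier M" "m'' \<in> carrier M"
      and l: "(g [^]\<^bsub>A\<^esub> (l + k')) \<odot>\<^bsub>M\<^esub> m = (g [^]\<^bsub>A\<^esub> (l + k)) \<odot>\<^bsub>M\<^esub> m'"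
      and l': "(g [^]\<^bsub>A\<^esub> (l' + k'')) \<odot>\<^bsub>M\<^esub> m' = (g [^]\<^bsub>A\<^esub> (l' + k')) \<odot>\<^bsub>M\<^esub> m''"
      by (auto simp: frac_rel_iff)
    have "(g [^]\<^bsub>A\<^esub> ((l + l' + k') + k'')) \<odot>\<^bsub>M\<^esub> m
        = (g [^]\<^bsub>A\<^esub> (l' + k'')) \<odot>\<^bsub>M\<^esub> ((g [^]\<^bsub>A\<^esub> (l + k')) \<odot>\<^bsub>M\<^esub> m)"
      using m by (simp add: pow_smult_pow add_ac)
    also have "\<dots> = (g [^]\<^bsub>A\<^esub> (l + k)) \<odot>\<^bsub>M\<^esub> ((g [^]\<^bsub>A\<^esub> (l' + k'')) \<odot>\<^bsub>M\<^esub> m')"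
      unfolding l using m by (simp add: pow_smult_pow add_ac)
    also have "\<dots> = (g [^]\<^bsub>A\<^esub> ((l + l' + k') + k)) \<odot>\<^bsub>M\<^esub> m''"
      unfolding l' using m by (simp add: pow_smult_pow add_ac)
    finally show "(u, w) \<in> frac_rel A g M"
      using m unfolding u frac_rel_iff by blast
  qed
qed

lemma frac_eq_iff:
  assumes "m \<in> carrier M" "m' \<in> carrier M"
  shows "frac A g M m k = frac A g M m' k' \<longleftrightarrow>
    (\<exists>l::nat. (g [^]\<^bsub>A\<^esub> (l + k')) \<odot>\<^bsub>M\<^esub> m = (g [^]\<^bsub>A\<^esub> (l + k)) \<odot>\<^bsub>M\<^esub> m')"
  unfolding frac_def using assms by (simp add: eq_equiv_class_iff [OF equiv_frac_rel] frac_rel_iff)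

lemma mem_fracD:
  assumes "(m', k') \<in> frac A g M m k"
  shows "m' \<in> carrier M" and "frac A g M m' k' = frac A g M m k"
proof -
  have *: "((m, k), (m', k')) \<in> frac_rel A g M"
    using assms by (simp add: frac_def)
  then show "m' \<in> carrier M" by (simp add: frac_rel_iff)
  show "frac A g M m' k' = frac A g M m k"
    unfolding frac_def by (rule equiv_class_eq [OF equiv_frac_rel *, symmetric])
qed

text \<open>
  The operations on fractions are unions over all representatives; such a union collapses
  to its value at one representative as soon as the value does not depend on the choice.
\<close>
lemma UN_frac:
  assumes "m \<in> carrier M"
    and "\<And>m' k'. \<lbrakk> m' \<in> carrier M; frac A g M m' k' = frac A g M m k \<rbrakk> \<Longrightarrow> F m' k' = F m k"
  shows "(\<Union>(m', k') \<in> frac A g M m k. F m' k') = F m k"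
proof -
  have "(m, k) \<in> frac A g M m k"
    using assms(1) by (auto simp: frac_def frac_rel_iff)
  moreover have "(case z of (m', k') \<Rightarrow> F m' k') = F m k" if "z \<in> frac A g M m k" for z
    using that assms(2) mem_fracD by (cases z) simp
  ultimately show ?thesis by (intro UN_constant_eq) simp_all
qed

text \<open>
  Fractions can be expanded, so two of them always have a common denominator. This reduces the
  group laws of the localization to those of numerators.
\<close>
lemma frac_cancel:
  "m \<in> carrier M \<Longrightarrow> frac A g M ((g [^]\<^bsub>A\<^esub> (l::nat)) \<odot>\<^bsub>M\<^esub> m) (l + k) = frac A g M m k"
  by (auto simp: frac_eq_iff pow_smult_pow add_ac)

lemma carrier_localize: "carrier (localize G A g M) = {frac A g M m k | m k. m \<in> carrier M}"
  and zero_localize: "\<zero>\<^bsub>localize G A g M\<^esub> = frac A g M \<zero>\<^bsub>M\<^esub> 0"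
  by (simp_all add: localize_def)

lemma frac_closed: "m \<in> carrier M \<Longrightarrow> frac A g M m k \<in> carrier (localize G A g M)"
  by (auto simp: carrier_localize)

lemma frac_zero: "frac A g M \<zero>\<^bsub>M\<^esub> k = \<zero>\<^bsub>localize G A g M\<^esub>"
  by (auto simp: zero_localize frac_eq_iff)

text \<open>
  If \<open>m / g\<^sup>k = n / g\<^sup>j\<close>, the equation that witnesses this, multiplied by a power of \<open>g\<close>, also identifies
  the two sums with \<open>m' / g\<^sup>i\<close>; commutativity gives independence of the second representative.
\<close>
lemma add_frac:
  assumes "m \<in> carrier M" "m' \<in> carrier M"
  shows "frac A g M m k \<oplus>\<^bsub>localize G A g M\<^esub> frac A g M m' k' =
    frac A g M (((g [^]\<^bsub>A\<^esub> k') \<odot>\<^bsub>M\<^esub> m) \<oplus>\<^bsub>M\<^esub> ((g [^]\<^bsub>A\<^esub> k) \<odot>\<^bsub>M\<^esub> m')) (k + k')"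
proof -
  let ?F = "\<lambda>m k m' k'.
    frac A g M (((g [^]\<^bsub>A\<^esub> k') \<odot>\<^bsub>M\<^esub> m) \<oplus>\<^bsub>M\<^esub> ((g [^]\<^bsub>A\<^esub> k) \<odot>\<^bsub>M\<^esub> m')) (k + k')"
  have left: "?F n j m' k' = ?F m k m' k'"
    if mn: "m \<in> carrier M" "m' \<in> carrier M" "n \<in> carrier M"
      and eq: "frac A g M n j = frac A g M m k"
    for n j m k m' k'
  proof -
    obtain l :: nat where l: "(g [^]\<^bsub>A\<^esub> (l + k)) \<odot>\<^bsub>M\<^esub> n = (g [^]\<^bsub>A\<^esub> (l + j)) \<odot>\<^bsub>M\<^esub> m"
      using mn eq frac_eq_iff [of n m j k] by blast
    have "(g [^]\<^bsub>A\<^esub> (l + k + k' + k')) \<odot>\<^bsub>M\<^esub> n = (g [^]\<^bsub>A\<^esub> (l + j + k' + k')) \<odot>\<^bsub>M\<^esub> m"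
      using arg_cong [OF l, of "\<lambda>x. (g [^]\<^bsub>A\<^esub> (k' + k')) \<odot>\<^bsub>M\<^esub> x"] mn
      by (simp add: pow_smult_pow add_ac)
    then show ?thesis
      using mn
      by (subst frac_eq_iff) (auto intro!: exI [of _ l] simp: smult_r_distr pow_smult_pow add_ac)
  qed
  have right: "?F m k n j = ?F m k m' k'"
    if "m \<in> carrier M" "m' \<in> carrier M" "n \<in> carrier M" "frac A g M n j = frac A g M m' k'"
    for n j m k m' k'
    using left [of m' m n j k' k] that by (simp add: M.a_comm add.commute)
  have "(\<Union>(m2, k2) \<in> frac A g M m' k'. ?F n j m2 k2) = ?F n j m' k'"
    if "n \<in> carrier M" for n j
    using assms that right by (intro UN_frac) blast+
  then have "(\<Union>(m1, k1) \<in> frac A g M m k. \<Union>(m2, k2) \<in> frac A g M m' k'. ?F m1 k1 m2 k2)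
      = (\<Union>(m1, k1) \<in> frac A g M m k. ?F m1 k1 m' k')"
    by (intro SUP_cong) (auto dest: mem_fracD)
  also have "\<dots> = ?F m k m' k'"
    using assms left by (intro UN_frac) blast+
  finally show ?thesis by (simp add: localize_def)
qed

lemma add_frac_same:
  assumes "m \<in> carrier M" "m' \<in> carrier M"
  shows "frac A g M m k \<oplus>\<^bsub>localize G A g M\<^esub> frac A g M m' k = frac A g M (m \<oplus>\<^bsub>M\<^esub> m') k"
  using frac_cancel [of "m \<oplus>\<^bsub>M\<^esub> m'" k k] assms by (simp add: add_frac smult_r_distr)

lemma common_denominator:
  assumes "u \<in> carrier (localize G A g M)" "v \<in> carrier (localize G A g M)"
  obtains m m' k where "m \<in> carrier M" "m' \<in> carrier M"
    "u = frac A g M m k" "v = frac A g M m' k"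
proof -
  obtain m i m' j where *: "m \<in> carrier M" "m' \<in> carrier M" "u = frac A g M m i" "v = frac A g M m' j"
    using assms by (auto simp: carrier_localize)
  then have "u = frac A g M ((g [^]\<^bsub>A\<^esub> j) \<odot>\<^bsub>M\<^esub> m) (j + i)" "v = frac A g M ((g [^]\<^bsub>A\<^esub> i) \<odot>\<^bsub>M\<^esub> m') (j + i)"
    using frac_cancel [of m j i] frac_cancel [of m' i j] by (simp_all add: add.commute)
  then show thesis using * that pow_smult_closed by blast
qed

lemma abelian_group_localize: "abelian_group (localize G A g M)"
proof (rule abelian_groupI)
  let ?L = "localize G A g M"
  show "\<zero>\<^bsub>?L\<^esub> \<in> carrier ?L"
    by (simp add: zero_localize frac_closed)
  fix x assume x: "x \<in> carrier ?L"
  then obtain m k where m: "m \<in> carrier M" "x = frac A g M m k"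
    by (auto simp: carrier_localize)
  show "\<zero>\<^bsub>?L\<^esub> \<oplus>\<^bsub>?L\<^esub> x = x"
    using m by (simp add: frac_zero [of k, symmetric] add_frac_same)
  have "frac A g M (\<ominus>\<^bsub>M\<^esub> m) k \<oplus>\<^bsub>?L\<^esub> x = \<zero>\<^bsub>?L\<^esub>"
    using m by (simp add: add_frac_same M.l_neg frac_zero)
  then show "\<exists>y \<in> carrier ?L. y \<oplus>\<^bsub>?L\<^esub> x = \<zero>\<^bsub>?L\<^esub>"
    using m frac_closed by blast
  fix y assume y: "y \<in> carrier ?L"
  show "x \<oplus>\<^bsub>?L\<^esub> y \<in> carrier ?L" "x \<oplus>\<^bsub>?L\<^esub> y = y \<oplus>\<^bsub>?L\<^esub> x"
    using common_denominator [OF x y]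
    by (metis M.a_closed add_frac_same frac_closed, metis M.a_comm add_frac_same)
  fix z assume z: "z \<in> carrier ?L"
  then obtain n j where n: "n \<in> carrier M" "z = frac A g M n j"
    by (auto simp: carrier_localize)
  obtain a b i where ab: "a \<in> carrier M" "b \<in> carrier M" "x = frac A g M a i" "y = frac A g M b i"
    using common_denominator [OF x y] by metis
  let ?p = "\<lambda>k. smult M (g [^]\<^bsub>A\<^esub> (k::nat))"
  have "x = frac A g M (?p j a) (j + i)" "y = frac A g M (?p j b) (j + i)"
    "z = frac A g M (?p i n) (j + i)"
    using ab n frac_cancel [of a j i] frac_cancel [of b j i] frac_cancel [of n i j]
    by (simp_all add: add.commute)
  then show "x \<oplus>\<^bsub>?L\<^esub> y \<oplus>\<^bsub>?L\<^esub> z = x \<oplus>\<^bsub>?L\<^esub> (y \<oplus>\<^bsub>?L\<^esub> z)"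
    using ab n by (simp add: add_frac_same M.a_assoc)
qed

end

text \<open>
  The maps between localizations that occur below all send \<open>m / g\<^sup>k\<close> to \<open>\<theta>\<^sub>k(m) / h\<^sup>k\<close> for a family
  of additive maps \<open>\<theta>\<^sub>k\<close>: further localization multiplies numerators by a power,
  the map induced by a module homomorphism has a constant family, and the projection to
  a homogeneous part projects the numerator to a degree that depends on \<open>k\<close>.
\<close>
definition frac_map ::
  "('a, 'r, 'g) gmodule \<Rightarrow> 'r \<Rightarrow> ('r, 'm, 'g) gmodule \<Rightarrow> (nat \<Rightarrow> 'n \<Rightarrow> 'm) \<Rightarrow>
    ('n \<times> nat) set \<Rightarrow> ('m \<times> nat) set" where
  "frac_map A h M \<theta> U = (\<Union>(m, k) \<in> U. frac A h M (\<theta> k m) k)"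

lemma localize_more_eq_frac_map:
  "localize_more A M a h = frac_map A h M (\<lambda>k m. (a [^]\<^bsub>A\<^esub> k) \<odot>\<^bsub>M\<^esub> m)"
  by (simp add: localize_more_def frac_map_def fun_eq_iff)

lemma localize_map_eq_frac_map: "localize_map \<phi> A M g = frac_map A g M (\<lambda>k. \<phi>)"
  by (simp add: localize_map_def frac_map_def fun_eq_iff)

text \<open>
  The condition \<open>shift\<close> says that \<open>\<theta>\<close> is compatible with expanding fractions. With additivity it makes the
  map on fractions well defined: an equation \<open>g\<^sup>a m = g\<^sup>b m'\<close> between numerators is carried by a single
  \<open>\<theta>\<^sub>i\<close> to the corresponding equation between their images.
\<close>
locale frac_family = src: localization A L g + tgt: localization A' M h
  for A :: "('a, 'r, 'g) gmodule" and L :: "('r, 'n, 'g) gmodule" and g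
    and A' :: "('b, 's, 'g) gmodule" and M :: "('s, 'm, 'g) gmodule" and h +
  fixes \<theta> :: "nat \<Rightarrow> 'n \<Rightarrow> 'm"
  assumes closed: "m \<in> carrier L \<Longrightarrow> \<theta> k m \<in> carrier M"
    and additive: "\<lbrakk> m \<in> carrier L; m' \<in> carrier L \<rbrakk> \<Longrightarrow> \<theta> k (m \<oplus>\<^bsub>L\<^esub> m') = \<theta> k m \<oplus>\<^bsub>M\<^esub> \<theta> k m'"
    and shift: "m \<in> carrier L \<Longrightarrow> \<theta> (l + k) ((g [^]\<^bsub>A\<^esub> l) \<odot>\<^bsub>L\<^esub> m) = (h [^]\<^bsub>A'\<^esub> l) \<odot>\<^bsub>M\<^esub> \<theta> k m"
begin

lemma frac_map_frac:
  assumes "m \<in> carrier L"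
  shows "frac_map A' h M \<theta> (frac A g L m k) = frac A' h M (\<theta> k m) k"
  unfolding frac_map_def
proof (rule src.UN_frac [OF assms])
  fix m' k' assume m': "m' \<in> carrier L" "frac A g L m' k' = frac A g L m k"
  then obtain l where l: "(g [^]\<^bsub>A\<^esub> (l + k)) \<odot>\<^bsub>L\<^esub> m' = (g [^]\<^bsub>A\<^esub> (l + k')) \<odot>\<^bsub>L\<^esub> m"
    using assms by (auto simp: src.frac_eq_iff)
  have "(h [^]\<^bsub>A'\<^esub> (l + k)) \<odot>\<^bsub>M\<^esub> \<theta> k' m' = (h [^]\<^bsub>A'\<^esub> (l + k')) \<odot>\<^bsub>M\<^esub> \<theta> k m"
    using shift [OF m'(1), of "l + k" k'] shift [OF assms, of "l + k'" k] l by (simp add: add_ac)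
  then show "frac A' h M (\<theta> k' m') k' = frac A' h M (\<theta> k m) k"
    using m' assms closed by (auto simp: tgt.frac_eq_iff)
qed

lemma hom_frac_map: "abelian_group_hom (localize G A g L) (localize G' A' h M) (frac_map A' h M \<theta>)"
proof -
  interpret L: abelian_group "localize G A g L" by (rule src.abelian_group_localize)
  interpret M: abelian_group "localize G' A' h M" by (rule tgt.abelian_group_localize)
  show ?thesis
  proof (rule abelian_group_homI)
    show "abelian_group (localize G A g L)" "abelian_group (localize G' A' h M)"
      by unfold_locales
    show "group_hom (add_monoid (localize G A g L)) (add_monoid (localize G' A' h M)) (frac_map A' h M \<theta>)"
    proof (rule group_hom.intro)
      show "group_hom_axioms (add_monoid (localize G A g L)) (add_monoid (localize G' A' h M)) (frac_map A' h M \<theta>)"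
      proof (rule group_hom_axioms.intro, rule homI)
        fix x assume "x \<in> carrier (add_monoid (localize G A g L))"
        then show "frac_map A' h M \<theta> x \<in> carrier (add_monoid (localize G' A' h M))"
          by (auto simp: src.carrier_localize frac_map_frac intro!: tgt.frac_closed closed)
      next
        fix x y
        assume xy: "x \<in> carrier (add_monoid (localize G A g L))" "y \<in> carrier (add_monoid (localize G A g L))"
        obtain m m' k where "m \<in> carrier L" "m' \<in> carrier L"
          "x = frac A g L m k" "y = frac A g L m' k"
          using src.common_denominator xy by (metis monoid.select_convs(1) partial_object.select_convs(1))
        then show "frac_map A' h M \<theta> (x \<otimes>\<^bsub>add_monoid (localize G A g L)\<^esub> y) =
            frac_map A' h M \<theta> x \<otimes>\<^bsub>add_monoid (localize G' A' h M)\<^esub> frac_map A' h M \<theta> y"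
          by (simp add: src.add_frac_same tgt.add_frac_same frac_map_frac closed additive)
      qed
    qed (rule L.a_group M.a_group)+
  qed
qed

end

section \<open>Additive maps and quotients of abelian groups\<close>

lemma additive_mapI:
  assumes "abelian_group C" "abelian_group D"
    and "\<And>x. x \<in> carrier C \<Longrightarrow> h x \<in> carrier D"
    and "\<And>x y. \<lbrakk> x \<in> carrier C; y \<in> carrier C \<rbrakk> \<Longrightarrow> h (x \<oplus>\<^bsub>C\<^esub> y) = h x \<oplus>\<^bsub>D\<^esub> h y"
  shows "abelian_group_hom C D h"
  using assms
  by (intro abelian_group_homI group_hom.intro group_hom_axioms.intro homI)
    (auto intro: abelian_group.a_group)

lemma additive_subgroup_criterion:
  assumes "abelian_group C" "V \<subseteq> carrier C" "\<zero>\<^bsub>C\<^esub> \<in> V"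
    and "\<And>x y. \<lbrakk> x \<in> V; y \<in> V \<rbrakk> \<Longrightarrow> x \<oplus>\<^bsub>C\<^esub> y \<in> V"
    and "\<And>x. x \<in> V \<Longrightarrow> \<ominus>\<^bsub>C\<^esub> x \<in> V"
  shows "additive_subgroup V C"
proof -
  interpret C: abelian_group C by fact
  show ?thesis
    using assms by (intro additive_subgroupI subgroup.intro) (auto simp: a_inv_def)
qed

context abelian_group_hom
begin

lemma hom_finsum:
  "\<lbrakk> finite I; u \<in> I \<rightarrow> carrier G \<rbrakk> \<Longrightarrow> h (finsum G u I) = finsum H (\<lambda>i. h (u i)) I"
proof (induction I rule: finite_induct)
  case (insert i I)
  then have "u i \<in> carrier G" "u \<in> I \<rightarrow> carrier G" by auto
  with insert show ?case by (auto simp: Pi_iff)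
qed simp

lemma image_subgroup:
  assumes "additive_subgroup V G"
  shows "additive_subgroup (h ` V) H"
  using group_hom.subgroup_img_is_subgroup [OF a_group_hom additive_subgroup.a_subgroup [OF assms]]
  by (rule additive_subgroupI)

lemma vimage_subgroup:
  assumes "additive_subgroup W H"
  shows "additive_subgroup {x \<in> carrier G. h x \<in> W} G"
proof -
  interpret W: additive_subgroup W H by fact
  show ?thesis
    by (rule additive_subgroup_criterion) (auto simp: G.abelian_group_axioms)
qed

lemma hom_uminus: "abelian_group_hom G H (\<lambda>x. \<ominus>\<^bsub>H\<^esub> h x)"
  by (rule additive_mapI) (simp_all add: G.abelian_group_axioms H.abelian_group_axioms H.minus_add)

end

lemma (in abelian_group) carrier_additive_subgroup: "additive_subgroup (carrier G) G"
  by (rule additive_subgroup_criterion) (simp_all add: abelian_group_axioms)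

lemma (in abelian_group) zero_additive_subgroup: "additive_subgroup {\<zero>} G"
  by (rule additive_subgroup_criterion) (simp_all add: abelian_group_axioms)

lemma (in abelian_group) additive_subgroup_Int:
  assumes "additive_subgroup V G" "additive_subgroup W G"
  shows "additive_subgroup (V \<inter> W) G"
proof -
  interpret V: additive_subgroup V G by fact
  interpret W: additive_subgroup W G by fact
  show ?thesis
    by (rule additive_subgroup_criterion) (auto simp: abelian_group_axioms V.a_inv_closed W.a_inv_closed)
qed

lemma (in abelian_group) coset_eq_iff:
  assumes "additive_subgroup B G" "x \<in> carrier G" "y \<in> carrier G"
  shows "B +> x = B +> y \<longleftrightarrow> x \<ominus> y \<in> B"
proof -
  interpret B: abelian_subgroup B G
    using assms(1) by (rule abelian_subgroupI3) (rule abelian_group_axioms)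
  show ?thesis
    using B.a_rcos_module [OF assms(3,2)] B.a_repr_independence' [OF _ assms(3)]
      B.a_rcos_self [OF assms(2)] unfolding minus_eq by auto
qed

lemma (in abelian_group) coset_eq_self_iff:
  assumes "additive_subgroup B G" "x \<in> carrier G"
  shows "B +> x = B \<longleftrightarrow> x \<in> B"
  using coset_eq_iff [OF assms(1,2) zero_closed] assms additive_subgroup.a_subset [OF assms(1)]
  by (simp add: minus_eq a_inv_def)

text \<open>
  A homomorphism that is injective on a subgroup \<open>V\<close> of cocycles modulo the coboundaries \<open>B\<close>, \<open>E\<close>
  and maps \<open>V\<close> onto the target cocycles \<open>W\<close> induces an isomorphism of the images of \<open>V\<close> and \<open>W\<close> in
  the quotients. Here \<open>V\<close> and \<open>W\<close> are the cocycles of one degree, whereas \<open>B\<close> and \<open>E\<close> consist of the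
  coboundaries of all degrees together, so that the cosets of \<open>B\<close> need not be subsets of \<open>V\<close>.
\<close>
lemma coset_map_iso:
  assumes hom: "abelian_group_hom C D \<phi>"
    and B: "additive_subgroup B C" and E: "additive_subgroup E D"
    and V: "additive_subgroup V C"
    and W: "W = \<phi> ` V"
    and BE: "\<phi> ` B \<subseteq> E"
    and inj: "\<And>x. \<lbrakk> x \<in> V; \<phi> x \<in> E \<rbrakk> \<Longrightarrow> x \<in> B"
  shows "(\<lambda>U. \<Union>x \<in> U. E +>\<^bsub>D\<^esub> \<phi> x)
     \<in> iso \<lparr>carrier = {B +>\<^bsub>C\<^esub> x | x. x \<in> V}, monoid.mult = set_add C, one = B\<rparr>
           \<lparr>carrier = {E +>\<^bsub>D\<^esub> x | x. x \<in> W}, monoid.mult = set_add D, one = E\<rparr>"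
    (is "?F \<in> iso ?P ?Q")
proof -
  interpret abelian_group_hom C D \<phi> by fact
  interpret B: abelian_subgroup B C
    using B by (rule abelian_subgroupI3) (rule G.abelian_group_axioms)
  interpret E: abelian_subgroup E D
    using E by (rule abelian_subgroupI3) (rule H.abelian_group_axioms)
  interpret V: additive_subgroup V C by fact
  have F: "?F (B +>\<^bsub>C\<^esub> x) = E +>\<^bsub>D\<^esub> \<phi> x" if x: "x \<in> carrier C" for x
  proof -
    have "E +>\<^bsub>D\<^esub> \<phi> y = E +>\<^bsub>D\<^esub> \<phi> x" if "y \<in> B +>\<^bsub>C\<^esub> x" for y
    proof -
      obtain b where b: "b \<in> B" "y = b \<oplus>\<^bsub>C\<^esub> x"
        using \<open>y \<in> B +>\<^bsub>C\<^esub> x\<close> by (auto simp: a_r_coset_def')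
      then have "\<phi> y \<ominus>\<^bsub>D\<^esub> \<phi> x = \<phi> b"
        using x by (simp add: H.minus_eq H.a_assoc H.r_neg)
      then show ?thesis
        using b x BE by (subst H.coset_eq_iff [OF E]) auto
    qed
    moreover have "x \<in> B +>\<^bsub>C\<^esub> x" using x by (rule B.a_rcos_self)
    ultimately show ?thesis by blast
  qed
  show ?thesis
  proof (rule isoI)
    show "?F \<in> hom ?P ?Q"
    proof (rule homI)
      fix U assume "U \<in> carrier ?P"
      then obtain x where "x \<in> V" "U = B +>\<^bsub>C\<^esub> x" by auto
      then have "?F U = E +>\<^bsub>D\<^esub> \<phi> x" "\<phi> x \<in> W" using F W by auto
      then show "?F U \<in> carrier ?Q" by auto
    next
      fix U U' assume "U \<in> carrier ?P" "U' \<in> carrier ?P"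
      then obtain x y where xy: "x \<in> V" "y \<in> V" "U = B +>\<^bsub>C\<^esub> x" "U' = B +>\<^bsub>C\<^esub> y"
        by auto
      then have "?F (U <+>\<^bsub>C\<^esub> U') = ?F U <+>\<^bsub>D\<^esub> ?F U'"
        by (simp only: B.a_rcos_sum E.a_rcos_sum F V.a_Hcarr G.a_closed hom_closed hom_add)
      then show "?F (U \<otimes>\<^bsub>?P\<^esub> U') = ?F U \<otimes>\<^bsub>?Q\<^esub> ?F U'" by simp
    qed
    show "bij_betw ?F (carrier ?P) (carrier ?Q)"
    proof (rule bij_betw_imageI)
      show "inj_on ?F (carrier ?P)"
      proof (rule inj_onI)
        fix U U' assume "U \<in> carrier ?P" "U' \<in> carrier ?P" and eq: "?F U = ?F U'"
        then obtain x y where xy: "x \<in> V" "y \<in> V" "U = B +>\<^bsub>C\<^esub> x" "U' = B +>\<^bsub>C\<^esub> y"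
          by auto
        then have c: "x \<in> carrier C" "y \<in> carrier C" by auto
        have "E +>\<^bsub>D\<^esub> \<phi> x = E +>\<^bsub>D\<^esub> \<phi> y" using eq unfolding xy by (simp only: F c)
        then have "\<phi> (x \<ominus>\<^bsub>C\<^esub> y) \<in> E"
          using c by (simp add: H.coset_eq_iff [OF E] G.minus_eq H.minus_eq)
        moreover have "x \<ominus>\<^bsub>C\<^esub> y \<in> V"
          using xy V.a_inv_closed unfolding G.minus_eq by auto
        ultimately show "U = U'"
          unfolding xy using c inj by (subst G.coset_eq_iff [OF B]) auto
      qed
      show "?F ` carrier ?P = carrier ?Q"
      proof
        show "?F ` carrier ?P \<subseteq> carrier ?Q"
        proof
          fix U' assume "U' \<in> ?F ` carrier ?P"
          then obtain x where "x \<in> V" "U' = ?F (B +>\<^bsub>C\<^esub> x)" by auto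
          then have "U' = E +>\<^bsub>D\<^esub> \<phi> x" "\<phi> x \<in> W" using F W by auto
          then show "U' \<in> carrier ?Q" by auto
        qed
        show "carrier ?Q \<subseteq> ?F ` carrier ?P"
        proof
          fix U assume "U \<in> carrier ?Q"
          then obtain x where "x \<in> V" "U = E +>\<^bsub>D\<^esub> \<phi> x" using W by auto
          then have "U = ?F (B +>\<^bsub>C\<^esub> x)" "B +>\<^bsub>C\<^esub> x \<in> carrier ?P"
            using F by auto
          then show "U \<in> ?F ` carrier ?P" by blast
        qed
      qed
    qed
  qed
qed

section \<open>The Cech complex\<close>

locale cech_complex = module A M
  for A :: "('a, 'r, 'g) gmodule" and M :: "('r, 'm, 'g) gmodule" +
  fixes G :: "('g, 'x) monoid_scheme" and f :: "nat \<Rightarrow> 'r" and r :: nat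
  assumes f_closed: "j < r \<Longrightarrow> f j \<in> carrier A"
begin

abbreviation denom :: "nat set \<Rightarrow> 'r" where "denom J \<equiv> finprod A f J"
abbreviation loc where "loc J \<equiv> cech_loc G A M f J"
abbreviation cochains where "cochains p \<equiv> cech_cochains G A M f r p"
abbreviation diff where "diff p \<equiv> cech_diff G A M f r p"
abbreviation coboundaries where "coboundaries p \<equiv> cech_coboundaries G A M f r p"
abbreviation cocycles where "cocycles p \<equiv> carrier (cech_cocycles G A M f r p)"

lemma denom_closed: "J \<subseteq> {..<r} \<Longrightarrow> denom J \<in> carrier A"
  by (rule R.finprod_closed) (auto intro: f_closed)

lemma localization_denom: "J \<subseteq> {..<r} \<Longrightarrow> localization A M (denom J)"
  by unfold_locales (rule denom_closed)

lemma abelian_group_loc: "J \<subseteq> {..<r} \<Longrightarrow> abelian_group (loc J)"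
  by (rule localization.abelian_group_localize [OF localization_denom])

lemma denom_remove:
  assumes "J \<subseteq> {..<r}" "j \<in> J"
  shows "denom J = f j \<otimes>\<^bsub>A\<^esub> denom (J - {j})"
proof -
  have "finite J" using assms(1) finite_subset by blast
  then have "denom (insert j (J - {j})) = f j \<otimes>\<^bsub>A\<^esub> denom (J - {j})"
    using assms by (intro R.finprod_insert) (auto intro: f_closed)
  then show ?thesis using assms(2) by (simp add: insert_absorb)
qed

abbreviation face_map where
  "face_map J j \<equiv> localize_more A M (f j) (denom J)"

text \<open>
  The denominator of \<open>J\<close> is \<open>f j\<close> times that of \<open>J - {j}\<close>, so expanding a fraction before or after passing
  to the larger denominator multiplies the numerator by the same power of both factors.
\<close>
lemma frac_family_face_map:
  assumes "J \<subseteq> {..<r}" "j \<in> J"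
  shows "frac_family A M (denom (J - {j})) A M (denom J) (\<lambda>k m. (f j [^]\<^bsub>A\<^esub> k) \<odot>\<^bsub>M\<^esub> m)"
proof -
  have J: "J - {j} \<subseteq> {..<r}" and fj: "f j \<in> carrier A" using assms f_closed by auto
  interpret src: localization A M "denom (J - {j})" by (rule localization_denom [OF J])
  interpret tgt: localization A M "denom J" by (rule localization_denom [OF assms(1)])
  define d where "d = denom (J - {j})"
  have d: "d \<in> carrier A" "denom J = f j \<otimes>\<^bsub>A\<^esub> d"
    using denom_closed [OF J] denom_remove [OF assms] by (simp_all add: d_def)
  show ?thesis
    unfolding d_def [symmetric]
  proof
    fix m and k l :: nat assume m: "m \<in> carrier M"
    have "f j [^]\<^bsub>A\<^esub> (l + k) \<otimes>\<^bsub>A\<^esub> d [^]\<^bsub>A\<^esub> l = denom J [^]\<^bsub>A\<^esub> l \<otimes>\<^bsub>A\<^esub> f j [^]\<^bsub>A\<^esub> k"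
      using fj d by (simp add: R.nat_pow_mult [symmetric] R.nat_pow_distrib R.m_ac)
    then show "(f j [^]\<^bsub>A\<^esub> (l + k)) \<odot>\<^bsub>M\<^esub> ((d [^]\<^bsub>A\<^esub> l) \<odot>\<^bsub>M\<^esub> m)
        = (denom J [^]\<^bsub>A\<^esub> l) \<odot>\<^bsub>M\<^esub> ((f j [^]\<^bsub>A\<^esub> k) \<odot>\<^bsub>M\<^esub> m)"
      using m fj d tgt.g_closed by (simp add: smult_assoc1 [symmetric])
  qed (use fj d in \<open>auto simp: smult_r_distr\<close>)
qed

lemma face_map_frac:
  assumes "J \<subseteq> {..<r}" "j \<in> J" "m \<in> carrier M"
  shows "face_map J j (frac A (denom (J - {j})) M m k) =
    frac A (denom J) M ((f j [^]\<^bsub>A\<^esub> k) \<odot>\<^bsub>M\<^esub> m) k"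
  unfolding localize_more_eq_frac_map
  by (rule frac_family.frac_map_frac [OF frac_family_face_map [OF assms(1,2)] assms(3)])

lemma face_map_hom:
  assumes "J \<subseteq> {..<r}" "j \<in> J"
  shows "abelian_group_hom (loc (J - {j})) (loc J) (face_map J j)"
  unfolding localize_more_eq_frac_map
  by (rule frac_family.hom_frac_map [OF frac_family_face_map [OF assms]])

definition signed_face_map where
  "signed_face_map J j y =
    (if even (card {i \<in> J. i < j}) then face_map J j y else \<ominus>\<^bsub>loc J\<^esub> face_map J j y)"

lemma signed_face_map_hom:
  assumes "J \<subseteq> {..<r}" "j \<in> J"
  shows "abelian_group_hom (loc (J - {j})) (loc J) (signed_face_map J j)"
  using face_map_hom [OF assms] abelian_group_hom.hom_uminus [OF face_map_hom [OF assms]]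
  by (cases "even (card {i \<in> J. i < j})") (simp_all add: signed_face_map_def [abs_def])

lemma diff_eq:
  "diff p x = (\<lambda>J \<in> cech_index r (Suc p).
    finsum (loc J) (\<lambda>j. signed_face_map J j (x (J - {j}))) J)"
  by (simp add: cech_diff_def signed_face_map_def Let_def)

lemma cech_index_subset: "J \<in> cech_index r p \<Longrightarrow> J \<subseteq> {..<r}"
  by (simp add: cech_index_def)

lemma cech_index_finite: "J \<in> cech_index r p \<Longrightarrow> finite J"
  using cech_index_subset finite_subset by blast

lemma cech_index_remove: "\<lbrakk> J \<in> cech_index r (Suc p); j \<in> J \<rbrakk> \<Longrightarrow> J - {j} \<in> cech_index r p"
  by (auto simp: cech_index_def)

lemma cochains_simps:
  "carrier (cochains p) = (\<Pi>\<^sub>E J \<in> cech_index r p. carrier (loc J))"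
  "\<zero>\<^bsub>cochains p\<^esub> = (\<lambda>J \<in> cech_index r p. \<zero>\<^bsub>loc J\<^esub>)"
  "x \<oplus>\<^bsub>cochains p\<^esub> y = (\<lambda>J \<in> cech_index r p. x J \<oplus>\<^bsub>loc J\<^esub> y J)"
  "hpart (cochains p) \<gamma> = (\<Pi>\<^sub>E J \<in> cech_index r p. hpart (loc J) \<gamma>)"
  by (simp_all add: cech_cochains_def)

lemma cochainD: "\<lbrakk> x \<in> carrier (cochains p); J \<in> cech_index r p \<rbrakk> \<Longrightarrow> x J \<in> carrier (loc J)"
  by (auto simp: cochains_simps)

lemma abelian_group_cochains: "abelian_group (cochains p)"
proof (rule abelian_groupI)
  have ab: "abelian_group (loc J)" if "J \<in> cech_index r p" for J
    using that abelian_group_loc cech_index_subset by blast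
  note am = ab [THEN abelian_group.axioms(1)]
  note laws = abelian_groupE(1-5) [OF ab] abelian_group.a_inv_closed [OF ab] abelian_group.l_neg [OF ab]
  show "\<zero>\<^bsub>cochains p\<^esub> \<in> carrier (cochains p)"
    unfolding cochains_simps by (rule restrict_PiE_iff [THEN iffD2]) (simp add: laws)
  fix x assume x: "x \<in> carrier (cochains p)"
  have "x \<in> extensional (cech_index r p)" using x by (simp add: cochains_simps PiE_def)
  then show "\<zero>\<^bsub>cochains p\<^esub> \<oplus>\<^bsub>cochains p\<^esub> x = x"
    unfolding cochains_simps
    by (rule extensionalityI [OF restrict_extensional]) (simp_all add: laws(5) cochainD [OF x])
  let ?y = "\<lambda>J \<in> cech_index r p. \<ominus>\<^bsub>loc J\<^esub> x J"
  have "?y \<in> carrier (cochains p)"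
    unfolding cochains_simps by (rule restrict_PiE_iff [THEN iffD2]) (simp add: laws cochainD [OF x])
  moreover have "?y \<oplus>\<^bsub>cochains p\<^esub> x = \<zero>\<^bsub>cochains p\<^esub>"
    unfolding cochains_simps by (rule restrict_ext) (simp add: laws(7) cochainD [OF x])
  ultimately show "\<exists>y \<in> carrier (cochains p). y \<oplus>\<^bsub>cochains p\<^esub> x = \<zero>\<^bsub>cochains p\<^esub>" by blast
  fix y assume y: "y \<in> carrier (cochains p)"
  show "x \<oplus>\<^bsub>cochains p\<^esub> y \<in> carrier (cochains p)"
    unfolding cochains_simps
    by (rule restrict_PiE_iff [THEN iffD2]) (simp add: laws cochainD [OF x] cochainD [OF y])
  show "x \<oplus>\<^bsub>cochains p\<^esub> y = y \<oplus>\<^bsub>cochains p\<^esub> x"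
    unfolding cochains_simps
    by (rule restrict_ext) (rule laws(4) [OF _ cochainD [OF x] cochainD [OF y]])
  fix z assume z: "z \<in> carrier (cochains p)"
  show "x \<oplus>\<^bsub>cochains p\<^esub> y \<oplus>\<^bsub>cochains p\<^esub> z = x \<oplus>\<^bsub>cochains p\<^esub> (y \<oplus>\<^bsub>cochains p\<^esub> z)"
    unfolding cochains_simps
    by (rule restrict_ext) (simp add: laws(3) cochainD [OF x] cochainD [OF y] cochainD [OF z])
qed

end

text \<open>
  A family of homomorphisms between the localizations of two modules that commutes with
  the maps of further localization is a morphism of Cech complexes.
\<close>
locale cech_morphism = src: cech_complex A L G f r + tgt: cech_complex A' M G f' r
  for A :: "('a, 'r, 'g) gmodule" and L :: "('r, 'n, 'g) gmodule"
    and A' :: "('b, 's, 'g) gmodule" and M :: "('s, 'm, 'g) gmodule"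
    and G :: "('g, 'x) monoid_scheme" and f f' r +
  fixes \<psi> :: "nat set \<Rightarrow> ('n \<times> nat) set \<Rightarrow> ('m \<times> nat) set"
  assumes \<psi>_hom: "J \<subseteq> {..<r} \<Longrightarrow> abelian_group_hom (src.loc J) (tgt.loc J) (\<psi> J)"
    and \<psi>_face_map:
      "\<lbrakk> J \<subseteq> {..<r}; j \<in> J; u \<in> carrier (src.loc (J - {j})) \<rbrakk> \<Longrightarrow>
        \<psi> J (src.face_map J j u) = tgt.face_map J j (\<psi> (J - {j}) u)"
begin

definition cochain_map where
  "cochain_map p x = (\<lambda>J \<in> cech_index r p. \<psi> J (x J))"

lemma cochain_map_hom: "abelian_group_hom (src.cochains p) (tgt.cochains p) (cochain_map p)"
proof (rule additive_mapI)
  note hom = abelian_group_hom.hom_closed [OF \<psi>_hom [OF src.cech_index_subset]]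
    abelian_group_hom.hom_add [OF \<psi>_hom [OF src.cech_index_subset]]
  fix x assume x: "x \<in> carrier (src.cochains p)"
  show "cochain_map p x \<in> carrier (tgt.cochains p)"
    using x by (auto simp: cochain_map_def src.cochains_simps tgt.cochains_simps intro!: hom)
  fix y assume y: "y \<in> carrier (src.cochains p)"
  show "cochain_map p (x \<oplus>\<^bsub>src.cochains p\<^esub> y) = cochain_map p x \<oplus>\<^bsub>tgt.cochains p\<^esub> cochain_map p y"
    using src.cochainD [OF x] src.cochainD [OF y]
    by (auto simp: cochain_map_def src.cochains_simps tgt.cochains_simps fun_eq_iff hom)
qed (rule src.abelian_group_cochains tgt.abelian_group_cochains)+

lemma \<psi>_signed_face_map:
  assumes "J \<subseteq> {..<r}" "j \<in> J" "u \<in> carrier (src.loc (J - {j}))"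
  shows "\<psi> J (src.signed_face_map J j u) = tgt.signed_face_map J j (\<psi> (J - {j}) u)"
  using assms abelian_group_hom.hom_closed [OF src.face_map_hom [OF assms(1,2)] assms(3)]
  by (simp add: src.signed_face_map_def tgt.signed_face_map_def \<psi>_face_map
      abelian_group_hom.hom_a_inv [OF \<psi>_hom])

lemma cochain_map_diff:
  assumes x: "x \<in> carrier (src.cochains p)"
  shows "cochain_map (Suc p) (src.diff p x) = tgt.diff p (cochain_map p x)"
proof -
  have "\<psi> J (finsum (src.loc J) (\<lambda>j. src.signed_face_map J j (x (J - {j}))) J) =
      finsum (tgt.loc J) (\<lambda>j. tgt.signed_face_map J j (cochain_map p x (J - {j}))) J"
    if J: "J \<in> cech_index r (Suc p)" for J
  proof -
    note sub = src.cech_index_subset [OF J]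
    interpret abelian_group_hom "src.loc J" "tgt.loc J" "\<psi> J" by (rule \<psi>_hom [OF sub])
    have c: "x (J - {j}) \<in> carrier (src.loc (J - {j}))" if "j \<in> J" for j
      using src.cochainD [OF x src.cech_index_remove [OF J that]] .
    have s: "src.signed_face_map J j (x (J - {j})) \<in> carrier (src.loc J)" if "j \<in> J" for j
      using abelian_group_hom.hom_closed [OF src.signed_face_map_hom [OF sub that] c [OF that]] .
    have "\<psi> J (finsum (src.loc J) (\<lambda>j. src.signed_face_map J j (x (J - {j}))) J) =
        finsum (tgt.loc J) (\<lambda>j. \<psi> J (src.signed_face_map J j (x (J - {j})))) J"
      using s by (intro hom_finsum src.cech_index_finite [OF J]) auto
    also have "\<dots> = finsum (tgt.loc J) (\<lambda>j. tgt.signed_face_map J j (cochain_map p x (J - {j}))) J"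
    proof (rule H.finsum_cong')
      fix j assume j: "j \<in> J"
      show "\<psi> J (src.signed_face_map J j (x (J - {j}))) =
          tgt.signed_face_map J j (cochain_map p x (J - {j}))"
        using \<psi>_signed_face_map [OF sub j c [OF j]] src.cech_index_remove [OF J j]
        by (simp add: cochain_map_def)
    next
      show "(\<lambda>j. tgt.signed_face_map J j (cochain_map p x (J - {j}))) \<in> J \<rightarrow> carrier (tgt.loc J)"
      proof
        fix j assume j: "j \<in> J"
        show "tgt.signed_face_map J j (cochain_map p x (J - {j})) \<in> carrier (tgt.loc J)"
          using hom_closed [OF s [OF j]] \<psi>_signed_face_map [OF sub j c [OF j]] src.cech_index_remove [OF J j]
          by (simp add: cochain_map_def)
      qed
    qed simp
    finally show ?thesis .
  qed
  then show ?thesis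
    unfolding src.diff_eq tgt.diff_eq cochain_map_def [of "Suc p"]
    by (intro restrict_ext) simp
qed

end

context cech_complex
begin

lemma diff_hom: "abelian_group_hom (cochains p) (cochains (Suc p)) (diff p)"
proof (rule additive_mapI)
  have s: "signed_face_map J j (x (J - {j})) \<in> carrier (loc J)"
    if "x \<in> carrier (cochains p)" "J \<in> cech_index r (Suc p)" "j \<in> J" for x J j
    using abelian_group_hom.hom_closed [OF signed_face_map_hom [OF cech_index_subset]
        cochainD [OF _ cech_index_remove]] that by blast
  fix x assume x: "x \<in> carrier (cochains p)"
  show "diff p x \<in> carrier (cochains (Suc p))"
    using s x abelian_group_loc [OF cech_index_subset]
    by (auto simp: diff_eq cochains_simps(1) [of "Suc p"]
        intro!: abelian_monoid.finsum_closed [OF abelian_group.axioms(1)])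
  fix y assume y: "y \<in> carrier (cochains p)"
  have "finsum (loc J) (\<lambda>j. signed_face_map J j ((x \<oplus>\<^bsub>cochains p\<^esub> y) (J - {j}))) J =
      finsum (loc J) (\<lambda>j. signed_face_map J j (x (J - {j}))) J \<oplus>\<^bsub>loc J\<^esub>
      finsum (loc J) (\<lambda>j. signed_face_map J j (y (J - {j}))) J"
    if J: "J \<in> cech_index r (Suc p)" for J
  proof -
    interpret abelian_group "loc J" by (rule abelian_group_loc [OF cech_index_subset [OF J]])
    have "finsum (loc J) (\<lambda>j. signed_face_map J j ((x \<oplus>\<^bsub>cochains p\<^esub> y) (J - {j}))) J =
        finsum (loc J) (\<lambda>j. signed_face_map J j (x (J - {j})) \<oplus>\<^bsub>loc J\<^esub> signed_face_map J j (y (J - {j}))) J"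
    proof (rule finsum_cong')
      fix j assume j: "j \<in> J"
      show "signed_face_map J j ((x \<oplus>\<^bsub>cochains p\<^esub> y) (J - {j})) =
          signed_face_map J j (x (J - {j})) \<oplus>\<^bsub>loc J\<^esub> signed_face_map J j (y (J - {j}))"
        using abelian_group_hom.hom_add [OF signed_face_map_hom [OF cech_index_subset [OF J] j]
            cochainD [OF x cech_index_remove [OF J j]] cochainD [OF y cech_index_remove [OF J j]]]
          cech_index_remove [OF J j]
        by (simp add: cochains_simps)
    qed (use s [OF x J] s [OF y J] in auto)
    also have "\<dots> = finsum (loc J) (\<lambda>j. signed_face_map J j (x (J - {j}))) J \<oplus>\<^bsub>loc J\<^esub>
        finsum (loc J) (\<lambda>j. signed_face_map J j (y (J - {j}))) J"
      using s [OF x J] s [OF y J] by (intro finsum_addf) auto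
    finally show ?thesis .
  qed
  then show "diff p (x \<oplus>\<^bsub>cochains p\<^esub> y) = diff p x \<oplus>\<^bsub>cochains (Suc p)\<^esub> diff p y"
    unfolding diff_eq cochains_simps(3) [of "Suc p"]
    by (intro restrict_ext) simp
qed (rule abelian_group_cochains)+

lemma cocycles_eq: "cocycles p = {x \<in> carrier (cochains p). diff p x \<in> {\<zero>\<^bsub>cochains (Suc p)\<^esub>}}"
  by (simp add: cech_cocycles_def Let_def)

lemma cocycles_subgroup: "additive_subgroup (cocycles p) (cochains p)"
  unfolding cocycles_eq
  by (rule abelian_group_hom.vimage_subgroup [OF diff_hom
        abelian_group.zero_additive_subgroup [OF abelian_group_cochains]])

lemma coboundaries_subgroup: "additive_subgroup (coboundaries p) (cochains p)"
proof (cases p)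
  case 0
  then show ?thesis
    using abelian_group.zero_additive_subgroup [OF abelian_group_cochains]
    by (simp add: cech_coboundaries_def)
next
  case (Suc q)
  then show ?thesis
    using abelian_group_hom.image_subgroup [OF diff_hom
        abelian_group.carrier_additive_subgroup [OF abelian_group_cochains]]
    by (simp add: cech_coboundaries_def)
qed

text \<open>
  The two paths from the empty set to a pair of indices lead to the same fraction, with
  opposite signs.
\<close>
lemma diff_diff_0:
  assumes x: "x \<in> carrier (cochains 0)"
  shows "diff 0 x \<in> cocycles 1"
proof -
  have x0: "x {} \<in> carrier (loc {})" using cochainD [OF x, of "{}"] by (simp add: cech_index_def)
  interpret L0: localization A M "denom {}" by (rule localization_denom) simp
  obtain m k where m: "m \<in> carrier M" "x {} = frac A (denom {}) M m k"
    using x0 unfolding L0.carrier_localize by blast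
  have d: "diff 0 x {j} = frac A (denom {j}) M ((f j [^]\<^bsub>A\<^esub> k) \<odot>\<^bsub>M\<^esub> m) k"
    if "j < r" for j
  proof -
    interpret Lj: localization A M "denom {j}" by (rule localization_denom) (simp add: that)
    interpret abelian_group "loc {j}" by (rule abelian_group_loc) (simp add: that)
    have "signed_face_map {j} j (x {}) = frac A (denom {j}) M ((f j [^]\<^bsub>A\<^esub> k) \<odot>\<^bsub>M\<^esub> m) k"
    proof -
      have "{i \<in> {j}. i < j} = {}" by auto
      then have "signed_face_map {j} j = face_map {j} j"
        by (simp only: signed_face_map_def [abs_def] card.empty even_zero if_True)
      then show ?thesis
        using face_map_frac [of "{j}" j m k] m that by simp
    qed
    moreover have "frac A (denom {j}) M ((f j [^]\<^bsub>A\<^esub> k) \<odot>\<^bsub>M\<^esub> m) k \<in> carrier (loc {j})"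
      using m that f_closed by (intro Lj.frac_closed) auto
    ultimately show ?thesis
      using that by (simp add: diff_eq cech_index_def)
  qed
  have "diff 1 (diff 0 x) J = \<zero>\<^bsub>loc J\<^esub>" if J: "J \<in> cech_index r (Suc 1)" for J
  proof -
    obtain a b where J_eq: "J = {a, b}" and "a < b"
    proof -
      have "card J = 2" using J by (simp add: cech_index_def)
      then obtain c d where "J = {c, d}" "c \<noteq> d" by (auto simp: card_2_iff)
      then show thesis
        using that [of c d] that [of d c] by (cases "c < d") (auto simp: insert_commute)
    qed
    then have ab: "a < r" "b < r" "a \<noteq> b" using J by (auto simp: cech_index_def)
    have Jr: "J \<subseteq> {..<r}" using J by (rule cech_index_subset)
    interpret LJ: localization A M "denom J" by (rule localization_denom [OF Jr])
    interpret abelian_group "loc J" by (rule abelian_group_loc [OF Jr])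
    have fc: "f a \<in> carrier A" "f b \<in> carrier A" using ab f_closed by auto
    let ?y = "frac A (denom J) M (((f a \<otimes>\<^bsub>A\<^esub> f b) [^]\<^bsub>A\<^esub> k) \<odot>\<^bsub>M\<^esub> m) k"
    have y: "?y \<in> carrier (loc J)" using m fc by (intro LJ.frac_closed) simp
    have lower: "{i \<in> J. i < a} = {}" "{i \<in> J. i < b} = {a}" using J_eq \<open>a < b\<close> by auto
    have "even (card ({} :: nat set))" "odd (card {a})" by simp_all
    then have "even (card {i \<in> J. i < a})" "odd (card {i \<in> J. i < b})"
      by (simp_all only: lower not_False_eq_True)
    moreover have "J - {a} = {b}" "J - {b} = {a}" using J_eq \<open>a < b\<close> by auto
    moreover have "face_map J a (diff 0 x {b}) = ?y"
      using face_map_frac [OF Jr, of a "(f b [^]\<^bsub>A\<^esub> k) \<odot>\<^bsub>M\<^esub> m" k] J_eq ab m fc \<open>J - {a} = {b}\<close>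
      by (simp add: d R.nat_pow_distrib smult_assoc1)
    moreover have "face_map J b (diff 0 x {a}) = ?y"
      using face_map_frac [OF Jr, of b "(f a [^]\<^bsub>A\<^esub> k) \<odot>\<^bsub>M\<^esub> m" k] J_eq ab m fc \<open>J - {b} = {a}\<close>
      by (simp add: d R.nat_pow_distrib smult_assoc1 [symmetric] R.m_comm)
    ultimately have "signed_face_map J a (diff 0 x (J - {a})) = ?y"
      "signed_face_map J b (diff 0 x (J - {b})) = \<ominus>\<^bsub>loc J\<^esub> ?y"
      by (simp_all add: signed_face_map_def)
    then have "finsum (loc J) (\<lambda>j. signed_face_map J j (diff 0 x (J - {j}))) {a, b} = \<zero>\<^bsub>loc J\<^esub>"
      using y ab by (simp add: Pi_iff r_neg)
    then show ?thesis using J J_eq by (simp add: diff_eq)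
  qed
  then have "diff 1 (diff 0 x) = \<zero>\<^bsub>cochains (Suc 1)\<^esub>"
    unfolding cochains_simps
    by (intro extensionalityI [of _ "cech_index r (Suc 1)"]) (simp_all only: diff_eq restrict_extensional restrict_apply if_True)
  moreover have "diff 0 x \<in> carrier (cochains 1)"
    using abelian_group_hom.hom_closed [OF diff_hom x] by simp
  ultimately show ?thesis
    unfolding cocycles_eq by simp
qed

end

section \<open>Homogeneous cochains\<close>

text \<open>
  The grading enters through the projections \<open>comp \<gamma>\<close> onto the homogeneous parts of the module and
  through chosen degrees \<open>\<delta> j\<close> of the elements \<open>f j\<close>. A common choice of
  the \<open>\<delta> j\<close> for several modules over subrings is what makes their complexes comparable when some
  \<open>f j\<close> is zero and has more than one degree.
\<close>
locale graded_cech_complex = cech_complex A M G f r + G: comm_group G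
  for A :: "('a, 'r, 'g) gmodule" and M :: "('r, 'm, 'g) gmodule"
    and G :: "('g, 'x) monoid_scheme" and f r +
  fixes \<delta> :: "nat \<Rightarrow> 'g" and comp :: "'g \<Rightarrow> 'm \<Rightarrow> 'm"
  assumes one_degree: "\<one>\<^bsub>A\<^esub> \<in> hpart A \<one>\<^bsub>G\<^esub>"
    and mult_degree:
      "\<lbrakk> \<alpha> \<in> carrier G; \<beta> \<in> carrier G; a \<in> hpart A \<alpha>; b \<in> hpart A \<beta> \<rbrakk> \<Longrightarrow>
        a \<otimes>\<^bsub>A\<^esub> b \<in> hpart A (\<alpha> \<otimes>\<^bsub>G\<^esub> \<beta>)"
    and degree_unique:
      "\<lbrakk> \<alpha> \<in> carrier G; \<beta> \<in> carrier G; a \<in> hpart A \<alpha>; a \<in> hpart A \<beta>; a \<noteq> \<zero>\<^bsub>A\<^esub> \<rbrakk> \<Longrightarrow> \<alpha> = \<beta>"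
    and f_degree: "j < r \<Longrightarrow> f j \<in> hpart A (\<delta> j)"
    and \<delta>_closed: "j < r \<Longrightarrow> \<delta> j \<in> carrier G"
    and hpart_subset: "\<gamma> \<in> carrier G \<Longrightarrow> hpart M \<gamma> \<subseteq> carrier M"
    and comp_closed: "\<lbrakk> \<gamma> \<in> carrier G; x \<in> carrier M \<rbrakk> \<Longrightarrow> comp \<gamma> x \<in> hpart M \<gamma>"
    and comp_id: "\<lbrakk> \<gamma> \<in> carrier G; x \<in> hpart M \<gamma> \<rbrakk> \<Longrightarrow> comp \<gamma> x = x"
    and comp_add: "\<lbrakk> \<gamma> \<in> carrier G; x \<in> carrier M; y \<in> carrier M \<rbrakk> \<Longrightarrow>
        comp \<gamma> (x \<oplus>\<^bsub>M\<^esub> y) = comp \<gamma> x \<oplus>\<^bsub>M\<^esub> comp \<gamma> y"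
    and comp_smult:
      "\<lbrakk> \<gamma> \<in> carrier G; \<epsilon> \<in> carrier G; a \<in> hpart A \<epsilon>; x \<in> carrier M \<rbrakk> \<Longrightarrow>
        comp (\<gamma> \<otimes>\<^bsub>G\<^esub> \<epsilon>) (a \<odot>\<^bsub>M\<^esub> x) = a \<odot>\<^bsub>M\<^esub> comp \<gamma> x"
begin

abbreviation denom_degree :: "nat set \<Rightarrow> 'g" where "denom_degree J \<equiv> finprod G \<delta> J"

lemma denom_degree_closed: "J \<subseteq> {..<r} \<Longrightarrow> denom_degree J \<in> carrier G"
  by (rule G.finprod_closed) (auto intro: \<delta>_closed)

lemma denom_degree_remove:
  assumes "J \<subseteq> {..<r}" "j \<in> J"
  shows "denom_degree J = \<delta> j \<otimes>\<^bsub>G\<^esub> denom_degree (J - {j})"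
proof -
  have "finite J" using assms(1) finite_subset by blast
  then have "denom_degree (insert j (J - {j})) = \<delta> j \<otimes>\<^bsub>G\<^esub> denom_degree (J - {j})"
    using assms by (intro G.finprod_insert) (auto intro: \<delta>_closed)
  then show ?thesis using assms(2) by (simp add: insert_absorb)
qed

lemma denom_hpart:
  assumes "J \<subseteq> {..<r}"
  shows "denom J \<in> hpart A (denom_degree J)"
proof -
  have "finite J" using assms finite_subset by blast
  then show ?thesis
    using assms
  proof (induction J rule: finite_induct)
    case empty
    then show ?case by (simp add: one_degree)
  next
    case (insert j J)
    then have "f j \<otimes>\<^bsub>A\<^esub> denom J \<in> hpart A (\<delta> j \<otimes>\<^bsub>G\<^esub> denom_degree J)"
      by (intro mult_degree \<delta>_closed denom_degree_closed f_degree) auto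
    moreover have "denom (insert j J) = f j \<otimes>\<^bsub>A\<^esub> denom J"
      using insert by (intro R.finprod_insert) (auto intro: f_closed)
    moreover have "denom_degree (insert j J) = \<delta> j \<otimes>\<^bsub>G\<^esub> denom_degree J"
      using insert by (intro G.finprod_insert) (auto intro: \<delta>_closed)
    ultimately show ?case by simp
  qed
qed

lemma pow_hpart:
  assumes "\<alpha> \<in> carrier G" "a \<in> hpart A \<alpha>"
  shows "a [^]\<^bsub>A\<^esub> (k::nat) \<in> hpart A (\<alpha> [^]\<^bsub>G\<^esub> k)"
  by (induction k) (auto simp: one_degree assms intro: mult_degree)

abbreviation frac_degree :: "'g \<Rightarrow> nat set \<Rightarrow> nat \<Rightarrow> 'g" where
  "frac_degree \<gamma> J k \<equiv> \<gamma> \<otimes>\<^bsub>G\<^esub> denom_degree J [^]\<^bsub>G\<^esub> k"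

lemma frac_degree_closed:
  "\<lbrakk> \<gamma> \<in> carrier G; J \<subseteq> {..<r} \<rbrakk> \<Longrightarrow> frac_degree \<gamma> J k \<in> carrier G"
  by (simp add: denom_degree_closed)

lemma comp_hom: "\<gamma> \<in> carrier G \<Longrightarrow> abelian_group_hom M M (comp \<gamma>)"
  using comp_closed hpart_subset comp_add
  by (intro additive_mapI) (auto simp: M.abelian_group_axioms)

lemma zero_hpart: "\<gamma> \<in> carrier G \<Longrightarrow> \<zero>\<^bsub>M\<^esub> \<in> hpart M \<gamma>"
  using comp_closed [of \<gamma> "\<zero>\<^bsub>M\<^esub>"] abelian_group_hom.hom_zero [OF comp_hom] by simp

text \<open>
  A power of the denominator has the expected degree, and only this one unless it is zero; in the latter
  case every fraction equals \<open>0 / 1\<close>, which has the expected form too.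
\<close>
lemma hpart_loc:
  assumes \<gamma>: "\<gamma> \<in> carrier G" and J: "J \<subseteq> {..<r}"
  shows "hpart (loc J) \<gamma> = {frac A (denom J) M m k | m k. m \<in> hpart M (frac_degree \<gamma> J k)}"
proof
  interpret localization A M "denom J" by (rule localization_denom [OF J])
  note dc = denom_degree_closed [OF J] and dh = denom_hpart [OF J]
  show "{frac A (denom J) M m k | m k. m \<in> hpart M (frac_degree \<gamma> J k)} \<subseteq> hpart (loc J) \<gamma>"
    using pow_hpart [OF dc dh] G.nat_pow_closed [OF dc] by (fastforce simp: localize_def)
  show "hpart (loc J) \<gamma> \<subseteq> {frac A (denom J) M m k | m k. m \<in> hpart M (frac_degree \<gamma> J k)}"
  proof
    fix u assume "u \<in> hpart (loc J) \<gamma>"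
    then obtain m k \<epsilon> where u: "u = frac A (denom J) M m k" and \<epsilon>: "\<epsilon> \<in> carrier G"
      and d: "denom J [^]\<^bsub>A\<^esub> k \<in> hpart A \<epsilon>" and m: "m \<in> hpart M (\<gamma> \<otimes>\<^bsub>G\<^esub> \<epsilon>)"
      by (auto simp: localize_def)
    show "u \<in> {frac A (denom J) M m k | m k. m \<in> hpart M (frac_degree \<gamma> J k)}"
    proof (cases "denom J [^]\<^bsub>A\<^esub> k = \<zero>\<^bsub>A\<^esub>")
      case True
      \<comment> \<open>The denominator is nilpotent, so the degree of \<open>g\<^sup>k\<close> is ambiguous, but the localization is zero.\<close>
      have mc: "m \<in> carrier M" using m hpart_subset [OF G.m_closed [OF \<gamma> \<epsilon>]] by blast
      have "(denom J [^]\<^bsub>A\<^esub> (k + 0)) \<odot>\<^bsub>M\<^esub> m = (denom J [^]\<^bsub>A\<^esub> (k + k)) \<odot>\<^bsub>M\<^esub> \<zero>\<^bsub>M\<^esub>"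
        using mc True by simp
      then have "u = frac A (denom J) M \<zero>\<^bsub>M\<^esub> 0"
        unfolding u using mc by (subst frac_eq_iff) (auto intro: exI [of _ k])
      moreover have "\<zero>\<^bsub>M\<^esub> \<in> hpart M (frac_degree \<gamma> J 0)"
        by (rule zero_hpart) (rule frac_degree_closed [OF \<gamma> J])
      ultimately show ?thesis by blast
    next
      case False
      have "\<epsilon> = denom_degree J [^]\<^bsub>G\<^esub> k"
        by (rule degree_unique [OF \<epsilon> G.nat_pow_closed [OF dc] d pow_hpart [OF dc dh] False])
      then show ?thesis using u m by auto
    qed
  qed
qed

definition loc_comp where
  "loc_comp \<gamma> J = frac_map A (denom J) M (\<lambda>k. comp (frac_degree \<gamma> J k))"

text \<open>
  Projecting the numerator of \<open>m / g\<^sup>k\<close> to degree \<open>\<gamma> + k deg g\<close> does not depend on the way in which the fraction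
  is written, because projections commute with multiplication by homogeneous elements.
\<close>
lemma frac_family_comp:
  assumes \<gamma>: "\<gamma> \<in> carrier G" and J: "J \<subseteq> {..<r}"
  shows "frac_family A M (denom J) A M (denom J) (\<lambda>k. comp (frac_degree \<gamma> J k))"
proof -
  interpret localization A M "denom J" by (rule localization_denom [OF J])
  note dc = denom_degree_closed [OF J]
  show ?thesis
  proof
    fix m and k l :: nat assume m: "m \<in> carrier M"
    show "comp (frac_degree \<gamma> J k) m \<in> carrier M"
      using comp_closed [OF frac_degree_closed [OF \<gamma> J] m] hpart_subset [OF frac_degree_closed [OF \<gamma> J]]
      by blast
    have "frac_degree \<gamma> J (l + k) = frac_degree \<gamma> J k \<otimes>\<^bsub>G\<^esub> denom_degree J [^]\<^bsub>G\<^esub> l"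
      using \<gamma> dc by (simp add: G.nat_pow_mult [symmetric] G.m_ac)
    then show "comp (frac_degree \<gamma> J (l + k)) ((denom J [^]\<^bsub>A\<^esub> l) \<odot>\<^bsub>M\<^esub> m) =
        (denom J [^]\<^bsub>A\<^esub> l) \<odot>\<^bsub>M\<^esub> comp (frac_degree \<gamma> J k) m"
      using comp_smult [OF frac_degree_closed [OF \<gamma> J] G.nat_pow_closed [OF dc]
          pow_hpart [OF dc denom_hpart [OF J]] m] by simp
  next
    fix m m' k assume "m \<in> carrier M" "m' \<in> carrier M"
    then show "comp (frac_degree \<gamma> J k) (m \<oplus>\<^bsub>M\<^esub> m') =
        comp (frac_degree \<gamma> J k) m \<oplus>\<^bsub>M\<^esub> comp (frac_degree \<gamma> J k) m'"
      by (rule comp_add [OF frac_degree_closed [OF \<gamma> J]])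
  qed
qed

lemma loc_comp_frac:
  "\<lbrakk> \<gamma> \<in> carrier G; J \<subseteq> {..<r}; m \<in> carrier M \<rbrakk> \<Longrightarrow>
    loc_comp \<gamma> J (frac A (denom J) M m k) = frac A (denom J) M (comp (frac_degree \<gamma> J k) m) k"
  unfolding loc_comp_def by (rule frac_family.frac_map_frac [OF frac_family_comp])

lemma loc_comp_hom:
  "\<lbrakk> \<gamma> \<in> carrier G; J \<subseteq> {..<r} \<rbrakk> \<Longrightarrow> abelian_group_hom (loc J) (loc J) (loc_comp \<gamma> J)"
  unfolding loc_comp_def by (rule frac_family.hom_frac_map [OF frac_family_comp])

lemma carrier_loc:
  "J \<subseteq> {..<r} \<Longrightarrow> carrier (loc J) = {frac A (denom J) M m k | m k. m \<in> carrier M}"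
  by (rule localization.carrier_localize [OF localization_denom])

lemma loc_comp_closed:
  assumes "\<gamma> \<in> carrier G" "J \<subseteq> {..<r}" "u \<in> carrier (loc J)"
  shows "loc_comp \<gamma> J u \<in> hpart (loc J) \<gamma>"
proof -
  obtain m k where m: "m \<in> carrier M" "u = frac A (denom J) M m k"
    using assms(3) unfolding carrier_loc [OF assms(2)] by blast
  then show ?thesis
    using comp_closed [OF frac_degree_closed [OF assms(1,2)] m(1)]
    unfolding hpart_loc [OF assms(1,2)] m(2) loc_comp_frac [OF assms(1,2) m(1)] by blast
qed

lemma hpart_loc_subset:
  assumes "\<gamma> \<in> carrier G" "J \<subseteq> {..<r}"
  shows "hpart (loc J) \<gamma> \<subseteq> carrier (loc J)"
  using assms hpart_subset [OF frac_degree_closed [OF assms]]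
  by (auto simp: hpart_loc carrier_loc)

lemma loc_comp_id:
  assumes "\<gamma> \<in> carrier G" "J \<subseteq> {..<r}" "u \<in> hpart (loc J) \<gamma>"
  shows "loc_comp \<gamma> J u = u"
  using assms comp_id [OF frac_degree_closed [OF assms(1,2)]] hpart_subset [OF frac_degree_closed [OF assms(1,2)]]
  by (auto simp: hpart_loc loc_comp_frac subset_iff)

lemma cech_morphism_comp:
  assumes \<gamma>: "\<gamma> \<in> carrier G"
  shows "cech_morphism A M A M G f f r (loc_comp \<gamma>)"
proof (rule cech_morphism.intro [OF cech_complex_axioms cech_complex_axioms], rule cech_morphism_axioms.intro)
  fix J assume J: "J \<subseteq> {..<r}"
  show "abelian_group_hom (loc J) (loc J) (loc_comp \<gamma> J)" by (rule loc_comp_hom [OF \<gamma> J])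
  fix j u assume j: "j \<in> J" and u: "u \<in> carrier (loc (J - {j}))"
  have J': "J - {j} \<subseteq> {..<r}" and jr: "j < r" using J j by auto
  obtain m k where m: "m \<in> carrier M" "u = frac A (denom (J - {j})) M m k"
    using u carrier_loc [OF J'] by blast
  note dc = denom_degree_closed [OF J'] \<delta>_closed [OF jr]
  have fc: "(f j [^]\<^bsub>A\<^esub> k) \<odot>\<^bsub>M\<^esub> m \<in> carrier M" using m f_closed jr by simp
  have c: "comp (frac_degree \<gamma> (J - {j}) k) m \<in> carrier M"
    using comp_closed [OF frac_degree_closed [OF \<gamma> J'] m(1)] hpart_subset [OF frac_degree_closed [OF \<gamma> J']]
    by blast
  have "frac_degree \<gamma> J k = frac_degree \<gamma> (J - {j}) k \<otimes>\<^bsub>G\<^esub> \<delta> j [^]\<^bsub>G\<^esub> k"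
    using \<gamma> dc by (simp add: denom_degree_remove [OF J j] G.nat_pow_distrib G.m_ac)
  then have "comp (frac_degree \<gamma> J k) ((f j [^]\<^bsub>A\<^esub> k) \<odot>\<^bsub>M\<^esub> m) =
      (f j [^]\<^bsub>A\<^esub> k) \<odot>\<^bsub>M\<^esub> comp (frac_degree \<gamma> (J - {j}) k) m"
    using comp_smult [OF frac_degree_closed [OF \<gamma> J'] G.nat_pow_closed [OF dc(2)]
        pow_hpart [OF dc(2) f_degree [OF jr]] m(1)] by simp
  then show "loc_comp \<gamma> J (face_map J j u) = face_map J j (loc_comp \<gamma> (J - {j}) u)"
    unfolding m(2)
    by (simp only: face_map_frac [OF J j m(1)] loc_comp_frac [OF \<gamma> J fc] loc_comp_frac [OF \<gamma> J' m(1)]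
        face_map_frac [OF J j c])
qed

context
  fixes \<gamma> assumes \<gamma>: "\<gamma> \<in> carrier G"
begin

interpretation comp: cech_morphism A M A M G f f r "loc_comp \<gamma>"
  by (rule cech_morphism_comp [OF \<gamma>])

lemma hpart_cochains_subset: "hpart (cochains p) \<gamma> \<subseteq> carrier (cochains p)"
  unfolding cochains_simps by (rule PiE_mono) (rule hpart_loc_subset [OF \<gamma> cech_index_subset])

lemma cochain_comp_id: "x \<in> hpart (cochains p) \<gamma> \<Longrightarrow> comp.cochain_map p x = x"
  unfolding cochains_simps comp.cochain_map_def
  by (rule extensionalityI [OF restrict_extensional])
    (auto simp: PiE_def loc_comp_id [OF \<gamma> cech_index_subset] Pi_iff)

lemma cochain_comp_closed:
  "x \<in> carrier (cochains p) \<Longrightarrow> comp.cochain_map p x \<in> hpart (cochains p) \<gamma>"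
  unfolding cochains_simps(4) comp.cochain_map_def
  by (rule restrict_PiE_iff [THEN iffD2]) (auto intro: loc_comp_closed [OF \<gamma> cech_index_subset] cochainD)

lemma hpart_cochains_subgroup: "additive_subgroup (hpart (cochains p) \<gamma>) (cochains p)"
proof -
  have "hpart (cochains p) \<gamma> = comp.cochain_map p ` carrier (cochains p)"
    using cochain_comp_id cochain_comp_closed hpart_cochains_subset by (force simp: image_iff)
  then show ?thesis
    using abelian_group_hom.image_subgroup [OF comp.cochain_map_hom
        abelian_group.carrier_additive_subgroup [OF abelian_group_cochains]] by simp
qed

text \<open>
  The differential commutes with the projection to degree \<open>\<gamma>\<close>, so that a preimage of a homogeneous
  coboundary can be replaced by its component of degree \<open>\<gamma>\<close>.
\<close>
lemma homogeneous_preimage: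
  assumes "y \<in> carrier (cochains p)" "diff p y \<in> hpart (cochains (Suc p)) \<gamma>"
  obtains y' where "y' \<in> hpart (cochains p) \<gamma>" "diff p y' = diff p y"
  using that [OF cochain_comp_closed [OF assms(1)]] comp.cochain_map_diff [OF assms(1)]
    cochain_comp_id [OF assms(2)] by simp

abbreviation homogeneous_cocycles where
  "homogeneous_cocycles p \<equiv> hpart (cochains p) \<gamma> \<inter> cocycles p"

lemma homogeneous_cocycles_subgroup: "additive_subgroup (homogeneous_cocycles p) (cochains p)"
  by (rule abelian_group.additive_subgroup_Int [OF abelian_group_cochains
        hpart_cochains_subgroup cocycles_subgroup])

end

lemma cohomology_simps:
  "hpart (cech_cohomology G A M f r p) \<gamma> =
    {coboundaries p +>\<^bsub>cochains p\<^esub> x | x. x \<in> hpart (cochains p) \<gamma> \<inter> cocycles p}"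
  "\<zero>\<^bsub>cech_cohomology G A M f r p\<^esub> = coboundaries p"
  "add (cech_cohomology G A M f r p) = set_add (cochains p)"
  by (simp_all add: cech_cohomology_def quot_module_def cech_cocycles_def Let_def a_r_coset_def'
      set_add_def' [abs_def] fun_eq_iff)

lemma cohomology_hpart_trivial_iff:
  assumes \<gamma>: "\<gamma> \<in> carrier G"
  shows "hpart (cech_cohomology G A M f r p) \<gamma> = {\<zero>\<^bsub>cech_cohomology G A M f r p\<^esub>} \<longleftrightarrow>
    hpart (cochains p) \<gamma> \<inter> cocycles p \<subseteq> coboundaries p"
proof -
  interpret C: abelian_group "cochains p" by (rule abelian_group_cochains)
  interpret V: additive_subgroup "hpart (cochains p) \<gamma> \<inter> cocycles p" "cochains p"
    by (rule homogeneous_cocycles_subgroup [OF \<gamma>])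
  have "coboundaries p +>\<^bsub>cochains p\<^esub> x = coboundaries p \<longleftrightarrow> x \<in> coboundaries p"
    if "x \<in> hpart (cochains p) \<gamma> \<inter> cocycles p" for x
    by (rule C.coset_eq_self_iff [OF coboundaries_subgroup V.a_Hcarr [OF that]])
  moreover have "\<exists>x. x \<in> hpart (cochains p) \<gamma> \<inter> cocycles p" using V.zero_closed by blast
  ultimately show ?thesis unfolding cohomology_simps by blast
qed

end

section \<open>Comparison along an inclusion of graded modules\<close>

locale graded_cech_inclusion =
  sub: graded_cech_complex A L G f r \<delta> comp + sup: graded_cech_complex R M G f r \<delta> comp'
  for A R :: "('a, 'r, 'g) gmodule" and L M :: "('r, 'm, 'g) gmodule"
    and G :: "('g, 'x) monoid_scheme" and f r \<delta> comp comp' +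
  assumes ring_operations: "monoid.mult A = monoid.mult R" "one A = one R"
    and module_operations: "add L = add M" "smult L = smult M"
    and carrier_subset: "carrier L \<subseteq> carrier M"
    and hpart_mono: "\<gamma> \<in> carrier G \<Longrightarrow> hpart L \<gamma> \<subseteq> hpart M \<gamma>"
begin

lemma pow_eq: "a [^]\<^bsub>A\<^esub> (k::nat) = a [^]\<^bsub>R\<^esub> k"
  by (simp add: nat_pow_def ring_operations)

lemma denom_eq:
  assumes "J \<subseteq> {..<r}"
  shows "sub.denom J = sup.denom J"
proof -
  have "finite J" using assms finite_subset by blast
  then show ?thesis
    using assms
  proof (induction J rule: finite_induct)
    case empty
    then show ?case by (simp add: ring_operations)
  next
    case (insert j J)
    have "sub.denom (insert j J) = f j \<otimes>\<^bsub>A\<^esub> sub.denom J"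
      using insert by (intro sub.R.finprod_insert) (auto intro: sub.f_closed)
    moreover have "sup.denom (insert j J) = f j \<otimes>\<^bsub>R\<^esub> sup.denom J"
      using insert by (intro sup.R.finprod_insert) (auto intro: sup.f_closed)
    ultimately show ?case using insert by (simp add: ring_operations)
  qed
qed

definition loc_incl where
  "loc_incl J = localize_map (\<lambda>m. m) R M (sup.denom J)"

lemma frac_family_incl:
  assumes J: "J \<subseteq> {..<r}"
  shows "frac_family A L (sub.denom J) R M (sup.denom J) (\<lambda>k m. m)"
proof -
  interpret src: localization A L "sub.denom J" by (rule sub.localization_denom [OF J])
  interpret tgt: localization R M "sup.denom J" by (rule sup.localization_denom [OF J])
  show ?thesis
    using carrier_subset by unfold_locales (auto simp: module_operations pow_eq denom_eq [OF J])
qed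

lemma loc_incl_frac:
  "\<lbrakk> J \<subseteq> {..<r}; m \<in> carrier L \<rbrakk> \<Longrightarrow>
    loc_incl J (frac A (sub.denom J) L m k) = frac R (sup.denom J) M m k"
  unfolding loc_incl_def localize_map_eq_frac_map
  by (rule frac_family.frac_map_frac [OF frac_family_incl])

lemma loc_incl_hom: "J \<subseteq> {..<r} \<Longrightarrow> abelian_group_hom (sub.loc J) (sup.loc J) (loc_incl J)"
  unfolding loc_incl_def localize_map_eq_frac_map
  by (rule frac_family.hom_frac_map [OF frac_family_incl])

lemma loc_incl_inj:
  assumes J: "J \<subseteq> {..<r}"
  shows "inj_on (loc_incl J) (carrier (sub.loc J))"
proof (rule inj_onI)
  interpret src: localization A L "sub.denom J" by (rule sub.localization_denom [OF J])
  interpret tgt: localization R M "sup.denom J" by (rule sup.localization_denom [OF J])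
  fix u v assume uv: "u \<in> carrier (sub.loc J)" "v \<in> carrier (sub.loc J)" "loc_incl J u = loc_incl J v"
  obtain m k where m: "m \<in> carrier L" "u = frac A (sub.denom J) L m k"
    using uv(1) unfolding sub.carrier_loc [OF J] by blast
  obtain m' k' where m': "m' \<in> carrier L" "v = frac A (sub.denom J) L m' k'"
    using uv(2) unfolding sub.carrier_loc [OF J] by blast
  have M: "m \<in> carrier M" "m' \<in> carrier M" using m m' carrier_subset by auto
  have "frac R (sup.denom J) M m k = frac R (sup.denom J) M m' k'"
    using uv(3) unfolding m(2) m'(2) loc_incl_frac [OF J m(1)] loc_incl_frac [OF J m'(1)] .
  then show "u = v"
    unfolding m(2) m'(2) tgt.frac_eq_iff [OF M] src.frac_eq_iff [OF m(1) m'(1)]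
    by (simp only: module_operations pow_eq denom_eq [OF J])
qed

lemma loc_incl_hpart:
  assumes "\<gamma> \<in> carrier G" and J: "J \<subseteq> {..<r}" and u: "u \<in> hpart (sub.loc J) \<gamma>"
  shows "loc_incl J u \<in> hpart (sup.loc J) \<gamma>"
proof -
  obtain m k where m: "u = frac A (sub.denom J) L m k" "m \<in> hpart L (sub.frac_degree \<gamma> J k)"
    using u unfolding sub.hpart_loc [OF assms(1) J] by blast
  have c: "sub.frac_degree \<gamma> J k \<in> carrier G" by (rule sub.frac_degree_closed [OF assms(1) J])
  have "m \<in> carrier L" using m sub.hpart_subset [OF c] by blast
  then show ?thesis
    using m hpart_mono [OF c] unfolding sup.hpart_loc [OF assms(1) J]
    by (auto simp: loc_incl_frac [OF J])
qed

text \<open>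
  The numerator of a fraction over the larger module may be multiplied by a power of the denominator,
  so it suffices that this moves it into the smaller module.
\<close>
lemma loc_incl_onto:
  assumes \<gamma>: "\<gamma> \<in> carrier G" and J: "J \<subseteq> {..<r}"
    and pow: "\<And>m k. m \<in> hpart M (sub.frac_degree \<gamma> J k) \<Longrightarrow>
      \<exists>l::nat. (sup.denom J [^]\<^bsub>R\<^esub> l) \<odot>\<^bsub>M\<^esub> m \<in> hpart L (sub.frac_degree \<gamma> J (l + k))"
  shows "hpart (sup.loc J) \<gamma> \<subseteq> loc_incl J ` hpart (sub.loc J) \<gamma>"
proof
  interpret tgt: localization R M "sup.denom J" by (rule sup.localization_denom [OF J])
  fix u assume "u \<in> hpart (sup.loc J) \<gamma>"
  then obtain m k where m: "u = frac R (sup.denom J) M m k" "m \<in> hpart M (sub.frac_degree \<gamma> J k)"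
    unfolding sup.hpart_loc [OF \<gamma> J] by blast
  obtain l :: nat where l: "(sup.denom J [^]\<^bsub>R\<^esub> l) \<odot>\<^bsub>M\<^esub> m \<in> hpart L (sub.frac_degree \<gamma> J (l + k))"
    using pow [OF m(2)] by blast
  let ?n = "(sup.denom J [^]\<^bsub>R\<^esub> l) \<odot>\<^bsub>M\<^esub> m"
  have "?n \<in> carrier L" using l sub.hpart_subset [OF sub.frac_degree_closed [OF \<gamma> J]] by blast
  moreover have "m \<in> carrier M" using m sup.hpart_subset [OF sup.frac_degree_closed [OF \<gamma> J]] by blast
  ultimately have "u = loc_incl J (frac A (sub.denom J) L ?n (l + k))"
    by (simp add: loc_incl_frac [OF J] m(1) tgt.frac_cancel)
  moreover have "frac A (sub.denom J) L ?n (l + k) \<in> hpart (sub.loc J) \<gamma>"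
    using l unfolding sub.hpart_loc [OF \<gamma> J] by blast
  ultimately show "u \<in> loc_incl J ` hpart (sub.loc J) \<gamma>" by blast
qed

sublocale cech_morphism A L R M G f f r loc_incl
proof (rule cech_morphism.intro [OF sub.cech_complex_axioms sup.cech_complex_axioms],
    rule cech_morphism_axioms.intro)
  fix J assume J: "J \<subseteq> {..<r}"
  show "abelian_group_hom (sub.loc J) (sup.loc J) (loc_incl J)" by (rule loc_incl_hom [OF J])
  fix j u assume j: "j \<in> J" and u: "u \<in> carrier (sub.loc (J - {j}))"
  have J': "J - {j} \<subseteq> {..<r}" and jr: "j < r" using J j by auto
  obtain m k where m: "m \<in> carrier L" "u = frac A (sub.denom (J - {j})) L m k"
    using u sub.carrier_loc [OF J'] by blast
  have mM: "m \<in> carrier M" using m carrier_subset by blast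
  have fc: "(f j [^]\<^bsub>A\<^esub> k) \<odot>\<^bsub>L\<^esub> m \<in> carrier L" using m sub.f_closed jr by simp
  show "loc_incl J (sub.face_map J j u) = sup.face_map J j (loc_incl (J - {j}) u)"
    unfolding m(2) sub.face_map_frac [OF J j m(1)] loc_incl_frac [OF J fc] loc_incl_frac [OF J' m(1)]
      sup.face_map_frac [OF J j mM]
    by (simp add: pow_eq module_operations)
qed

lemma cochain_map_inj: "inj_on (cochain_map p) (carrier (sub.cochains p))"
proof (rule inj_onI)
  fix x y assume x: "x \<in> carrier (sub.cochains p)" and y: "y \<in> carrier (sub.cochains p)"
    and eq: "cochain_map p x = cochain_map p y"
  show "x = y"
  proof (rule PiE_ext)
    show "x \<in> (\<Pi>\<^sub>E J \<in> cech_index r p. carrier (sub.loc J))"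
      "y \<in> (\<Pi>\<^sub>E J \<in> cech_index r p. carrier (sub.loc J))"
      using x y by (simp_all add: sub.cochains_simps)
    fix J assume J: "J \<in> cech_index r p"
    have "loc_incl J (x J) = loc_incl J (y J)"
      using fun_cong [OF eq, of J] J by (simp add: cochain_map_def)
    then show "x J = y J"
      by (rule inj_onD [OF loc_incl_inj [OF sub.cech_index_subset [OF J]] _
            sub.cochainD [OF x J] sub.cochainD [OF y J]])
  qed
qed

lemma cochain_map_hpart:
  assumes "\<gamma> \<in> carrier G" "x \<in> hpart (sub.cochains p) \<gamma>"
  shows "cochain_map p x \<in> hpart (sup.cochains p) \<gamma>"
  using assms unfolding sub.cochains_simps sup.cochains_simps cochain_map_def
  by (auto intro: loc_incl_hpart [OF assms(1) sub.cech_index_subset] dest: PiE_mem)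

lemma cochain_map_onto:
  assumes \<gamma>: "\<gamma> \<in> carrier G"
    and onto: "\<And>J. J \<in> cech_index r p \<Longrightarrow> hpart (sup.loc J) \<gamma> \<subseteq> loc_incl J ` hpart (sub.loc J) \<gamma>"
    and z: "z \<in> hpart (sup.cochains p) \<gamma>"
  obtains x where "x \<in> hpart (sub.cochains p) \<gamma>" "z = cochain_map p x"
proof -
  have "\<forall>J \<in> cech_index r p. \<exists>u. u \<in> hpart (sub.loc J) \<gamma> \<and> z J = loc_incl J u"
    using onto z unfolding sup.cochains_simps by (blast dest: PiE_mem)
  then obtain x where x: "\<forall>J \<in> cech_index r p. x J \<in> hpart (sub.loc J) \<gamma> \<and> z J = loc_incl J (x J)"
    using bchoice [of "cech_index r p" "\<lambda>J u. u \<in> hpart (sub.loc J) \<gamma> \<and> z J = loc_incl J u"] by blast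
  show thesis
  proof (rule that)
    show "restrict x (cech_index r p) \<in> hpart (sub.cochains p) \<gamma>"
      unfolding sub.cochains_simps using x by simp
    show "z = cochain_map p (restrict x (cech_index r p))"
      unfolding cochain_map_def
    proof (rule extensionalityI [OF _ restrict_extensional])
      show "z \<in> extensional (cech_index r p)" using z by (simp add: sup.cochains_simps PiE_def)
    qed (use x in simp)
  qed
qed

lemma cochain_map_cocycle_iff:
  assumes x: "x \<in> carrier (sub.cochains p)"
  shows "cochain_map p x \<in> sup.cocycles p \<longleftrightarrow> x \<in> sub.cocycles p"
proof -
  interpret h: abelian_group_hom "sub.cochains p" "sup.cochains p" "cochain_map p"
    by (rule cochain_map_hom)
  interpret h': abelian_group_hom "sub.cochains (Suc p)" "sup.cochains (Suc p)" "cochain_map (Suc p)"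
    by (rule cochain_map_hom)
  have d: "sub.diff p x \<in> carrier (sub.cochains (Suc p))"
    by (rule abelian_group_hom.hom_closed [OF sub.diff_hom x])
  have "sup.diff p (cochain_map p x) = \<zero>\<^bsub>sup.cochains (Suc p)\<^esub> \<longleftrightarrow>
      cochain_map (Suc p) (sub.diff p x) = cochain_map (Suc p) \<zero>\<^bsub>sub.cochains (Suc p)\<^esub>"
    by (simp add: cochain_map_diff [OF x])
  also have "\<dots> \<longleftrightarrow> sub.diff p x = \<zero>\<^bsub>sub.cochains (Suc p)\<^esub>"
    by (rule inj_on_eq_iff [OF cochain_map_inj d]) simp
  finally show ?thesis using x by (simp add: sub.cocycles_eq sup.cocycles_eq)
qed

lemma cochain_map_coboundaries: "cochain_map p ` sub.coboundaries p \<subseteq> sup.coboundaries p"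
proof (cases p)
  case 0
  then show ?thesis
    using abelian_group_hom.hom_zero [OF cochain_map_hom [of 0]] by (simp add: cech_coboundaries_def)
next
  case (Suc q)
  then show ?thesis
    using abelian_group_hom.hom_closed [OF cochain_map_hom [of q]]
    by (auto simp: cech_coboundaries_def cochain_map_diff)
qed

text \<open>
  The differential is homogeneous, so a primitive over the larger module can be taken in degree \<open>\<gamma>\<close>,
  where it lifts; the lift is a primitive because the map on cochains is injective.
\<close>
lemma cochain_map_reflects_coboundaries:
  assumes \<gamma>: "\<gamma> \<in> carrier G"
    and onto: "\<And>q J. \<lbrakk> Suc q = p; J \<in> cech_index r q \<rbrakk> \<Longrightarrow>
      hpart (sup.loc J) \<gamma> \<subseteq> loc_incl J ` hpart (sub.loc J) \<gamma>"
    and x: "x \<in> hpart (sub.cochains p) \<gamma>" "cochain_map p x \<in> sup.coboundaries p"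
  shows "x \<in> sub.coboundaries p"
proof (cases p)
  case 0
  have x0: "x \<in> carrier (sub.cochains 0)"
    using x(1) sub.hpart_cochains_subset [OF \<gamma>] unfolding 0 by blast
  interpret h: abelian_group_hom "sub.cochains 0" "sup.cochains 0" "cochain_map 0"
    by (rule cochain_map_hom)
  have "cochain_map 0 x = \<zero>\<^bsub>sup.cochains 0\<^esub>"
    using x(2) unfolding 0 by (simp add: cech_coboundaries_def)
  then have "cochain_map 0 x = cochain_map 0 \<zero>\<^bsub>sub.cochains 0\<^esub>"
    unfolding h.hom_zero .
  then have "x = \<zero>\<^bsub>sub.cochains 0\<^esub>"
    by (rule inj_onD [OF cochain_map_inj [of 0] _ x0 h.G.zero_closed])
  then show ?thesis unfolding 0 by (simp add: cech_coboundaries_def)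
next
  case (Suc q)
  have xc: "x \<in> carrier (sub.cochains (Suc q))"
    using x(1) sub.hpart_cochains_subset [OF \<gamma>] unfolding Suc by blast
  obtain y where y: "y \<in> carrier (sup.cochains q)" "cochain_map (Suc q) x = sup.diff q y"
    using x(2) unfolding Suc by (auto simp: cech_coboundaries_def)
  have "sup.diff q y \<in> hpart (sup.cochains (Suc q)) \<gamma>"
    unfolding y(2) [symmetric] by (rule cochain_map_hpart [OF \<gamma> x(1) [unfolded Suc]])
  then obtain y' where y': "y' \<in> hpart (sup.cochains q) \<gamma>" "sup.diff q y' = sup.diff q y"
    by (rule sup.homogeneous_preimage [OF \<gamma> y(1)])
  obtain w where w: "w \<in> hpart (sub.cochains q) \<gamma>" "y' = cochain_map q w"
    by (rule cochain_map_onto [OF \<gamma> onto [OF Suc [symmetric]] y'(1)])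
  have wc: "w \<in> carrier (sub.cochains q)" using w sub.hpart_cochains_subset [OF \<gamma>] by blast
  have "cochain_map (Suc q) x = cochain_map (Suc q) (sub.diff q w)"
    unfolding cochain_map_diff [OF wc] y(2) y'(2) [symmetric] w(2) ..
  then have "x = sub.diff q w"
    by (rule inj_onD [OF cochain_map_inj _ xc abelian_group_hom.hom_closed [OF sub.diff_hom wc]])
  then show ?thesis unfolding Suc using wc by (simp add: cech_coboundaries_def)
qed

lemma cech_cohomology_map_eq:
  "cech_cohomology_map (\<lambda>m. m) G R M f r p =
    (\<lambda>U. \<Union>x \<in> U. sup.coboundaries p +>\<^bsub>sup.cochains p\<^esub> cochain_map p x)"
proof -
  have "B +>\<^bsub>cech_cocycles G R M f r p\<^esub> x = B +>\<^bsub>sup.cochains p\<^esub> x" for B x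
    by (simp add: cech_cocycles_def Let_def a_r_coset_def')
  then show ?thesis
    unfolding cech_cohomology_map_def cochain_map_def loc_incl_def by simp
qed

text \<open>
  The map on cochains is always injective, so bijectivity on cohomology in degree \<open>p\<close> needs
  surjectivity on the cochains of degrees \<open>p\<close> (to lift cocycles) and \<open>p - 1\<close> (to lift
  primitives of coboundaries) only.
\<close>
theorem cohomology_iso:
  assumes \<gamma>: "\<gamma> \<in> carrier G"
    and onto: "\<And>q J. \<lbrakk> q = p \<or> Suc q = p; J \<in> cech_index r q \<rbrakk> \<Longrightarrow>
      hpart (sup.loc J) \<gamma> \<subseteq> loc_incl J ` hpart (sub.loc J) \<gamma>"
  shows "cech_cohomology_map (\<lambda>m. m) G R M f r p
    \<in> iso (hgroup (cech_cohomology G A L f r p) \<gamma>) (hgroup (cech_cohomology G R M f r p) \<gamma>)"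
proof -
  let ?V = "hpart (sub.cochains p) \<gamma> \<inter> sub.cocycles p"
  let ?W = "hpart (sup.cochains p) \<gamma> \<inter> sup.cocycles p"
  have onto_at: "J \<in> cech_index r q \<Longrightarrow> hpart (sup.loc J) \<gamma> \<subseteq> loc_incl J ` hpart (sub.loc J) \<gamma>"
    if "q = p \<or> Suc q = p" for q J
    using onto that by blast
  have W: "?W = cochain_map p ` ?V"
  proof
    show "cochain_map p ` ?V \<subseteq> ?W"
    proof
      fix z assume "z \<in> cochain_map p ` ?V"
      then obtain x where x: "x \<in> ?V" "z = cochain_map p x" by blast
      then have "x \<in> carrier (sub.cochains p)" using sub.hpart_cochains_subset [OF \<gamma>] by blast
      then show "z \<in> ?W" using x cochain_map_cocycle_iff cochain_map_hpart [OF \<gamma>] by simp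
    qed
    show "?W \<subseteq> cochain_map p ` ?V"
    proof
      fix z assume z: "z \<in> ?W"
      obtain x where x: "x \<in> hpart (sub.cochains p) \<gamma>" "z = cochain_map p x"
        by (rule cochain_map_onto [OF \<gamma> onto_at [of p]]) (use z in auto)
      then have "x \<in> carrier (sub.cochains p)" using sub.hpart_cochains_subset [OF \<gamma>] by blast
      then show "z \<in> cochain_map p ` ?V" using x z cochain_map_cocycle_iff by auto
    qed
  qed
  have inj: "x \<in> sub.coboundaries p" if "x \<in> ?V" "cochain_map p x \<in> sup.coboundaries p" for x
    by (rule cochain_map_reflects_coboundaries [OF \<gamma> onto]) (use that in auto)
  show ?thesis
    unfolding cech_cohomology_map_eq hgroup_def sub.cohomology_simps sup.cohomology_simps
    by (rule coset_map_iso [OF cochain_map_hom sub.coboundaries_subgroup sup.coboundaries_subgroup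
          sub.homogeneous_cocycles_subgroup [OF \<gamma>] W cochain_map_coboundaries inj])
qed

end

section \<open>Parts of a graded module\<close>

lemma degree_part_simps [simp]:
  "add (degree_part M D) = add M" "zero (degree_part M D) = zero M"
  "smult (degree_part M D) = smult M" "monoid.mult (degree_part M D) = monoid.mult M"
  "one (degree_part M D) = one M"
  "hpart (degree_part M D) \<gamma> = (if \<gamma> \<in> D then hpart M \<gamma> else {\<zero>\<^bsub>M\<^esub>})"
  by (simp_all add: degree_part_def)

locale graded_group = abelian_group M
  for M :: "('a, 'b, 'g) gmodule" (structure) +
  fixes I :: "'g set"
  assumes hpart_subgroup: "\<gamma> \<in> I \<Longrightarrow> additive_subgroup (hpart M \<gamma>) M"
begin

lemma hpart_carrier: "\<lbrakk> \<gamma> \<in> I; x \<in> hpart M \<gamma> \<rbrakk> \<Longrightarrow> x \<in> carrier M"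
  using additive_subgroup.a_subset [OF hpart_subgroup] by blast

lemma hpart_zero: "\<gamma> \<in> I \<Longrightarrow> \<zero> \<in> hpart M \<gamma>"
  by (rule additive_subgroup.zero_closed [OF hpart_subgroup])

lemma hpart_add: "\<lbrakk> \<gamma> \<in> I; x \<in> hpart M \<gamma>; y \<in> hpart M \<gamma> \<rbrakk> \<Longrightarrow> x \<oplus> y \<in> hpart M \<gamma>"
  by (rule additive_subgroup.a_closed [OF hpart_subgroup])

lemma hpart_uminus: "\<lbrakk> \<gamma> \<in> I; x \<in> hpart M \<gamma> \<rbrakk> \<Longrightarrow> \<ominus> x \<in> hpart M \<gamma>"
  using additive_subgroup.a_inv_closed [OF hpart_subgroup] by blast

lemma degree_partI:
  "\<lbrakk> finite F; F \<subseteq> D; c \<in> (\<Pi> \<gamma> \<in> F. hpart M \<gamma>) \<rbrakk> \<Longrightarrow> finsum M c F \<in> carrier (degree_part M D)"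
  unfolding degree_part_def by auto

lemma degree_partE:
  assumes "x \<in> carrier (degree_part M D)"
  obtains F c where "finite F" "F \<subseteq> D" "c \<in> (\<Pi> \<gamma> \<in> F. hpart M \<gamma>)" "x = finsum M c F"
  using assms unfolding degree_part_def by auto

context
  fixes D :: "'g set" assumes D: "D \<subseteq> I"
begin

lemma hpart_Pi_carrier:
  "\<lbrakk> F \<subseteq> D; c \<in> (\<Pi> \<gamma> \<in> F. hpart M \<gamma>) \<rbrakk> \<Longrightarrow> c \<in> F \<rightarrow> carrier M"
  using D hpart_carrier by (fastforce simp: Pi_iff)

lemma degree_part_subset: "carrier (degree_part M D) \<subseteq> carrier M"
proof
  fix x assume "x \<in> carrier (degree_part M D)"
  then obtain F c where "finite F" "F \<subseteq> D" "c \<in> (\<Pi> \<gamma> \<in> F. hpart M \<gamma>)" "x = finsum M c F"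
    by (rule degree_partE)
  then show "x \<in> carrier M" using finsum_closed [OF hpart_Pi_carrier] by simp
qed

lemma degree_part_zero: "\<zero> \<in> carrier (degree_part M D)"
  using degree_partI [of "{}" D] by simp

lemma hpart_degree_part: "\<lbrakk> \<gamma> \<in> D; x \<in> hpart M \<gamma> \<rbrakk> \<Longrightarrow> x \<in> carrier (degree_part M D)"
  using degree_partI [of "{\<gamma>}" D "\<lambda>_. x"] hpart_carrier [of \<gamma> x] D by (auto simp: Pi_iff)

text \<open>
  An element of \<open>M\<^sub>D\<close> is a finite sum of homogeneous elements; induction on the number of summands
  spares handling such sums in the closure properties below.
\<close>
lemma degree_part_induct [consumes 1, case_names zero add]:
  assumes x: "x \<in> carrier (degree_part M D)"
    and zero: "P \<zero>"
    and add: "\<And>y \<gamma> h. \<lbrakk> y \<in> carrier (degree_part M D); P y; \<gamma> \<in> D; h \<in> hpart M \<gamma> \<rbrakk> \<Longrightarrow> P (h \<oplus> y)"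
  shows "P x"
proof -
  obtain F c where "finite F" "F \<subseteq> D" "c \<in> (\<Pi> \<gamma> \<in> F. hpart M \<gamma>)" "x = finsum M c F"
    using x by (rule degree_partE)
  moreover have "finite F \<Longrightarrow> F \<subseteq> D \<Longrightarrow> c \<in> (\<Pi> \<gamma> \<in> F. hpart M \<gamma>) \<Longrightarrow> P (finsum M c F)" for F
  proof (induction F rule: finite_induct)
    case empty
    then show ?case by (simp add: zero)
  next
    case (insert \<gamma> F)
    then have F: "F \<subseteq> D" "c \<in> (\<Pi> \<gamma> \<in> F. hpart M \<gamma>)" "\<gamma> \<in> D" "c \<gamma> \<in> hpart M \<gamma>" by auto
    have "finsum M c (insert \<gamma> F) = c \<gamma> \<oplus> finsum M c F"
      using insert.hyps hpart_Pi_carrier [OF F(1,2)] hpart_carrier [of \<gamma> "c \<gamma>"] F D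
      by (intro finsum_insert) auto
    then show ?case
      using add [OF degree_partI [OF insert.hyps(1) F(1,2)] insert.IH [OF F(1,2)] F(3,4)] by simp
  qed
  ultimately show ?thesis by simp
qed

text \<open>
  A summand of degree \<open>\<gamma>\<close> is merged with the one of the same degree, if there is one, since \<open>M\<^sub>D\<close> is defined by
  sums with at most one summand in each degree.
\<close>
lemma degree_part_add_hpart:
  assumes \<gamma>: "\<gamma> \<in> D" and h: "h \<in> hpart M \<gamma>" and x: "x \<in> carrier (degree_part M D)"
  shows "h \<oplus> x \<in> carrier (degree_part M D)"
proof -
  obtain F c where F: "finite F" "F \<subseteq> D" "c \<in> (\<Pi> \<gamma> \<in> F. hpart M \<gamma>)" "x = finsum M c F"
    using x by (rule degree_partE)
  note cF = hpart_Pi_carrier [OF F(2,3)] and hc = hpart_carrier [OF subsetD [OF D \<gamma>] h]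
  define c' where "c' = c(\<gamma> := (if \<gamma> \<in> F then h \<oplus> c \<gamma> else h))"
  have rest: "F - {\<gamma>} \<subseteq> D" "c \<in> (F - {\<gamma>}) \<rightarrow> carrier M" "finite (F - {\<gamma>})" using F cF by auto
  have fc: "finsum M c (F - {\<gamma>}) \<in> carrier M" using finsum_closed [OF rest(2)] .
  have "finsum M c' (insert \<gamma> (F - {\<gamma>})) = c' \<gamma> \<oplus> finsum M c' (F - {\<gamma>})"
    using rest cF hc by (intro finsum_insert) (auto simp: c'_def)
  also have "finsum M c' (F - {\<gamma>}) = finsum M c (F - {\<gamma>})"
    using rest(2) by (intro finsum_cong') (auto simp: c'_def)
  also have "c' \<gamma> \<oplus> finsum M c (F - {\<gamma>}) = h \<oplus> finsum M c F"
  proof (cases "\<gamma> \<in> F")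
    case True
    have "finsum M c (insert \<gamma> (F - {\<gamma>})) = c \<gamma> \<oplus> finsum M c (F - {\<gamma>})"
      using rest cF True by (intro finsum_insert) auto
    moreover have "c \<gamma> \<in> carrier M" using cF True by auto
    ultimately show ?thesis using True hc fc by (simp add: insert_absorb a_assoc c'_def)
  qed (simp add: c'_def)
  finally have sum: "h \<oplus> x = finsum M c' (insert \<gamma> (F - {\<gamma>}))" unfolding F(4) by simp
  have "c' \<in> (\<Pi> \<gamma> \<in> insert \<gamma> (F - {\<gamma>}). hpart M \<gamma>)"
    using F(3) h hpart_add [OF subsetD [OF D \<gamma>] h] by (simp add: c'_def Pi_iff)
  then show ?thesis
    unfolding sum using F \<gamma> by (intro degree_partI) auto
qed

lemma degree_part_add:
  assumes x: "x \<in> carrier (degree_part M D)" and y: "y \<in> carrier (degree_part M D)"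
  shows "x \<oplus> y \<in> carrier (degree_part M D)"
  using x
proof (induction x rule: degree_part_induct)
  case zero
  then show ?case using y degree_part_subset by auto
next
  case (add x \<gamma> h)
  have "h \<in> carrier M" "x \<in> carrier M" "y \<in> carrier M"
    using add y D degree_part_subset hpart_carrier by auto
  then show ?case
    using degree_part_add_hpart [OF add(2,3,4)] by (simp add: a_assoc)
qed

lemma degree_part_uminus:
  assumes x: "x \<in> carrier (degree_part M D)"
  shows "\<ominus> x \<in> carrier (degree_part M D)"
  using x
proof (induction x rule: degree_part_induct)
  case zero
  then show ?case using degree_part_zero by (simp add: a_inv_def)
next
  case (add x \<gamma> h)
  have "h \<in> carrier M" "x \<in> carrier M" using add D degree_part_subset hpart_carrier by auto
  then show ?case
    using degree_part_add_hpart [OF add(2) hpart_uminus [OF subsetD [OF D add(2)] add(3)] add(4)]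
    by (simp add: minus_add)
qed

lemma abelian_group_degree_part: "abelian_group (degree_part M D)"
proof (rule abelian_groupI, goal_cases)
  case (6 x)
  then have "x \<in> carrier M" using degree_part_subset by blast
  then show ?case using degree_part_uminus [OF 6] by (intro bexI [of _ "\<ominus> x"]) (simp_all add: l_neg)
qed (use degree_part_subset in \<open>auto intro: degree_part_add degree_part_zero a_assoc a_comm\<close>)

lemma uminus_degree_part:
  assumes x: "x \<in> carrier (degree_part M D)"
  shows "\<ominus>\<^bsub>degree_part M D\<^esub> x = \<ominus> x"
proof -
  interpret part: abelian_group "degree_part M D" by (rule abelian_group_degree_part)
  have "x \<in> carrier M" using x degree_part_subset by blast
  then show ?thesis
    using x degree_part_uminus [OF x] by (intro part.minus_equality) (simp_all add: l_neg)
qed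

lemma degree_part_subgroup:
  assumes "E \<subseteq> D"
  shows "additive_subgroup (carrier (degree_part M E)) (degree_part M D)"
proof -
  have EI: "E \<subseteq> I" using assms D by blast
  interpret E: abelian_group "degree_part M E"
    by (rule graded_group.abelian_group_degree_part [OF graded_group_axioms EI])
  have sub: "carrier (degree_part M E) \<subseteq> carrier (degree_part M D)"
    using assms by (auto elim!: degree_partE intro!: degree_partI)
  show ?thesis
    using sub E.zero_closed E.a_closed
      graded_group.degree_part_uminus [OF graded_group_axioms EI]
    by (intro additive_subgroup_criterion abelian_group_degree_part)
      (auto simp: uminus_degree_part)
qed

end

end

text \<open>
  Bilinear operations respect degrees once they do so on homogeneous elements; this covers the
  product of a graded ring and the action on a graded module alike.
\<close>
lemma bilinear_degree_part:
  fixes A :: "('a, 'b, 'g) gmodule" and M :: "('c, 'd, 'g) gmodule"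
    and G :: "('g, 'x) monoid_scheme"
  assumes A: "graded_group A (carrier G)" and M: "graded_group M (carrier G)"
    and D: "D \<subseteq> carrier G" "E \<subseteq> carrier G" "D' \<subseteq> carrier G"
    and DE: "\<And>\<alpha> \<beta>. \<lbrakk> \<alpha> \<in> D; \<beta> \<in> E \<rbrakk> \<Longrightarrow> \<alpha> \<otimes>\<^bsub>G\<^esub> \<beta> \<in> D'"
    and closed: "\<And>a x. \<lbrakk> a \<in> carrier A; x \<in> carrier M \<rbrakk> \<Longrightarrow> op a x \<in> carrier M"
    and left: "\<And>a b x. \<lbrakk> a \<in> carrier A; b \<in> carrier A; x \<in> carrier M \<rbrakk> \<Longrightarrow>
      op (a \<oplus>\<^bsub>A\<^esub> b) x = op a x \<oplus>\<^bsub>M\<^esub> op b x"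
    and right: "\<And>a x y. \<lbrakk> a \<in> carrier A; x \<in> carrier M; y \<in> carrier M \<rbrakk> \<Longrightarrow>
      op a (x \<oplus>\<^bsub>M\<^esub> y) = op a x \<oplus>\<^bsub>M\<^esub> op a y"
    and hom: "\<And>\<alpha> \<beta> a x. \<lbrakk> \<alpha> \<in> D; \<beta> \<in> E; a \<in> hpart A \<alpha>; x \<in> hpart M \<beta> \<rbrakk> \<Longrightarrow>
      op a x \<in> hpart M (\<alpha> \<otimes>\<^bsub>G\<^esub> \<beta>)"
    and a: "a \<in> carrier (degree_part A D)" and x: "x \<in> carrier (degree_part M E)"
  shows "op a x \<in> carrier (degree_part M D')"
proof -
  interpret A: graded_group A "carrier G" by fact
  interpret M: graded_group M "carrier G" by fact
  have right_hom: "abelian_group_hom M M (op a)" if "a \<in> carrier A" for a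
    using that closed right by (intro additive_mapI M.abelian_group_axioms) auto
  have left_hom: "abelian_group_hom A M (\<lambda>a. op a x)" if "x \<in> carrier M" for x
    using that closed left by (intro additive_mapI M.abelian_group_axioms A.abelian_group_axioms) auto
  have hom': "op h x \<in> carrier (degree_part M D')" if h: "\<alpha> \<in> D" "h \<in> hpart A \<alpha>" for \<alpha> h
    using x
  proof (induction x rule: M.degree_part_induct [OF D(2), consumes 1, case_names zero add])
    case zero
    have "h \<in> carrier A" using h A.hpart_carrier D by blast
    then show ?case
      using abelian_group_hom.hom_zero [OF right_hom] M.degree_part_zero [OF D(3)] by simp
  next
    case (add x \<beta> y)
    have "h \<in> carrier A" "x \<in> carrier M" "y \<in> carrier M"
      using add h A.hpart_carrier M.hpart_carrier M.degree_part_subset [OF D(2)] D by blast+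
    then have "op h (y \<oplus>\<^bsub>M\<^esub> x) = op h y \<oplus>\<^bsub>M\<^esub> op h x" by (intro right)
    then show ?case
      using M.degree_part_add_hpart [OF D(3) DE [OF h(1) add(2)] hom [OF h(1) add(2) h(2) add(3)] add(4)]
      by simp
  qed
  have xM: "x \<in> carrier M" using x M.degree_part_subset [OF D(2)] by blast
  show ?thesis
    using a
  proof (induction a rule: A.degree_part_induct [OF D(1), consumes 1, case_names zero add])
    case zero
    then show ?case
      using abelian_group_hom.hom_zero [OF left_hom [OF xM]] M.degree_part_zero [OF D(3)] by simp
  next
    case (add a \<alpha> h)
    have "h \<in> carrier A" "a \<in> carrier A"
      using add A.hpart_carrier A.degree_part_subset [OF D(1)] D by blast+
    then have "op (h \<oplus>\<^bsub>A\<^esub> a) x = op h x \<oplus>\<^bsub>M\<^esub> op a x" using xM by (intro left)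
    then show ?case
      using M.degree_part_add [OF D(3) hom' [OF add(2,3)] add(4)] by simp
  qed
qed

text \<open>
  The properties of degrees in the ring on which the Cech complex depends. They pass to the subring of
  elements with degrees in a submonoid.
\<close>
locale homogeneous_ring = G: comm_group G + cring R
  for G :: "('g, 'x) monoid_scheme" and R :: "('a, 'r, 'g) gmodule" +
  assumes ring_hpart_subgroup: "\<gamma> \<in> carrier G \<Longrightarrow> additive_subgroup (hpart R \<gamma>) R"
    and ring_one_degree: "\<one>\<^bsub>R\<^esub> \<in> hpart R \<one>\<^bsub>G\<^esub>"
    and ring_mult_degree:
      "\<lbrakk> \<alpha> \<in> carrier G; \<beta> \<in> carrier G; a \<in> hpart R \<alpha>; b \<in> hpart R \<beta> \<rbrakk> \<Longrightarrow>
        a \<otimes>\<^bsub>R\<^esub> b \<in> hpart R (\<alpha> \<otimes>\<^bsub>G\<^esub> \<beta>)"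
    and ring_degree_unique:
      "\<lbrakk> \<alpha> \<in> carrier G; \<beta> \<in> carrier G; a \<in> hpart R \<alpha>; a \<in> hpart R \<beta>; a \<noteq> \<zero>\<^bsub>R\<^esub> \<rbrakk> \<Longrightarrow> \<alpha> = \<beta>"
begin

sublocale ring_parts: graded_group R "carrier G"
  by (rule graded_group.intro [OF abelian_group_axioms graded_group_axioms.intro])
    (rule ring_hpart_subgroup)

lemma homogeneous_ring_degree_part:
  assumes E: "submonoid E G"
  shows "homogeneous_ring G (degree_part R E)"
proof -
  interpret E: submonoid E G by fact
  note sub = E.subset
  interpret part: abelian_group "degree_part R E" by (rule ring_parts.abelian_group_degree_part [OF sub])
  have mult: "a \<otimes>\<^bsub>R\<^esub> b \<in> carrier (degree_part R E)"
    if "a \<in> carrier (degree_part R E)" "b \<in> carrier (degree_part R E)" for a b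
    by (rule bilinear_degree_part [where op = "monoid.mult R", OF ring_parts.graded_group_axioms
          ring_parts.graded_group_axioms sub sub sub E.m_closed m_closed l_distr r_distr
          ring_mult_degree [OF subsetD [OF sub] subsetD [OF sub]] that])
  have c: "a \<in> carrier R" if "a \<in> carrier (degree_part R E)" for a
    using that ring_parts.degree_part_subset [OF sub] by blast
  interpret part: cring "degree_part R E"
  proof (rule cringI)
    show "abelian_group (degree_part R E)" by (rule part.abelian_group_axioms)
    show "comm_monoid (degree_part R E)"
    proof (rule comm_monoidI, unfold degree_part_simps)
      show "\<one>\<^bsub>R\<^esub> \<in> carrier (degree_part R E)"
        by (rule ring_parts.hpart_degree_part [OF sub E.one_closed ring_one_degree])
    qed (simp_all only: mult m_assoc m_comm m_lcomm l_one m_closed c)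
  qed (simp only: degree_part_simps l_distr c)
  have zero: "\<zero>\<^bsub>R\<^esub> \<in> hpart (degree_part R E) \<gamma>" if "\<gamma> \<in> carrier G" for \<gamma>
    using ring_parts.hpart_zero [OF that] by simp
  have hc: "a \<in> carrier R" if "\<gamma> \<in> carrier G" "a \<in> hpart (degree_part R E) \<gamma>" for \<gamma> a
    using that ring_parts.hpart_carrier [OF that(1), of a] by (cases "\<gamma> \<in> E") auto
  show ?thesis
  proof (rule homogeneous_ring.intro [OF G.comm_group_axioms part.cring_axioms],
      rule homogeneous_ring_axioms.intro)
    fix \<gamma> assume \<gamma>: "\<gamma> \<in> carrier G"
    show "additive_subgroup (hpart (degree_part R E) \<gamma>) (degree_part R E)"
    proof (cases "\<gamma> \<in> E")
      case True
      show ?thesis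
        using True ring_parts.hpart_degree_part [OF sub True] ring_parts.hpart_zero [OF \<gamma>]
          ring_parts.hpart_add [OF \<gamma>] ring_parts.hpart_uminus [OF \<gamma>]
        by (intro additive_subgroup_criterion part.abelian_group_axioms) (auto simp: ring_parts.uminus_degree_part [OF sub])
    next
      case False
      then show ?thesis using part.zero_additive_subgroup by simp
    qed
  next
    show "\<one>\<^bsub>degree_part R E\<^esub> \<in> hpart (degree_part R E) \<one>\<^bsub>G\<^esub>"
      using ring_one_degree by simp
  next
    fix \<alpha> \<beta> a b
    assume \<alpha>\<beta>: "\<alpha> \<in> carrier G" "\<beta> \<in> carrier G"
      and ab: "a \<in> hpart (degree_part R E) \<alpha>" "b \<in> hpart (degree_part R E) \<beta>"
    show "a \<otimes>\<^bsub>degree_part R E\<^esub> b \<in> hpart (degree_part R E) (\<alpha> \<otimes>\<^bsub>G\<^esub> \<beta>)"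
    proof (cases "\<alpha> \<in> E \<and> \<beta> \<in> E")
      case True
      then show ?thesis using ab \<alpha>\<beta> ring_mult_degree by (simp add: E.m_closed)
    next
      case False
      then have "a \<otimes>\<^bsub>R\<^esub> b = \<zero>\<^bsub>R\<^esub>"
        using ab hc [OF \<alpha>\<beta>(1) ab(1)] hc [OF \<alpha>\<beta>(2) ab(2)] by (auto split: if_splits)
      then show ?thesis using zero [OF G.m_closed [OF \<alpha>\<beta>]] by simp
    qed
  next
    fix \<alpha> \<beta> a
    assume "\<alpha> \<in> carrier G" "\<beta> \<in> carrier G" "a \<in> hpart (degree_part R E) \<alpha>"
      "a \<in> hpart (degree_part R E) \<beta>" "a \<noteq> \<zero>\<^bsub>degree_part R E\<^esub>"
    then show "\<alpha> = \<beta>" using ring_degree_unique by (auto split: if_splits)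
  qed
qed

end

subsection \<open>Homogeneous components\<close>

definition component ::
  "('g, 'x) monoid_scheme \<Rightarrow> ('r, 'm, 'g) gmodule \<Rightarrow> 'g \<Rightarrow> 'm \<Rightarrow> 'm" where
  "component G M \<gamma> x =
    (THE c. c \<in> (\<Pi>\<^sub>E \<gamma> \<in> carrier G. hpart M \<gamma>) \<and>
       finite {\<gamma> \<in> carrier G. c \<gamma> \<noteq> \<zero>\<^bsub>M\<^esub>} \<and>
       x = finsum M c {\<gamma> \<in> carrier G. c \<gamma> \<noteq> \<zero>\<^bsub>M\<^esub>}) \<gamma>"

context graded_module
begin

sublocale parts: graded_group M "carrier G"
  by (rule graded_group.intro [OF M.abelian_group_axioms graded_group_axioms.intro])
    (rule hpart_subgroup)

text \<open>
  Extending a family on \<open>F\<close> by zero gives a decomposition in the sense of the grading, which is unique.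
\<close>
lemma component_finsum:
  assumes F: "finite F" "F \<subseteq> carrier G" and c: "c \<in> (\<Pi> \<gamma> \<in> F. hpart M \<gamma>)" and \<gamma>: "\<gamma> \<in> carrier G"
  shows "component G M \<gamma> (finsum M c F) = (if \<gamma> \<in> F then c \<gamma> else \<zero>\<^bsub>M\<^esub>)"
proof -
  let ?x = "finsum M c F"
  let ?P = "\<lambda>c. c \<in> (\<Pi>\<^sub>E \<gamma> \<in> carrier G. hpart M \<gamma>) \<and>
       finite {\<gamma> \<in> carrier G. c \<gamma> \<noteq> \<zero>\<^bsub>M\<^esub>} \<and>
       ?x = finsum M c {\<gamma> \<in> carrier G. c \<gamma> \<noteq> \<zero>\<^bsub>M\<^esub>}"
  define e where "e = (\<lambda>\<gamma> \<in> carrier G. if \<gamma> \<in> F then c \<gamma> else \<zero>\<^bsub>M\<^esub>)"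
  have cM: "c \<in> F \<rightarrow> carrier M" by (rule parts.hpart_Pi_carrier [OF F(2) _ c]) simp
  have supp: "{\<gamma> \<in> carrier G. e \<gamma> \<noteq> \<zero>\<^bsub>M\<^esub>} = {\<gamma> \<in> F. c \<gamma> \<noteq> \<zero>\<^bsub>M\<^esub>}"
    using F(2) by (auto simp: e_def)
  have "finsum M e {\<gamma> \<in> F. c \<gamma> \<noteq> \<zero>\<^bsub>M\<^esub>} = finsum M c F"
    using F cM by (intro M.add.finprod_mono_neutral_cong_left) (auto simp: e_def)
  moreover have "e \<in> (\<Pi>\<^sub>E \<gamma> \<in> carrier G. hpart M \<gamma>)"
    using c parts.hpart_zero by (auto simp: e_def)
  ultimately have e: "?P e" using F unfolding supp by simp
  have "\<exists>!c. ?P c" by (rule hpart_decomposition [OF M.finsum_closed [OF cM]])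
  then have "(THE c. ?P c) = e" using the1_equality [of ?P e] e by blast
  then show ?thesis using \<gamma> by (simp add: component_def e_def)
qed

lemma homogeneous_decomposition:
  assumes "x \<in> carrier M"
  obtains F c where "finite F" "F \<subseteq> carrier G" "c \<in> (\<Pi> \<gamma> \<in> F. hpart M \<gamma>)" "x = finsum M c F"
proof -
  obtain c where c: "c \<in> (\<Pi>\<^sub>E \<gamma> \<in> carrier G. hpart M \<gamma>)"
    "finite {\<gamma> \<in> carrier G. c \<gamma> \<noteq> \<zero>\<^bsub>M\<^esub>}" "x = finsum M c {\<gamma> \<in> carrier G. c \<gamma> \<noteq> \<zero>\<^bsub>M\<^esub>}"
    using hpart_decomposition [OF assms] by blast
  show thesis
    by (rule that [OF c(2) _ _ c(3)]) (use c(1) in auto)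
qed

lemma carrier_degree_part_all: "carrier (degree_part M (carrier G)) = carrier M"
proof
  show "carrier M \<subseteq> carrier (degree_part M (carrier G))"
  proof
    fix x assume "x \<in> carrier M"
    then obtain F c where "finite F" "F \<subseteq> carrier G" "c \<in> (\<Pi> \<gamma> \<in> F. hpart M \<gamma>)" "x = finsum M c F"
      by (rule homogeneous_decomposition)
    then show "x \<in> carrier (degree_part M (carrier G))" using parts.degree_partI by blast
  qed
qed (rule parts.degree_part_subset, simp)

lemma component_hpart:
  assumes "\<gamma> \<in> carrier G" "\<delta> \<in> carrier G" "h \<in> hpart M \<delta>"
  shows "component G M \<gamma> h = (if \<gamma> = \<delta> then h else \<zero>\<^bsub>M\<^esub>)"
  using component_finsum [of "{\<delta>}" "\<lambda>_. h" \<gamma>] assms parts.hpart_carrier [OF assms(2,3)]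
  by (simp add: Pi_iff)

lemma component_closed:
  assumes "\<gamma> \<in> carrier G" "x \<in> carrier M"
  shows "component G M \<gamma> x \<in> hpart M \<gamma>"
proof -
  obtain F c where F: "finite F" "F \<subseteq> carrier G" "c \<in> (\<Pi> \<gamma> \<in> F. hpart M \<gamma>)" "x = finsum M c F"
    using assms(2) by (rule homogeneous_decomposition)
  show ?thesis
    unfolding F(4) component_finsum [OF F(1-3) assms(1)]
    using F(3) parts.hpart_zero [OF assms(1)] by (auto simp: Pi_iff)
qed

lemma component_add:
  assumes \<gamma>: "\<gamma> \<in> carrier G" and xy: "x \<in> carrier M" "y \<in> carrier M"
  shows "component G M \<gamma> (x \<oplus>\<^bsub>M\<^esub> y) = component G M \<gamma> x \<oplus>\<^bsub>M\<^esub> component G M \<gamma> y"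
proof -
  obtain F c where F: "finite F" "F \<subseteq> carrier G" "c \<in> (\<Pi> \<gamma> \<in> F. hpart M \<gamma>)" "x = finsum M c F"
    using xy(1) by (rule homogeneous_decomposition)
  obtain E e where E: "finite E" "E \<subseteq> carrier G" "e \<in> (\<Pi> \<gamma> \<in> E. hpart M \<gamma>)" "y = finsum M e E"
    using xy(2) by (rule homogeneous_decomposition)
  define c' where "c' = (\<lambda>\<gamma>. if \<gamma> \<in> F then c \<gamma> else \<zero>\<^bsub>M\<^esub>)"
  define e' where "e' = (\<lambda>\<gamma>. if \<gamma> \<in> E then e \<gamma> else \<zero>\<^bsub>M\<^esub>)"
  have U: "finite (F \<union> E)" "F \<union> E \<subseteq> carrier G" using F E by auto
  have c': "c' \<in> (\<Pi> \<gamma> \<in> F \<union> E. hpart M \<gamma>)" and e': "e' \<in> (\<Pi> \<gamma> \<in> F \<union> E. hpart M \<gamma>)"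
    using F(2,3) E(2,3) parts.hpart_zero by (auto simp: c'_def e'_def Pi_iff subset_iff)
  then have s: "(\<lambda>\<gamma>. c' \<gamma> \<oplus>\<^bsub>M\<^esub> e' \<gamma>) \<in> (\<Pi> \<gamma> \<in> F \<union> E. hpart M \<gamma>)"
    using U(2) parts.hpart_add by (auto simp: Pi_iff)
  have cM: "c' \<in> F \<union> E \<rightarrow> carrier M" and eM: "e' \<in> F \<union> E \<rightarrow> carrier M"
    using parts.hpart_Pi_carrier [OF _ U(2)] c' e' by blast+
  have x: "x = finsum M c' (F \<union> E)"
    unfolding F(4) using U cM by (intro M.add.finprod_mono_neutral_cong_left) (auto simp: c'_def)
  have y: "y = finsum M e' (F \<union> E)"
    unfolding E(4) using U eM by (intro M.add.finprod_mono_neutral_cong_left) (auto simp: e'_def)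
  have "x \<oplus>\<^bsub>M\<^esub> y = finsum M (\<lambda>\<gamma>. c' \<gamma> \<oplus>\<^bsub>M\<^esub> e' \<gamma>) (F \<union> E)"
    unfolding x y by (rule M.finsum_addf [OF cM eM, symmetric])
  then show ?thesis
    unfolding component_finsum [OF U c' \<gamma>, folded x] component_finsum [OF U e' \<gamma>, folded y]
    by (simp add: component_finsum [OF U s \<gamma>])
qed

lemma component_hom: "\<gamma> \<in> carrier G \<Longrightarrow> abelian_group_hom M M (component G M \<gamma>)"
  using component_closed component_add parts.hpart_carrier
  by (intro additive_mapI M.abelian_group_axioms) auto

lemma component_smult:
  assumes \<gamma>: "\<gamma> \<in> carrier G" and \<epsilon>: "\<epsilon> \<in> carrier G"
    and a: "a \<in> carrier R" "a \<in> hpart R \<epsilon>" and x: "x \<in> carrier M"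
  shows "component G M (\<gamma> \<otimes>\<^bsub>G\<^esub> \<epsilon>) (a \<odot>\<^bsub>M\<^esub> x) = a \<odot>\<^bsub>M\<^esub> component G M \<gamma> x"
proof -
  note G = comm_group_axioms
  note G_comm = comm_monoid.m_comm [OF comm_group.axioms(1) [OF G]]
    and G_closed = monoid.m_closed [OF group.is_monoid [OF comm_group.axioms(2) [OF G]]]
    and G_cancel = group.right_cancel [OF comm_group.axioms(2) [OF G]]
  have x': "x \<in> carrier (degree_part M (carrier G))" using x carrier_degree_part_all by simp
  have \<gamma>\<epsilon>: "\<gamma> \<otimes>\<^bsub>G\<^esub> \<epsilon> \<in> carrier G" using \<gamma> \<epsilon> by (rule G_closed)
  interpret c1: abelian_group_hom M M "component G M \<gamma>" by (rule component_hom [OF \<gamma>])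
  interpret c2: abelian_group_hom M M "component G M (\<gamma> \<otimes>\<^bsub>G\<^esub> \<epsilon>)" by (rule component_hom [OF \<gamma>\<epsilon>])
  show ?thesis
    using x'
  proof (induction x rule: parts.degree_part_induct [OF subset_refl, consumes 1, case_names zero add])
    case zero
    show ?case using a by simp
  next
    case (add x \<beta> h)
    have xM: "x \<in> carrier M" using add(1) carrier_degree_part_all by simp
    have hM: "h \<in> carrier M" using add(2,3) by (rule parts.hpart_carrier)
    have "a \<odot>\<^bsub>M\<^esub> h \<in> hpart M (\<beta> \<otimes>\<^bsub>G\<^esub> \<epsilon>)"
      using hpart_smult [OF \<epsilon> add(2) a(2) add(3)] G_comm [OF \<epsilon> add(2)] by simp
    then have "component G M (\<gamma> \<otimes>\<^bsub>G\<^esub> \<epsilon>) (a \<odot>\<^bsub>M\<^esub> h) = a \<odot>\<^bsub>M\<^esub> component G M \<gamma> h"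
      using component_hpart [OF \<gamma>\<epsilon> G_closed [OF add(2) \<epsilon>]] component_hpart [OF \<gamma> add(2,3)]
        G_cancel [OF \<epsilon> \<gamma> add(2)] a(1) by simp
    then show ?case
      using xM hM a add(4) by (simp add: smult_r_distr)
  qed
qed

lemma component_degree_part:
  assumes D: "D \<subseteq> carrier G" and \<gamma>: "\<gamma> \<in> carrier G" and x: "x \<in> carrier (degree_part M D)"
  shows "component G M \<gamma> x \<in> hpart (degree_part M D) \<gamma>"
proof (cases "\<gamma> \<in> D")
  case True
  then show ?thesis using component_closed [OF \<gamma>] parts.degree_part_subset [OF D] x by auto
next
  case False
  obtain F c where F: "finite F" "F \<subseteq> D" "c \<in> (\<Pi> \<gamma> \<in> F. hpart M \<gamma>)" "x = finsum M c F"
    using x by (rule parts.degree_partE)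
  then show ?thesis using component_finsum [OF F(1) _ F(3) \<gamma>] D False by auto
qed

text \<open>
  A homogeneous element that lies in \<open>M\<^sub>D\<close> has its degree in \<open>D\<close> unless it is zero, so that membership
  in \<open>M\<^sub>D\<close> can be tested without knowing the degree.
\<close>
lemma hpart_degree_partI:
  assumes D: "D \<subseteq> carrier G" and \<gamma>: "\<gamma> \<in> carrier G"
    and x: "x \<in> carrier (degree_part M D)" "x \<in> hpart M \<gamma>"
  shows "x \<in> hpart (degree_part M D) \<gamma>"
  using component_degree_part [OF D \<gamma> x(1)] component_hpart [OF \<gamma> \<gamma> x(2)] by simp

end

section \<open>Cohomology in degrees 0 and 1\<close>

context graded_cech_complex
begin

lemma hpart_cochains_trivial:
  assumes \<gamma>: "\<gamma> \<in> carrier G"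
    and triv: "\<And>J k. J \<in> cech_index r p \<Longrightarrow> hpart M (frac_degree \<gamma> J k) \<subseteq> {\<zero>\<^bsub>M\<^esub>}"
  shows "hpart (cochains p) \<gamma> \<subseteq> {\<zero>\<^bsub>cochains p\<^esub>}"
proof
  fix x assume x: "x \<in> hpart (cochains p) \<gamma>"
  have "x J = \<zero>\<^bsub>loc J\<^esub>" if J: "J \<in> cech_index r p" for J
  proof -
    note sub = cech_index_subset [OF J]
    interpret localization A M "denom J" by (rule localization_denom [OF sub])
    have "x J \<in> hpart (loc J) \<gamma>" using x J unfolding cochains_simps by (rule PiE_mem)
    then obtain m k where m: "x J = frac A (denom J) M m k" "m \<in> hpart M (frac_degree \<gamma> J k)"
      unfolding hpart_loc [OF \<gamma> sub] by blast
    then have "m = \<zero>\<^bsub>M\<^esub>" using triv [OF J] by blast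
    then show ?thesis using m(1) frac_zero by simp
  qed
  moreover have "x \<in> extensional (cech_index r p)" using x by (simp add: cochains_simps PiE_def)
  ultimately have "x = \<zero>\<^bsub>cochains p\<^esub>"
    unfolding cochains_simps by (intro extensionalityI [OF _ restrict_extensional]) simp_all
  then show "x \<in> {\<zero>\<^bsub>cochains p\<^esub>}" by simp
qed

lemma cohomology_hpart_trivial:
  assumes \<gamma>: "\<gamma> \<in> carrier G"
    and triv: "\<And>J k. J \<in> cech_index r p \<Longrightarrow> hpart M (frac_degree \<gamma> J k) \<subseteq> {\<zero>\<^bsub>M\<^esub>}"
  shows "hpart (cech_cohomology G A M f r p) \<gamma> = {\<zero>\<^bsub>cech_cohomology G A M f r p\<^esub>}"
  using hpart_cochains_trivial [OF assms] additive_subgroup.zero_closed [OF coboundaries_subgroup]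
  unfolding cohomology_hpart_trivial_iff [OF \<gamma>] by blast

lemma cohomology_zero_hpart:
  assumes \<gamma>: "\<gamma> \<in> carrier G"
  shows "\<zero>\<^bsub>cech_cohomology G A M f r p\<^esub> \<in> hpart (cech_cohomology G A M f r p) \<gamma>"
proof -
  interpret C: abelian_group "cochains p" by (rule abelian_group_cochains)
  have "coboundaries p +>\<^bsub>cochains p\<^esub> \<zero>\<^bsub>cochains p\<^esub> = coboundaries p"
    using additive_subgroup.zero_closed [OF coboundaries_subgroup]
    by (simp add: C.coset_eq_self_iff [OF coboundaries_subgroup])
  moreover have "\<zero>\<^bsub>cochains p\<^esub> \<in> hpart (cochains p) \<gamma> \<inter> cocycles p"
    by (rule additive_subgroup.zero_closed [OF homogeneous_cocycles_subgroup [OF \<gamma>]])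
  ultimately show ?thesis unfolding cohomology_simps by blast
qed

lemma cech_index_0: "cech_index r 0 = {{}}"
proof -
  have "J \<subseteq> {..<r} \<and> card J = 0 \<longleftrightarrow> J = {}" for J
    using finite_subset [of J "{..<r}"] by auto
  then show ?thesis unfolding cech_index_def by auto
qed

definition zero_cochain where
  "zero_cochain m = (\<lambda>J \<in> cech_index r 0. frac A (denom J) M m 0)"

lemma zero_cochain_hom: "abelian_group_hom M (cochains 0) zero_cochain"
proof (rule additive_mapI)
  interpret localization A M "denom {}" by (rule localization_denom) simp
  fix x assume x: "x \<in> carrier M"
  show "zero_cochain x \<in> carrier (cochains 0)"
    unfolding zero_cochain_def cochains_simps cech_index_0
    by (rule restrict_PiE_iff [THEN iffD2]) (use frac_closed [OF x] in blast)
  fix y assume y: "y \<in> carrier M"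
  show "zero_cochain (x \<oplus>\<^bsub>M\<^esub> y) = zero_cochain x \<oplus>\<^bsub>cochains 0\<^esub> zero_cochain y"
    unfolding zero_cochain_def cochains_simps cech_index_0
  proof (rule restrict_ext)
    fix J :: "nat set" assume "J \<in> {{}}"
    then have J: "J = {}" by simp
    show "frac A (denom J) M (x \<oplus>\<^bsub>M\<^esub> y) 0 = (\<lambda>J\<in>{{}}. frac A (denom J) M x 0) J
        \<oplus>\<^bsub>loc J\<^esub> (\<lambda>J\<in>{{}}. frac A (denom J) M y 0) J"
      unfolding J restrict_apply' [OF singletonI] add_frac_same [OF x y] ..
  qed
qed (rule M.abelian_group_axioms abelian_group_cochains)+

lemma hpart_cochains_0:
  assumes \<gamma>: "\<gamma> \<in> carrier G"
  shows "hpart (cochains 0) \<gamma> = zero_cochain ` hpart M \<gamma>"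
proof -
  interpret localization A M "denom {}" by (rule localization_denom) simp
  have deg: "frac_degree \<gamma> {} k = \<gamma>" for k using \<gamma> by simp
  have frac: "frac A (denom {}) M m k = frac A (denom {}) M m 0" if "m \<in> hpart M \<gamma>" for m k
    using that hpart_subset [OF \<gamma>] frac_cancel [of m k 0] by auto
  have hp: "hpart (loc {}) \<gamma> = {frac A (denom {}) M m 0 | m. m \<in> hpart M \<gamma>}"
    unfolding hpart_loc [OF \<gamma> empty_subsetI] deg using frac by blast
  show ?thesis
  proof
    show "hpart (cochains 0) \<gamma> \<subseteq> zero_cochain ` hpart M \<gamma>"
    proof
      fix x assume x: "x \<in> hpart (cochains 0) \<gamma>"
      then have "x {} \<in> hpart (loc {}) \<gamma>" unfolding cochains_simps cech_index_0 by (rule PiE_mem) simp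
      then obtain m where m: "m \<in> hpart M \<gamma>" "x {} = frac A (denom {}) M m 0" unfolding hp by blast
      have "x = zero_cochain m"
        unfolding zero_cochain_def
      proof (rule extensionalityI [OF _ restrict_extensional])
        show "x \<in> extensional (cech_index r 0)" using x by (simp only: cochains_simps PiE_def IntD2)
        fix J assume "J \<in> cech_index r 0"
        then show "x J = (\<lambda>J \<in> cech_index r 0. frac A (denom J) M m 0) J"
          using m(2) unfolding cech_index_0 by (simp only: singleton_iff restrict_apply simp_thms if_True)
      qed
      then show "x \<in> zero_cochain ` hpart M \<gamma>" using m(1) by blast
    qed
    show "zero_cochain ` hpart M \<gamma> \<subseteq> hpart (cochains 0) \<gamma>"
    proof
      fix x assume "x \<in> zero_cochain ` hpart M \<gamma>"
      then obtain m where m: "m \<in> hpart M \<gamma>" "x = zero_cochain m" by blast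
      then have "frac A (denom {}) M m 0 \<in> hpart (loc {}) \<gamma>" unfolding hp by blast
      then show "x \<in> hpart (cochains 0) \<gamma>"
        unfolding m(2) zero_cochain_def cochains_simps cech_index_0
        by (intro restrict_PiE_iff [THEN iffD2]) blast
    qed
  qed
qed

lemma H0_submodule_eq:
  "cech_H0_submodule G A M f r = {m \<in> carrier M. zero_cochain m \<in> cocycles 0}"
  by (simp add: cech_H0_submodule_def zero_cochain_def)

text \<open>
  The elements of \<open>H\<^sup>0\<close> are those whose 0-cochain has differential zero, and the 0-cochains of degree \<open>\<gamma>\<close> come
  from the elements of degree \<open>\<gamma>\<close>.
\<close>
lemma Supp_quotient_H0_iff:
  assumes \<gamma>: "\<gamma> \<in> carrier G"
  shows "\<gamma> \<in> Supp G (quot_module M (cech_H0_submodule G A M f r)) \<longleftrightarrow>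
    (\<exists>x \<in> hpart (cochains 0) \<gamma>. diff 0 x \<noteq> \<zero>\<^bsub>cochains 1\<^esub>)"
proof -
  let ?H = "cech_H0_submodule G A M f r"
  have H: "additive_subgroup ?H M"
    unfolding H0_submodule_eq by (rule abelian_group_hom.vimage_subgroup [OF zero_cochain_hom cocycles_subgroup])
  have "?H +>\<^bsub>M\<^esub> m = ?H \<longleftrightarrow> diff 0 (zero_cochain m) = \<zero>\<^bsub>cochains 1\<^esub>" if m: "m \<in> hpart M \<gamma>" for m
  proof -
    have mc: "m \<in> carrier M" using m hpart_subset [OF \<gamma>] by blast
    have "?H +>\<^bsub>M\<^esub> m = ?H \<longleftrightarrow> m \<in> ?H" by (rule M.coset_eq_self_iff [OF H mc])
    also have "\<dots> \<longleftrightarrow> diff 0 (zero_cochain m) = \<zero>\<^bsub>cochains 1\<^esub>"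
      using mc abelian_group_hom.hom_closed [OF zero_cochain_hom mc] by (simp add: H0_submodule_eq cocycles_eq)
    finally show ?thesis .
  qed
  moreover have "\<gamma> \<in> Supp G (quot_module M ?H) \<longleftrightarrow> (\<exists>m \<in> hpart M \<gamma>. ?H +>\<^bsub>M\<^esub> m \<noteq> ?H)"
  proof -
    have "{?H +>\<^bsub>M\<^esub> m | m. m \<in> hpart M \<gamma>} \<noteq> {?H} \<longleftrightarrow> (\<exists>m \<in> hpart M \<gamma>. ?H +>\<^bsub>M\<^esub> m \<noteq> ?H)"
      using zero_hpart [OF \<gamma>] by blast
    then show ?thesis using \<gamma> by (simp add: Supp_def quot_module_def)
  qed
  ultimately show ?thesis unfolding hpart_cochains_0 [OF \<gamma>] by blast
qed

lemma diff_hpart: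
  assumes \<gamma>: "\<gamma> \<in> carrier G" and x: "x \<in> hpart (cochains p) \<gamma>"
  shows "diff p x \<in> hpart (cochains (Suc p)) \<gamma>"
proof -
  interpret comp: cech_morphism A M A M G f f r "loc_comp \<gamma>" by (rule cech_morphism_comp [OF \<gamma>])
  have xc: "x \<in> carrier (cochains p)" using x hpart_cochains_subset [OF \<gamma>] by blast
  have "diff p x = comp.cochain_map (Suc p) (diff p x)"
    using comp.cochain_map_diff [OF xc] cochain_comp_id [OF \<gamma> x] by simp
  also have "\<dots> \<in> hpart (cochains (Suc p)) \<gamma>"
    by (rule cochain_comp_closed [OF \<gamma> abelian_group_hom.hom_closed [OF diff_hom xc]])
  finally show ?thesis .
qed

end

text \<open>
  When the submodule vanishes in degree \<open>\<gamma>\<close>, its first cohomology consists of all cocycles. Under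
  the identification with the cocycles of the ambient module these comprise the classes
  of its first cohomology and the coboundaries of its elements of degree \<open>\<gamma>\<close>.
\<close>
lemma (in graded_cech_inclusion) H1_nontrivial_iff:
  assumes \<gamma>: "\<gamma> \<in> carrier G"
    and triv: "hpart L \<gamma> \<subseteq> {\<zero>\<^bsub>L\<^esub>}"
    and onto: "\<And>J. J \<in> cech_index r 1 \<Longrightarrow> hpart (sup.loc J) \<gamma> \<subseteq> loc_incl J ` hpart (sub.loc J) \<gamma>"
  shows "hpart (cech_cohomology G A L f r 1) \<gamma> \<noteq> {\<zero>\<^bsub>cech_cohomology G A L f r 1\<^esub>} \<longleftrightarrow>
    hpart (cech_cohomology G R M f r 1) \<gamma> \<noteq> {\<zero>\<^bsub>cech_cohomology G R M f r 1\<^esub>} \<or>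
    \<gamma> \<in> Supp G (quot_module M (cech_H0_submodule G R M f r))"
proof -
  let ?V = "hpart (sub.cochains 1) \<gamma> \<inter> sub.cocycles 1"
  let ?W = "hpart (sup.cochains 1) \<gamma> \<inter> sup.cocycles 1"
  interpret h: abelian_group_hom "sub.cochains 1" "sup.cochains 1" "cochain_map 1"
    by (rule cochain_map_hom)
  have cob: "sub.coboundaries 1 = sub.diff 0 ` carrier (sub.cochains 0)"
    "sup.coboundaries 1 = sup.diff 0 ` carrier (sup.cochains 0)"
    by (simp_all add: cech_coboundaries_def)
  have Vc: "?V \<subseteq> carrier (sub.cochains 1)" using sub.hpart_cochains_subset [OF \<gamma>] by blast
  have zero_V: "\<zero>\<^bsub>sub.cochains 1\<^esub> \<in> sub.coboundaries 1"
    by (rule additive_subgroup.zero_closed [OF sub.coboundaries_subgroup])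
  have V0: "x = \<zero>\<^bsub>sub.cochains 1\<^esub>" if x: "x \<in> ?V" "x \<in> sub.coboundaries 1" for x
  proof -
    obtain y where y: "y \<in> carrier (sub.cochains 0)" "x = sub.diff 0 y"
      using x(2) unfolding cob by blast
    have "sub.diff 0 y \<in> hpart (sub.cochains (Suc 0)) \<gamma>" using x(1) y(2) by simp
    then obtain w where w: "w \<in> hpart (sub.cochains 0) \<gamma>" "sub.diff 0 w = sub.diff 0 y"
      by (rule sub.homogeneous_preimage [OF \<gamma> y(1)])
    have "hpart (sub.cochains 0) \<gamma> \<subseteq> {\<zero>\<^bsub>sub.cochains 0\<^esub>}"
      by (rule sub.hpart_cochains_trivial [OF \<gamma>]) (use triv \<gamma> in \<open>auto simp: sub.cech_index_0\<close>)
    then have "w = \<zero>\<^bsub>sub.cochains 0\<^esub>" using w(1) by blast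
    then show ?thesis using w(2) y(2) abelian_group_hom.hom_zero [OF sub.diff_hom [of 0]] by simp
  qed
  have lift: "\<exists>x \<in> ?V. z = cochain_map 1 x" if z: "z \<in> ?W" for z
  proof -
    obtain x where x: "x \<in> hpart (sub.cochains 1) \<gamma>" "z = cochain_map 1 x"
      by (rule cochain_map_onto [OF \<gamma> onto, where z = z]) (use z in auto)
    then have "x \<in> carrier (sub.cochains 1)" using sub.hpart_cochains_subset [OF \<gamma>] by blast
    then have "x \<in> sub.cocycles 1" using z unfolding x(2) by (simp add: cochain_map_cocycle_iff)
    then show ?thesis using x by blast
  qed
  have "?V \<subseteq> sub.coboundaries 1 \<longleftrightarrow>
    ?W \<subseteq> sup.coboundaries 1 \<and> (\<forall>y \<in> hpart (sup.cochains 0) \<gamma>. sup.diff 0 y = \<zero>\<^bsub>sup.cochains 1\<^esub>)"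
  proof
    assume L: "?V \<subseteq> sub.coboundaries 1"
    have W0: "z = \<zero>\<^bsub>sup.cochains 1\<^esub>" if z: "z \<in> ?W" for z
    proof -
      obtain x where x: "x \<in> ?V" "z = cochain_map 1 x" using lift [OF z] by blast
      have "x = \<zero>\<^bsub>sub.cochains 1\<^esub>" using V0 x(1) L by blast
      then show ?thesis unfolding x(2) by (simp only: h.hom_zero)
    qed
    have "sup.diff 0 y = \<zero>\<^bsub>sup.cochains 1\<^esub>" if y: "y \<in> hpart (sup.cochains 0) \<gamma>" for y
    proof (rule W0)
      have "y \<in> carrier (sup.cochains 0)" using y sup.hpart_cochains_subset [OF \<gamma>] by blast
      then show "sup.diff 0 y \<in> ?W" using sup.diff_hpart [OF \<gamma> y] sup.diff_diff_0 by simp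
    qed
    moreover have "?W \<subseteq> sup.coboundaries 1"
      using W0 additive_subgroup.zero_closed [OF sup.coboundaries_subgroup [of 1]] by blast
    ultimately show "?W \<subseteq> sup.coboundaries 1 \<and>
        (\<forall>y \<in> hpart (sup.cochains 0) \<gamma>. sup.diff 0 y = \<zero>\<^bsub>sup.cochains 1\<^esub>)" by blast
  next
    assume R: "?W \<subseteq> sup.coboundaries 1 \<and>
        (\<forall>y \<in> hpart (sup.cochains 0) \<gamma>. sup.diff 0 y = \<zero>\<^bsub>sup.cochains 1\<^esub>)"
    show "?V \<subseteq> sub.coboundaries 1"
    proof
      fix x assume x: "x \<in> ?V"
      then have xc: "x \<in> carrier (sub.cochains 1)" using Vc by blast
      have z: "cochain_map 1 x \<in> hpart (sup.cochains 1) \<gamma>" "cochain_map 1 x \<in> sup.cocycles 1"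
        using x cochain_map_hpart [OF \<gamma>] cochain_map_cocycle_iff [OF xc] by auto
      then obtain y where y: "y \<in> carrier (sup.cochains 0)" "cochain_map 1 x = sup.diff 0 y"
        using R unfolding cob by blast
      have "sup.diff 0 y \<in> hpart (sup.cochains (Suc 0)) \<gamma>" using z(1) y(2) by simp
      then obtain w where w: "w \<in> hpart (sup.cochains 0) \<gamma>" "sup.diff 0 w = sup.diff 0 y"
        by (rule sup.homogeneous_preimage [OF \<gamma> y(1)])
      have "sup.diff 0 w = \<zero>\<^bsub>sup.cochains 1\<^esub>" using R w(1) by blast
      then have "cochain_map 1 x = cochain_map 1 \<zero>\<^bsub>sub.cochains 1\<^esub>"
        by (simp only: h.hom_zero y(2) w(2))
      then have "x = \<zero>\<^bsub>sub.cochains 1\<^esub>"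
        by (rule inj_onD [OF cochain_map_inj _ xc h.G.zero_closed])
      then show "x \<in> sub.coboundaries 1" using zero_V by simp
    qed
  qed
  then show ?thesis
    unfolding sub.cohomology_hpart_trivial_iff [OF \<gamma>] sup.cohomology_hpart_trivial_iff [OF \<gamma>]
      sup.Supp_quotient_H0_iff [OF \<gamma>] by blast
qed

section \<open>The Cech complexes of the parts of a graded module\<close>

context graded_module
begin

text \<open>
  The projections of \<open>M\<close> restrict to every graded submodule, so one choice of \<open>comp\<close> serves all modules
  that are compared.
\<close>
lemma graded_cech_complexI:
  assumes A: "homogeneous_ring G A" and L: "module A L"
    and A_sub: "carrier A \<subseteq> carrier R" "\<And>\<epsilon>. \<epsilon> \<in> carrier G \<Longrightarrow> hpart A \<epsilon> \<subseteq> hpart R \<epsilon>"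
    and ops: "add L = add M" "smult L = smult M"
    and L_sub: "carrier L \<subseteq> carrier M"
      "\<And>\<gamma>. \<gamma> \<in> carrier G \<Longrightarrow> hpart L \<gamma> \<subseteq> carrier L \<inter> hpart M \<gamma>"
    and comp: "\<And>\<gamma> x. \<lbrakk> \<gamma> \<in> carrier G; x \<in> carrier L \<rbrakk> \<Longrightarrow> component G M \<gamma> x \<in> hpart L \<gamma>"
    and f: "\<And>j. j < r \<Longrightarrow> \<delta> j \<in> carrier G" "\<And>j. j < r \<Longrightarrow> f j \<in> hpart A (\<delta> j)"
  shows "graded_cech_complex A L G f r \<delta> (component G M)"
proof -
  interpret A: homogeneous_ring G A by fact
  have fA: "f j \<in> carrier A" if "j < r" for j
    by (rule A.ring_parts.hpart_carrier [OF f [OF that]])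
  show ?thesis
  proof (rule graded_cech_complex.intro [OF cech_complex.intro [OF L cech_complex_axioms.intro] comm_group_axioms],
      rule fA, assumption, rule graded_cech_complex_axioms.intro)
    fix \<gamma> \<epsilon> a x assume *: "\<gamma> \<in> carrier G" "\<epsilon> \<in> carrier G" "a \<in> hpart A \<epsilon>" "x \<in> carrier L"
    then have "a \<in> carrier R" "a \<in> hpart R \<epsilon>" "x \<in> carrier M"
      using A.ring_parts.hpart_carrier [OF *(2,3)] A_sub(1) A_sub(2) [OF *(2)] L_sub(1) by auto
    then show "component G M (\<gamma> \<otimes>\<^bsub>G\<^esub> \<epsilon>) (a \<odot>\<^bsub>L\<^esub> x) = a \<odot>\<^bsub>L\<^esub> component G M \<gamma> x"
      unfolding ops by (intro component_smult *)
  next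
    fix \<gamma> x y assume "\<gamma> \<in> carrier G" "x \<in> carrier L" "y \<in> carrier L"
    then show "component G M \<gamma> (x \<oplus>\<^bsub>L\<^esub> y) = component G M \<gamma> x \<oplus>\<^bsub>L\<^esub> component G M \<gamma> y"
      unfolding ops using L_sub(1) by (intro component_add) auto
  next
    fix \<gamma> x assume *: "\<gamma> \<in> carrier G" "x \<in> hpart L \<gamma>"
    then have "x \<in> hpart M \<gamma>" using L_sub(2) by blast
    then show "component G M \<gamma> x = x" by (simp add: component_hpart [OF *(1) *(1)])
  next
    fix \<gamma> assume "\<gamma> \<in> carrier G"
    then show "hpart L \<gamma> \<subseteq> carrier L" using L_sub(2) by blast
  qed (fact A.ring_one_degree A.ring_mult_degree A.ring_degree_unique comp f)+
qed

lemma module_degree_part: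
  assumes "cring A" "add A = add R" "monoid.mult A = monoid.mult R" "one A = one R"
    and sub: "carrier A \<subseteq> carrier R" and D: "D \<subseteq> carrier G"
    and closed: "\<And>a x. \<lbrakk> a \<in> carrier A; x \<in> carrier (degree_part M D) \<rbrakk> \<Longrightarrow>
      a \<odot>\<^bsub>M\<^esub> x \<in> carrier (degree_part M D)"
  shows "module A (degree_part M D)"
proof -
  have c: "a \<in> carrier A \<Longrightarrow> a \<in> carrier R" "x \<in> carrier (degree_part M D) \<Longrightarrow> x \<in> carrier M" for a x
    using sub parts.degree_part_subset [OF D] by blast+
  show ?thesis
    by (rule moduleI [OF assms(1) parts.abelian_group_degree_part [OF D]])
      (simp_all add: assms(2-4) c closed smult_l_distr smult_r_distr smult_assoc1)
qed

lemma graded_cech_complex_degree_part: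
  assumes A: "homogeneous_ring G A" and L: "module A (degree_part M D)"
    and A_sub: "carrier A \<subseteq> carrier R" "\<And>\<epsilon>. \<epsilon> \<in> carrier G \<Longrightarrow> hpart A \<epsilon> \<subseteq> hpart R \<epsilon>"
    and D: "D \<subseteq> carrier G"
    and f: "\<And>j. j < r \<Longrightarrow> \<delta> j \<in> carrier G" "\<And>j. j < r \<Longrightarrow> f j \<in> hpart A (\<delta> j)"
  shows "graded_cech_complex A (degree_part M D) G f r \<delta> (component G M)"
proof (rule graded_cech_complexI [OF A L A_sub])
  fix \<gamma> assume \<gamma>: "\<gamma> \<in> carrier G"
  show "hpart (degree_part M D) \<gamma> \<subseteq> carrier (degree_part M D) \<inter> hpart M \<gamma>"
    using parts.hpart_degree_part [OF D] parts.degree_part_zero [OF D] parts.hpart_zero [OF \<gamma>] by auto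
qed (use parts.degree_part_subset [OF D] component_degree_part [OF D] f in auto)

end

section \<open>Graded polynomial rings\<close>

lemma submonoid_gen_submonoid:
  assumes "comm_group G" "A \<subseteq> carrier G"
  shows "submonoid (submonoid_gen G A) G"
proof -
  interpret comm_group G by fact
  have "submonoid (carrier G) G" by unfold_locales auto
  then have "carrier G \<in> {H. submonoid H G \<and> A \<subseteq> H}" using assms(2) by blast
  then have sub: "submonoid_gen G A \<subseteq> carrier G" unfolding submonoid_gen_def by blast
  show ?thesis
  proof (rule submonoid.intro [OF sub])
    show "\<one>\<^bsub>G\<^esub> \<in> submonoid_gen G A"
      unfolding submonoid_gen_def using submonoid.one_closed by blast
    fix x y assume "x \<in> submonoid_gen G A" "y \<in> submonoid_gen G A"
    then show "x \<otimes>\<^bsub>G\<^esub> y \<in> submonoid_gen G A"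
      unfolding submonoid_gen_def by (auto intro: submonoid.m_closed)
  qed
qed

lemma submonoid_gen_incl: "A \<subseteq> submonoid_gen G A"
  by (auto simp: submonoid_gen_def)

lemma submonoid_gen_least: "\<lbrakk> submonoid H G; A \<subseteq> H \<rbrakk> \<Longrightarrow> submonoid_gen G A \<subseteq> H"
  by (auto simp: submonoid_gen_def)

locale graded_polynomials = G: comm_group G + S: cring S + R: cring "graded_poly_ring G degX S n"
  for G :: "('g, 'x) monoid_scheme" and degX :: "nat \<Rightarrow> 'g" and S :: "('s, 'y) ring_scheme" and n +
  assumes degX_closed: "degX \<in> {1..n} \<rightarrow> carrier G"
begin

abbreviation poly_ring where "poly_ring \<equiv> graded_poly_ring G degX S n"
abbreviation degrees where "degrees \<equiv> submonoid_gen G (degX ` {1..n})"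

lemma degrees_submonoid: "submonoid degrees G"
  using degX_closed by (intro submonoid_gen_submonoid G.comm_group_axioms) auto

lemma degX_in_degrees: "i \<in> {1..n} \<Longrightarrow> degX i \<in> degrees"
  by (rule subsetD [OF submonoid_gen_incl]) simp

lemma poly_ring_simps:
  "carrier poly_ring = S.indexed_pset {1..n} (carrier S)"
  "P \<oplus>\<^bsub>poly_ring\<^esub> Q = (\<lambda>m. P m \<oplus>\<^bsub>S\<^esub> Q m)"
  "\<zero>\<^bsub>poly_ring\<^esub> = (\<lambda>m. \<zero>\<^bsub>S\<^esub>)"
  "\<one>\<^bsub>poly_ring\<^esub> = S.indexed_const \<one>\<^bsub>S\<^esub>"
  "P \<otimes>\<^bsub>poly_ring\<^esub> Q = (\<lambda>m. finsum S (\<lambda>a. P a \<otimes>\<^bsub>S\<^esub> Q (m - a)) {a. a \<subseteq># m})"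
  "hpart poly_ring \<delta> = {P \<in> carrier poly_ring. \<forall>m. P m \<noteq> \<zero>\<^bsub>S\<^esub> \<longrightarrow> monom_deg G degX m = \<delta>}"
  by (simp_all add: graded_poly_ring_def S.indexed_padd_def S.indexed_zero_def)

lemma coeff_closed: "P \<in> carrier poly_ring \<Longrightarrow> P m \<in> carrier S"
  using S.indexed_pset_in_carrier [OF subset_refl] S.carrier_coeffE by (auto simp: poly_ring_simps)

lemma monomial_vars:
  assumes "P \<in> S.indexed_pset I K" "P m \<noteq> \<zero>\<^bsub>S\<^esub>"
  shows "set_mset m \<subseteq> I"
  using assms
proof (induction P arbitrary: m rule: S.indexed_pset.induct)
  case (indexed_const k)
  then show ?case by (auto simp: S.indexed_const_def split: if_splits)
next
  case (indexed_padd P Q)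
  then have "P m \<noteq> \<zero>\<^bsub>S\<^esub> \<or> Q m \<noteq> \<zero>\<^bsub>S\<^esub>" by (auto simp: S.indexed_padd_def)
  then show ?case using indexed_padd.IH by blast
next
  case (indexed_pmult P i)
  then have i: "i \<in># m" "P (m - {#i#}) \<noteq> \<zero>\<^bsub>S\<^esub>" by (auto simp: S.indexed_pmult_def split: if_splits)
  then have "set_mset m = insert i (set_mset (m - {#i#}))"
    by (metis insert_DiffM set_mset_add_mset_insert)
  then show ?case using indexed_pmult.IH [OF i(2)] indexed_pmult.hyps(2) by (metis insert_subset)
qed

lemma monom_deg_eq:
  assumes "set_mset m \<subseteq> {1..n}"
  shows "monom_deg G degX m = finprod G (\<lambda>i. degX i [^]\<^bsub>G\<^esub> count m i) {1..n}"
  unfolding monom_deg_def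
proof (rule G.finprod_mono_neutral_cong_left [OF _ assms])
  fix i assume "i \<in> {1..n} - set_mset m"
  then have "count m i = 0" by (simp add: not_in_iff)
  then show "degX i [^]\<^bsub>G\<^esub> count m i = \<one>\<^bsub>G\<^esub>" by simp
qed (use degX_closed in auto)

lemma monom_deg_add:
  assumes "set_mset a \<subseteq> {1..n}" "set_mset b \<subseteq> {1..n}"
  shows "monom_deg G degX (a + b) = monom_deg G degX a \<otimes>\<^bsub>G\<^esub> monom_deg G degX b"
proof -
  have ab: "set_mset (a + b) \<subseteq> {1..n}" using assms by simp
  have "monom_deg G degX (a + b) =
      finprod G (\<lambda>i. degX i [^]\<^bsub>G\<^esub> count a i \<otimes>\<^bsub>G\<^esub> degX i [^]\<^bsub>G\<^esub> count b i) {1..n}"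
    unfolding monom_deg_eq [OF ab] using degX_closed
    by (intro G.finprod_cong') (auto simp: Pi_iff G.nat_pow_mult)
  also have "\<dots> = monom_deg G degX a \<otimes>\<^bsub>G\<^esub> monom_deg G degX b"
    unfolding monom_deg_eq [OF assms(1)] monom_deg_eq [OF assms(2)]
    using degX_closed by (intro G.finprod_multf) auto
  finally show ?thesis .
qed

lemma monom_deg_empty: "monom_deg G degX {#} = \<one>\<^bsub>G\<^esub>"
  by (simp add: monom_deg_def)

lemma monom_deg_single: "i \<in> {1..n} \<Longrightarrow> monom_deg G degX {#i#} = degX i"
  using degX_closed by (auto simp: monom_deg_def Pi_iff)

lemma monom_deg_in_degrees: "set_mset m \<subseteq> {1..n} \<Longrightarrow> monom_deg G degX m \<in> degrees"
proof (induction m)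
  case empty
  then show ?case using submonoid.one_closed [OF degrees_submonoid] by (simp add: monom_deg_empty)
next
  case (add i m)
  then have i: "i \<in> {1..n}" and m: "set_mset m \<subseteq> {1..n}" by auto
  have "monom_deg G degX ({#i#} + m) = degX i \<otimes>\<^bsub>G\<^esub> monom_deg G degX m"
    using monom_deg_add [of "{#i#}" m] i m monom_deg_single by simp
  moreover have "degX i \<in> degrees" using degX_in_degrees [OF i] .
  ultimately show ?case using add.IH [OF m] submonoid.m_closed [OF degrees_submonoid] by simp
qed

lemma nonzero_coeff:
  assumes "P \<noteq> \<zero>\<^bsub>poly_ring\<^esub>"
  obtains m where "P m \<noteq> \<zero>\<^bsub>S\<^esub>"
  using assms by (auto simp: poly_ring_simps)

lemma degree_in_degrees:
  assumes P: "P \<in> hpart poly_ring \<delta>" "P \<noteq> \<zero>\<^bsub>poly_ring\<^esub>"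
  shows "\<delta> \<in> degrees"
proof -
  obtain m where m: "P m \<noteq> \<zero>\<^bsub>S\<^esub>" using P(2) by (rule nonzero_coeff)
  then have "set_mset m \<subseteq> {1..n}" "monom_deg G degX m = \<delta>"
    using P(1) monomial_vars [of P _ _ m] unfolding poly_ring_simps(1,6) by blast+
  then show ?thesis using monom_deg_in_degrees by blast
qed

lemma product_coeff:
  assumes P: "P \<in> carrier poly_ring" and Q: "Q \<in> carrier poly_ring"
    and m: "(P \<otimes>\<^bsub>poly_ring\<^esub> Q) m \<noteq> \<zero>\<^bsub>S\<^esub>"
  obtains a b where "m = a + b" "P a \<noteq> \<zero>\<^bsub>S\<^esub>" "Q b \<noteq> \<zero>\<^bsub>S\<^esub>"
proof -
  have "\<exists>a. a \<subseteq># m \<and> P a \<otimes>\<^bsub>S\<^esub> Q (m - a) \<noteq> \<zero>\<^bsub>S\<^esub>"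
  proof (rule ccontr)
    assume "\<not> ?thesis"
    then have "finsum S (\<lambda>a. P a \<otimes>\<^bsub>S\<^esub> Q (m - a)) {a. a \<subseteq># m} = \<zero>\<^bsub>S\<^esub>"
      by (intro S.add.finprod_one_eqI) blast
    then show False using m by (simp add: poly_ring_simps)
  qed
  then obtain a where a: "a \<subseteq># m" "P a \<otimes>\<^bsub>S\<^esub> Q (m - a) \<noteq> \<zero>\<^bsub>S\<^esub>" by blast
  have "P a \<in> carrier S" "Q (m - a) \<in> carrier S" using P Q coeff_closed by auto
  then have "P a \<noteq> \<zero>\<^bsub>S\<^esub>" "Q (m - a) \<noteq> \<zero>\<^bsub>S\<^esub>" using a(2) by auto
  then show thesis using a(1) by (intro that [of a "m - a"]) simp_all
qed

lemma homogeneous_poly_ring: "homogeneous_ring G poly_ring"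
proof (rule homogeneous_ring.intro [OF G.comm_group_axioms R.cring_axioms], rule homogeneous_ring_axioms.intro)
  fix \<gamma> assume "\<gamma> \<in> carrier G"
  show "additive_subgroup (hpart poly_ring \<gamma>) poly_ring"
  proof (rule additive_subgroup_criterion)
    show "abelian_group poly_ring" by (rule R.abelian_group_axioms)
    show "hpart poly_ring \<gamma> \<subseteq> carrier poly_ring" by (auto simp: poly_ring_simps(6))
    show "\<zero>\<^bsub>poly_ring\<^esub> \<in> hpart poly_ring \<gamma>"
      using R.zero_closed by (simp add: poly_ring_simps(3,6))
    fix P assume P: "P \<in> hpart poly_ring \<gamma>"
    then have Pc: "P \<in> carrier poly_ring" by (simp add: poly_ring_simps(6))
    have "(\<ominus>\<^bsub>poly_ring\<^esub> P) m = \<zero>\<^bsub>S\<^esub>" if "P m = \<zero>\<^bsub>S\<^esub>" for m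
      using fun_cong [OF R.r_neg [OF Pc], of m] that coeff_closed [OF R.a_inv_closed [OF Pc], of m]
      by (simp add: poly_ring_simps(2,3))
    then show "\<ominus>\<^bsub>poly_ring\<^esub> P \<in> hpart poly_ring \<gamma>"
      using P R.a_inv_closed [OF Pc] unfolding poly_ring_simps(6) by blast
    fix Q assume Q: "Q \<in> hpart poly_ring \<gamma>"
    then have Qc: "Q \<in> carrier poly_ring" by (simp add: poly_ring_simps(6))
    have "P m \<noteq> \<zero>\<^bsub>S\<^esub> \<or> Q m \<noteq> \<zero>\<^bsub>S\<^esub>" if "(P \<oplus>\<^bsub>poly_ring\<^esub> Q) m \<noteq> \<zero>\<^bsub>S\<^esub>" for m
      using that by (auto simp: poly_ring_simps(2))
    then show "P \<oplus>\<^bsub>poly_ring\<^esub> Q \<in> hpart poly_ring \<gamma>"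
      using P Q R.a_closed [OF Pc Qc] unfolding poly_ring_simps(6) by blast
  qed
next
  show "\<one>\<^bsub>poly_ring\<^esub> \<in> hpart poly_ring \<one>\<^bsub>G\<^esub>"
    using R.one_closed monom_deg_empty
    by (auto simp: poly_ring_simps(4,6) S.indexed_const_def split: if_splits)
next
  fix \<alpha> \<beta> P Q
  assume *: "P \<in> hpart poly_ring \<alpha>" "Q \<in> hpart poly_ring \<beta>"
  then have c: "P \<in> carrier poly_ring" "Q \<in> carrier poly_ring" by (auto simp: poly_ring_simps(6))
  have "monom_deg G degX m = \<alpha> \<otimes>\<^bsub>G\<^esub> \<beta>" if m: "(P \<otimes>\<^bsub>poly_ring\<^esub> Q) m \<noteq> \<zero>\<^bsub>S\<^esub>" for m
  proof -
    obtain a b where ab: "m = a + b" "P a \<noteq> \<zero>\<^bsub>S\<^esub>" "Q b \<noteq> \<zero>\<^bsub>S\<^esub>"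
      using c m by (rule product_coeff)
    then have "set_mset a \<subseteq> {1..n}" "set_mset b \<subseteq> {1..n}"
      using c monomial_vars unfolding poly_ring_simps(1) by blast+
    then show ?thesis
      using ab * by (simp add: monom_deg_add poly_ring_simps(6))
  qed
  then show "P \<otimes>\<^bsub>poly_ring\<^esub> Q \<in> hpart poly_ring (\<alpha> \<otimes>\<^bsub>G\<^esub> \<beta>)"
    using R.m_closed [OF c] unfolding poly_ring_simps(6) by blast
next
  fix \<alpha> \<beta> P
  assume P: "P \<in> hpart poly_ring \<alpha>" "P \<in> hpart poly_ring \<beta>" "P \<noteq> \<zero>\<^bsub>poly_ring\<^esub>"
  obtain m where "P m \<noteq> \<zero>\<^bsub>S\<^esub>" using P(3) by (rule nonzero_coeff)
  then show "\<alpha> = \<beta>" using P(1,2) unfolding poly_ring_simps(6) by blast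
qed

sublocale poly: homogeneous_ring G poly_ring
  by (rule homogeneous_poly_ring)

text \<open>
  This turns stability of a set of degrees under the degrees of the variables into stability of the
  corresponding part of a module under the whole polynomial ring.
\<close>
lemma poly_ring_spanned: "carrier (degree_part poly_ring degrees) = carrier poly_ring"
proof
  note sub = submonoid.subset [OF degrees_submonoid]
  show "carrier (degree_part poly_ring degrees) \<subseteq> carrier poly_ring"
    by (rule poly.ring_parts.degree_part_subset [OF sub])
  show "carrier poly_ring \<subseteq> carrier (degree_part poly_ring degrees)"
  proof
    fix P assume "P \<in> carrier poly_ring"
    then have "P \<in> S.indexed_pset {1..n} (carrier S)" by (simp add: poly_ring_simps(1))
    then show "P \<in> carrier (degree_part poly_ring degrees)"
    proof (induction P rule: S.indexed_pset.induct)
      case (indexed_const k)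
      have "S.indexed_const k \<in> hpart poly_ring \<one>\<^bsub>G\<^esub>"
        using S.indexed_pset.indexed_const [OF indexed_const] monom_deg_empty
        by (auto simp: poly_ring_simps(1,6) S.indexed_const_def split: if_splits)
      then show ?case
        by (rule poly.ring_parts.hpart_degree_part [OF sub submonoid.one_closed [OF degrees_submonoid]])
    next
      case (indexed_padd P Q)
      have "P \<oplus>\<^bsub>poly_ring\<^esub> Q \<in> carrier (degree_part poly_ring degrees)"
        by (rule poly.ring_parts.degree_part_add [OF sub indexed_padd.IH])
      then show ?case by (simp add: poly_ring_simps(2) S.indexed_padd_def)
    next
      case (indexed_pmult P i)
      have i: "degX i \<in> degrees" using degX_in_degrees [OF indexed_pmult.hyps(2)] .
      show ?case
        using indexed_pmult.IH
      proof (induction P rule: poly.ring_parts.degree_part_induct [OF sub, consumes 1, case_names zero add])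
        case zero
        have "S.indexed_pmult \<zero>\<^bsub>poly_ring\<^esub> i = \<zero>\<^bsub>poly_ring\<^esub>"
          by (auto simp: poly_ring_simps(3) S.indexed_pmult_def)
        then show ?case using poly.ring_parts.degree_part_zero [OF sub] by simp
      next
        case (add P \<delta> Q)
        have Q: "Q \<in> carrier poly_ring" using add.hyps(3) by (simp add: poly_ring_simps(6))
        have "S.indexed_pmult Q i \<in> hpart poly_ring (\<delta> \<otimes>\<^bsub>G\<^esub> degX i)"
          unfolding poly_ring_simps(6)
        proof (intro CollectI conjI allI impI)
          show "S.indexed_pmult Q i \<in> carrier poly_ring"
            using S.indexed_pset.indexed_pmult [OF _ indexed_pmult.hyps(2)] Q by (simp add: poly_ring_simps(1))
          fix m assume "S.indexed_pmult Q i m \<noteq> \<zero>\<^bsub>S\<^esub>"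
          then have m: "i \<in># m" "Q (m - {#i#}) \<noteq> \<zero>\<^bsub>S\<^esub>"
            by (auto simp: S.indexed_pmult_def split: if_splits)
          have "set_mset (m - {#i#}) \<subseteq> {1..n}"
            using monomial_vars [of Q _ _ "m - {#i#}"] m(2) Q unfolding poly_ring_simps(1) by blast
          then have "monom_deg G degX ((m - {#i#}) + {#i#}) = monom_deg G degX (m - {#i#}) \<otimes>\<^bsub>G\<^esub> degX i"
            using indexed_pmult.hyps(2) by (subst monom_deg_add) (auto simp: monom_deg_single)
          moreover have "monom_deg G degX (m - {#i#}) = \<delta>"
            using add.hyps(3) m(2) unfolding poly_ring_simps(6) by blast
          ultimately show "monom_deg G degX m = \<delta> \<otimes>\<^bsub>G\<^esub> degX i" using m(1) by simp
        qed
        then have "S.indexed_pmult Q i \<oplus>\<^bsub>poly_ring\<^esub> S.indexed_pmult P i \<in> carrier (degree_part poly_ring degrees)"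
          by (rule poly.ring_parts.degree_part_add_hpart
              [OF sub submonoid.m_closed [OF degrees_submonoid add.hyps(2) i] _ add.IH])
        moreover have "S.indexed_pmult (Q \<oplus>\<^bsub>poly_ring\<^esub> P) i = S.indexed_pmult Q i \<oplus>\<^bsub>poly_ring\<^esub> S.indexed_pmult P i"
          by (auto simp: poly_ring_simps(2) S.indexed_pmult_def)
        ultimately show ?case by simp
      qed
    qed
  qed
qed

end

section \<open>Cohomology and restriction of degrees\<close>

lemma (in comm_group) finprod_in_submonoid:
  assumes "submonoid H G" "finite J" "\<And>j. j \<in> J \<Longrightarrow> d j \<in> H"
  shows "finprod G d J \<in> H"
proof -
  interpret H: submonoid H G by fact
  show ?thesis
    using assms(2,3)
  proof (induction J rule: finite_induct)
    case (insert j J)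
    then have "finprod G d (insert j J) = d j \<otimes> finprod G d J"
      using H.subset by (intro finprod_insert) auto
    then show ?case using insert by simp
  qed simp
qed

lemma (in comm_group) nat_pow_in_submonoid:
  assumes "submonoid H G" "x \<in> H"
  shows "x [^] (k::nat) \<in> H"
proof -
  interpret H: submonoid H G by fact
  show ?thesis by (induction k) (simp_all add: assms(2))
qed

text \<open>
  The degrees of the \<open>f j\<close> lie in the submonoid \<open>\<Gamma>\<close>, so passing to larger denominators moves the degree of a numerator
  within a coset of the group generated by \<open>\<Gamma>\<close>.
\<close>
locale cech_grading = G: comm_group G + graded_module G R M + ring: homogeneous_ring G R
  for G :: "('g, 'x) monoid_scheme" and R :: "('a, 'r, 'g) gmodule" and M :: "('r, 'm, 'g) gmodule" +
  fixes f :: "nat \<Rightarrow> 'r" and r :: nat and \<delta> :: "nat \<Rightarrow> 'g" and \<Gamma> :: "'g set"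
  assumes \<Gamma>_submonoid: "submonoid \<Gamma> G"
    and \<delta>_in: "j < r \<Longrightarrow> \<delta> j \<in> \<Gamma>"
    and f_hpart: "j < r \<Longrightarrow> f j \<in> hpart R (\<delta> j)"
begin

abbreviation Z\<Gamma> where "Z\<Gamma> \<equiv> generate G \<Gamma>"

lemma \<Gamma>_subset: "\<Gamma> \<subseteq> carrier G"
  by (rule submonoid.subset [OF \<Gamma>_submonoid])

lemma \<delta>_carrier: "j < r \<Longrightarrow> \<delta> j \<in> carrier G"
  using \<delta>_in \<Gamma>_subset by blast

lemma Z\<Gamma>_subgroup: "subgroup Z\<Gamma> G"
  by (rule G.generate_is_subgroup [OF \<Gamma>_subset])

lemma \<Gamma>_Z\<Gamma>: "\<Gamma> \<subseteq> Z\<Gamma>"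
  by (rule subsetI) (rule generate.incl)

lemma Z\<Gamma>_subset: "Z\<Gamma> \<subseteq> carrier G"
  by (rule subgroup.subset [OF Z\<Gamma>_subgroup])

sublocale whole: graded_cech_complex R M G f r \<delta> "component G M"
  by (rule graded_cech_complexI [OF ring.homogeneous_ring_axioms module_axioms])
    (use parts.hpart_carrier \<delta>_carrier f_hpart component_closed in auto)

lemma denom_degree_pow: "J \<subseteq> {..<r} \<Longrightarrow> whole.denom_degree J [^]\<^bsub>G\<^esub> (k::nat) \<in> \<Gamma>"
  using finite_subset [of J "{..<r}"]
  by (intro G.nat_pow_in_submonoid G.finprod_in_submonoid \<Gamma>_submonoid) (auto intro: \<delta>_in)

lemma coset_action:
  assumes \<gamma>: "\<gamma> \<in> carrier G"
    and a: "a \<in> carrier (degree_part R \<Gamma>)" and x: "x \<in> carrier (degree_part M (\<gamma> <#\<^bsub>G\<^esub> Z\<Gamma>))"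
  shows "a \<odot>\<^bsub>M\<^esub> x \<in> carrier (degree_part M (\<gamma> <#\<^bsub>G\<^esub> Z\<Gamma>))"
proof -
  have sub: "\<gamma> <#\<^bsub>G\<^esub> Z\<Gamma> \<subseteq> carrier G" using \<gamma> Z\<Gamma>_subset by (auto simp: l_coset_def)
  have mult: "\<alpha> \<otimes>\<^bsub>G\<^esub> \<beta> \<in> \<gamma> <#\<^bsub>G\<^esub> Z\<Gamma>" if \<alpha>: "\<alpha> \<in> \<Gamma>" and \<beta>: "\<beta> \<in> \<gamma> <#\<^bsub>G\<^esub> Z\<Gamma>" for \<alpha> \<beta>
  proof -
    obtain z where z: "z \<in> Z\<Gamma>" "\<beta> = \<gamma> \<otimes>\<^bsub>G\<^esub> z" using \<beta> by (auto simp: l_coset_def)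
    have "\<alpha> \<otimes>\<^bsub>G\<^esub> \<beta> = \<gamma> \<otimes>\<^bsub>G\<^esub> (\<alpha> \<otimes>\<^bsub>G\<^esub> z)"
      using z \<alpha> \<gamma> \<Gamma>_subset Z\<Gamma>_subset by (simp add: subset_iff G.m_lcomm)
    moreover have "\<alpha> \<otimes>\<^bsub>G\<^esub> z \<in> Z\<Gamma>"
      using subgroup.m_closed [OF Z\<Gamma>_subgroup subsetD [OF \<Gamma>_Z\<Gamma> \<alpha>] z(1)] .
    ultimately show ?thesis by (auto simp: l_coset_def)
  qed
  show ?thesis
    by (rule bilinear_degree_part [where op = "smult M", OF ring.ring_parts.graded_group_axioms
          parts.graded_group_axioms \<Gamma>_subset sub sub mult smult_closed smult_l_distr smult_r_distr
          hpart_smult [OF subsetD [OF \<Gamma>_subset] subsetD [OF sub]] a x])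
qed

text \<open>
  A fraction of degree \<open>\<gamma>\<close> has its numerator in a degree of \<open>\<gamma> + \<Gamma>\<close>, so only that part of
  the module enters the cochains of degree \<open>\<gamma>\<close>.
\<close>
theorem cohomology_coset_iso:
  assumes \<gamma>: "\<gamma> \<in> carrier G"
  shows "cech_cohomology_map (\<lambda>m. m) G R M f r i
    \<in> iso (hgroup (cech_cohomology G (degree_part R \<Gamma>) (degree_part M (\<gamma> <#\<^bsub>G\<^esub> Z\<Gamma>)) f r i) \<gamma>)
          (hgroup (cech_cohomology G R M f r i) \<gamma>)"
proof -
  let ?A = "degree_part R \<Gamma>" and ?D = "\<gamma> <#\<^bsub>G\<^esub> Z\<Gamma>"
  have D: "?D \<subseteq> carrier G" using \<gamma> Z\<Gamma>_subset by (auto simp: l_coset_def)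
  interpret A: homogeneous_ring G ?A
    by (rule ring.homogeneous_ring_degree_part [OF \<Gamma>_submonoid])
  have A_sub: "carrier ?A \<subseteq> carrier R"
    by (rule ring.ring_parts.degree_part_subset [OF \<Gamma>_subset])
  have A_hpart: "hpart ?A \<epsilon> \<subseteq> hpart R \<epsilon>" if "\<epsilon> \<in> carrier G" for \<epsilon>
    using ring.ring_parts.hpart_zero [OF that] by simp
  have L: "module ?A (degree_part M ?D)"
    by (rule module_degree_part [OF A.cring_axioms _ _ _ A_sub D coset_action [OF \<gamma>]]) simp_all
  interpret sub: graded_cech_complex ?A "degree_part M ?D" G f r \<delta> "component G M"
    by (rule graded_cech_complex_degree_part [OF A.homogeneous_ring_axioms L A_sub A_hpart D \<delta>_carrier])
      (simp_all add: \<delta>_in f_hpart)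
  interpret graded_cech_inclusion ?A R "degree_part M ?D" M G f r \<delta> "component G M" "component G M"
    by unfold_locales (use parts.degree_part_subset [OF D] parts.hpart_zero in auto)
  show ?thesis
  proof (rule cohomology_iso [OF \<gamma>], rule loc_incl_onto [OF \<gamma>])
    fix q J assume J: "J \<in> cech_index r q"
    then show "J \<subseteq> {..<r}" by (rule whole.cech_index_subset)
    fix m k assume m: "m \<in> hpart M (whole.frac_degree \<gamma> J k)"
    have "whole.denom_degree J [^]\<^bsub>G\<^esub> k \<in> Z\<Gamma>"
      using denom_degree_pow [OF whole.cech_index_subset [OF J]] \<Gamma>_Z\<Gamma> by blast
    then have "whole.frac_degree \<gamma> J k \<in> ?D" by (auto simp: l_coset_def)
    moreover have "m \<in> carrier M"
      using m parts.hpart_carrier whole.frac_degree_closed [OF \<gamma> whole.cech_index_subset [OF J]] by blast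
    ultimately show "\<exists>l::nat. (whole.denom J [^]\<^bsub>R\<^esub> l) \<odot>\<^bsub>M\<^esub> m
        \<in> hpart (degree_part M ?D) (whole.frac_degree \<gamma> J (l + k))"
      using m by (intro exI [of _ 0]) simp
  qed
qed

end

text \<open>
  Stability of \<open>\<SS>\<close> under \<open>\<Gamma>\<close> keeps numerators in \<open>M\<^sub>\<SS>\<close> when denominators grow; the action of all of \<open>R\<close> lets
  arbitrary products of the \<open>f j\<close> act on them.
\<close>
locale cech_truncation = cech_grading G R M f r \<delta> \<Gamma>
  for G :: "('g, 'x) monoid_scheme" and R :: "('a, 'r, 'g) gmodule" and M :: "('r, 'm, 'g) gmodule"
    and f r \<delta> \<Gamma> +
  fixes \<SS> :: "'g set"
  assumes \<SS>_subset: "\<SS> \<subseteq> carrier G"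
    and \<SS>_\<Gamma>: "\<lbrakk> s \<in> \<SS>; g \<in> \<Gamma> \<rbrakk> \<Longrightarrow> s \<otimes>\<^bsub>G\<^esub> g \<in> \<SS>"
    and module_truncation: "module R (degree_part M \<SS>)"
begin

abbreviation N where "N \<equiv> degree_part M \<SS>"

sublocale trunc: graded_cech_complex R N G f r \<delta> "component G M"
  by (rule graded_cech_complex_degree_part [OF ring.homogeneous_ring_axioms module_truncation
        subset_refl subset_refl \<SS>_subset \<delta>_carrier f_hpart])

sublocale incl: graded_cech_inclusion R R N M G f r \<delta> "component G M" "component G M"
  by unfold_locales (use parts.degree_part_subset [OF \<SS>_subset] parts.hpart_zero in auto)

lemma \<SS>Z\<Gamma>_subset: "\<SS> <#>\<^bsub>G\<^esub> Z\<Gamma> \<subseteq> carrier G"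
  using \<SS>_subset Z\<Gamma>_subset by (auto simp: set_mult_def)

lemma \<SS>_subset_\<SS>Z\<Gamma>: "\<SS> \<subseteq> \<SS> <#>\<^bsub>G\<^esub> Z\<Gamma>"
proof
  fix s assume s: "s \<in> \<SS>"
  then have "s = s \<otimes>\<^bsub>G\<^esub> \<one>\<^bsub>G\<^esub>" using \<SS>_subset by auto
  then show "s \<in> \<SS> <#>\<^bsub>G\<^esub> Z\<Gamma>"
    using s subgroup.one_closed [OF Z\<Gamma>_subgroup] unfolding set_mult_def by blast
qed

lemma \<SS>Z\<Gamma>_iff:
  assumes \<gamma>: "\<gamma> \<in> carrier G" and z: "z \<in> Z\<Gamma>"
  shows "\<gamma> \<otimes>\<^bsub>G\<^esub> z \<in> \<SS> <#>\<^bsub>G\<^esub> Z\<Gamma> \<longleftrightarrow> \<gamma> \<in> \<SS> <#>\<^bsub>G\<^esub> Z\<Gamma>"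
proof -
  have step: "\<beta> \<otimes>\<^bsub>G\<^esub> w \<in> \<SS> <#>\<^bsub>G\<^esub> Z\<Gamma>" if \<beta>: "\<beta> \<in> \<SS> <#>\<^bsub>G\<^esub> Z\<Gamma>" and w: "w \<in> Z\<Gamma>" for \<beta> w
  proof -
    obtain s v where sv: "s \<in> \<SS>" "v \<in> Z\<Gamma>" "\<beta> = s \<otimes>\<^bsub>G\<^esub> v" using \<beta> by (auto simp: set_mult_def)
    have "\<beta> \<otimes>\<^bsub>G\<^esub> w = s \<otimes>\<^bsub>G\<^esub> (v \<otimes>\<^bsub>G\<^esub> w)"
      unfolding sv(3) using sv w \<SS>_subset Z\<Gamma>_subset by (intro G.m_assoc) auto
    then show ?thesis
      using sv subgroup.m_closed [OF Z\<Gamma>_subgroup sv(2) w] unfolding set_mult_def by blast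
  qed
  have zc: "z \<in> carrier G" using z Z\<Gamma>_subset by blast
  have "\<gamma> = (\<gamma> \<otimes>\<^bsub>G\<^esub> z) \<otimes>\<^bsub>G\<^esub> inv\<^bsub>G\<^esub> z" using \<gamma> zc by (simp add: G.m_assoc)
  then show ?thesis
    using step [of "\<gamma> \<otimes>\<^bsub>G\<^esub> z" "inv\<^bsub>G\<^esub> z"] step [of \<gamma> z] z subgroup.m_inv_closed [OF Z\<Gamma>_subgroup z]
    by auto
qed

lemma frac_degree_\<SS>Z\<Gamma>_iff:
  assumes "\<gamma> \<in> carrier G" "J \<subseteq> {..<r}"
  shows "whole.frac_degree \<gamma> J k \<in> \<SS> <#>\<^bsub>G\<^esub> Z\<Gamma> \<longleftrightarrow> \<gamma> \<in> \<SS> <#>\<^bsub>G\<^esub> Z\<Gamma>"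
  by (rule \<SS>Z\<Gamma>_iff [OF assms(1) subsetD [OF \<Gamma>_Z\<Gamma> denom_degree_pow [OF assms(2)]]])

text \<open>
  All numerators of fractions of degree \<open>\<gamma>\<close> have their degree in \<open>\<gamma> + \<Gamma>\<close>. If this meets \<open>\<SS>\<close>, then
  \<open>\<gamma>\<close> lies in \<open>\<SS> + Z\<Gamma>\<close>; otherwise already the cochains of degree \<open>\<gamma>\<close> vanish.
\<close>
theorem truncation_cohomology_trivial:
  assumes \<gamma>: "\<gamma> \<in> carrier G" "\<gamma> \<notin> \<SS> <#>\<^bsub>G\<^esub> Z\<Gamma>"
  shows "hpart (cech_cohomology G R N f r i) \<gamma> = {\<zero>\<^bsub>cech_cohomology G R N f r i\<^esub>}"
proof (rule trunc.cohomology_hpart_trivial [OF \<gamma>(1)])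
  fix J k assume "J \<in> cech_index r i"
  then have "whole.frac_degree \<gamma> J k \<notin> \<SS>"
    using frac_degree_\<SS>Z\<Gamma>_iff [OF \<gamma>(1) whole.cech_index_subset] \<gamma>(2) \<SS>_subset_\<SS>Z\<Gamma> by blast
  then show "hpart N (whole.frac_degree \<gamma> J k) \<subseteq> {\<zero>\<^bsub>N\<^esub>}" by simp
qed

lemma loc_incl_onto_inside:
  assumes \<gamma>: "\<gamma> \<in> \<SS>" and J: "J \<subseteq> {..<r}"
  shows "hpart (whole.loc J) \<gamma> \<subseteq> incl.loc_incl J ` hpart (trunc.loc J) \<gamma>"
proof -
  have \<gamma>c: "\<gamma> \<in> carrier G" using \<gamma> \<SS>_subset by blast
  show ?thesis
  proof (rule incl.loc_incl_onto [OF \<gamma>c J])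
    fix m k assume m: "m \<in> hpart M (whole.frac_degree \<gamma> J k)"
    have "whole.frac_degree \<gamma> J k \<in> \<SS>" by (rule \<SS>_\<Gamma> [OF \<gamma> denom_degree_pow [OF J]])
    moreover have "m \<in> carrier M"
      using m parts.hpart_carrier whole.frac_degree_closed [OF \<gamma>c J] by blast
    ultimately show "\<exists>l::nat. (whole.denom J [^]\<^bsub>R\<^esub> l) \<odot>\<^bsub>M\<^esub> m
        \<in> hpart N (whole.frac_degree \<gamma> J (l + k))"
      using m by (intro exI [of _ 0]) simp
  qed
qed

text \<open>
  For \<open>\<gamma>\<close> in \<open>\<SS>\<close> all of \<open>\<gamma> + \<Gamma>\<close> lies in \<open>\<SS>\<close>, so the cochains of degree \<open>\<gamma>\<close> are the same, in cohomological degree 0 too.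
\<close>
theorem truncation_cohomology_iso_inside:
  assumes \<gamma>: "\<gamma> \<in> \<SS>"
  shows "cech_cohomology_map (\<lambda>m. m) G R M f r i
    \<in> iso (hgroup (cech_cohomology G R N f r i) \<gamma>) (hgroup (cech_cohomology G R M f r i) \<gamma>)"
  by (rule incl.cohomology_iso [OF subsetD [OF \<SS>_subset \<gamma>] loc_incl_onto_inside [OF \<gamma> whole.cech_index_subset]])

lemma hgroup_iso_trivial_iff:
  assumes \<gamma>: "\<gamma> \<in> carrier G"
    and iso: "h \<in> iso (hgroup (cech_cohomology G R N f r i) \<gamma>) (hgroup (cech_cohomology G R M f r i) \<gamma>)"
  shows "hpart (cech_cohomology G R N f r i) \<gamma> = {\<zero>\<^bsub>cech_cohomology G R N f r i\<^esub>} \<longleftrightarrow>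
    hpart (cech_cohomology G R M f r i) \<gamma> = {\<zero>\<^bsub>cech_cohomology G R M f r i\<^esub>}"
proof -
  let ?X = "hpart (cech_cohomology G R N f r i) \<gamma>" and ?Y = "hpart (cech_cohomology G R M f r i) \<gamma>"
  have "bij_betw h ?X ?Y" using iso by (simp add: iso_def hgroup_def)
  then have "is_singleton ?X \<longleftrightarrow> is_singleton ?Y"
    by (simp add: is_singleton_altdef bij_betw_same_card)
  moreover have "\<zero>\<^bsub>cech_cohomology G R N f r i\<^esub> \<in> ?X" by (rule trunc.cohomology_zero_hpart [OF \<gamma>])
  moreover have "\<zero>\<^bsub>cech_cohomology G R M f r i\<^esub> \<in> ?Y" by (rule whole.cohomology_zero_hpart [OF \<gamma>])
  ultimately show ?thesis by (auto simp: is_singleton_def)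
qed

lemma Supp_H0_truncation:
  "Supp G (cech_cohomology G R N f r 0) = Supp G (cech_cohomology G R M f r 0) \<inter> \<SS>"
proof -
  have "hpart (cech_cohomology G R N f r 0) \<gamma> = {\<zero>\<^bsub>cech_cohomology G R N f r 0\<^esub>}"
    if \<gamma>: "\<gamma> \<in> carrier G" "\<gamma> \<notin> \<SS>" for \<gamma>
  proof (rule trunc.cohomology_hpart_trivial [OF \<gamma>(1)])
    fix J k assume "J \<in> cech_index r 0"
    then have "J = {}" by (simp add: whole.cech_index_0)
    then show "hpart N (whole.frac_degree \<gamma> J k) \<subseteq> {\<zero>\<^bsub>N\<^esub>}" using \<gamma> by simp
  qed
  moreover have "hpart (cech_cohomology G R N f r 0) \<gamma> = {\<zero>\<^bsub>cech_cohomology G R N f r 0\<^esub>} \<longleftrightarrow>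
      hpart (cech_cohomology G R M f r 0) \<gamma> = {\<zero>\<^bsub>cech_cohomology G R M f r 0\<^esub>}" if "\<gamma> \<in> \<SS>" for \<gamma>
    by (rule hgroup_iso_trivial_iff [OF subsetD [OF \<SS>_subset that] truncation_cohomology_iso_inside [OF that]])
  ultimately have *: "\<gamma> \<in> Supp G (cech_cohomology G R N f r 0) \<longleftrightarrow>
      \<gamma> \<in> Supp G (cech_cohomology G R M f r 0) \<inter> \<SS>" if "\<gamma> \<in> carrier G" for \<gamma>
    using that by (cases "\<gamma> \<in> \<SS>") (simp_all add: Supp_def)
  show ?thesis
  proof (rule Set.set_eqI)
    show "\<gamma> \<in> Supp G (cech_cohomology G R N f r 0) \<longleftrightarrow>
      \<gamma> \<in> Supp G (cech_cohomology G R M f r 0) \<inter> \<SS>" for \<gamma>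
      using * by (cases "\<gamma> \<in> carrier G") (simp_all add: Supp_def)
  qed
qed

end

locale torsion_truncation = cech_truncation +
  assumes torsion: "\<lbrakk> x \<in> carrier (degree_part M (\<SS> <#>\<^bsub>G\<^esub> Z\<Gamma>)); j < r \<rbrakk> \<Longrightarrow>
    \<exists>k::nat. (f j [^]\<^bsub>R\<^esub> k) \<odot>\<^bsub>M\<^esub> x \<in> carrier N"
begin

text \<open>
  A power of one factor \<open>f j\<close> of the denominator moves the numerator into the submodule; the remaining
  factors act on the submodule. For the empty \<open>J\<close> there is no such factor.
\<close>
lemma loc_incl_onto_torsion:
  assumes \<gamma>: "\<gamma> \<in> \<SS> <#>\<^bsub>G\<^esub> Z\<Gamma>" and J: "J \<subseteq> {..<r}" "J \<noteq> {}"
  shows "hpart (whole.loc J) \<gamma> \<subseteq> incl.loc_incl J ` hpart (trunc.loc J) \<gamma>"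
proof -
  have \<gamma>c: "\<gamma> \<in> carrier G" using \<gamma> \<SS>Z\<Gamma>_subset by blast
  obtain j where j: "j \<in> J" using J(2) by blast
  have jr: "j < r" and J': "J - {j} \<subseteq> {..<r}" using j J by auto
  show ?thesis
  proof (rule incl.loc_incl_onto [OF \<gamma>c J(1)])
    fix m k assume m: "m \<in> hpart M (whole.frac_degree \<gamma> J k)"
    have deg: "whole.frac_degree \<gamma> J i \<in> carrier G" for i
      by (rule whole.frac_degree_closed [OF \<gamma>c J(1)])
    have mc: "m \<in> carrier M" by (rule parts.hpart_carrier [OF deg m])
    have "whole.frac_degree \<gamma> J k \<in> \<SS> <#>\<^bsub>G\<^esub> Z\<Gamma>" using frac_degree_\<SS>Z\<Gamma>_iff [OF \<gamma>c J(1)] \<gamma> by blast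
    then have "m \<in> carrier (degree_part M (\<SS> <#>\<^bsub>G\<^esub> Z\<Gamma>))"
      by (rule parts.hpart_degree_part [OF \<SS>Z\<Gamma>_subset _ m])
    then obtain l :: nat where l: "(f j [^]\<^bsub>R\<^esub> l) \<odot>\<^bsub>M\<^esub> m \<in> carrier N" using torsion jr by blast
    have fc: "f j \<in> carrier R" and dc: "whole.denom (J - {j}) \<in> carrier R" "whole.denom J \<in> carrier R"
      using whole.f_closed [OF jr] whole.denom_closed [OF J'] whole.denom_closed [OF J(1)] by auto
    have "whole.denom J [^]\<^bsub>R\<^esub> l = whole.denom (J - {j}) [^]\<^bsub>R\<^esub> l \<otimes>\<^bsub>R\<^esub> f j [^]\<^bsub>R\<^esub> l"
      unfolding whole.denom_remove [OF J(1) j] using fc dc(1)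
      by (simp only: R.nat_pow_distrib R.nat_pow_closed R.m_comm)
    then have "(whole.denom J [^]\<^bsub>R\<^esub> l) \<odot>\<^bsub>M\<^esub> m
        = (whole.denom (J - {j}) [^]\<^bsub>R\<^esub> l) \<odot>\<^bsub>M\<^esub> ((f j [^]\<^bsub>R\<^esub> l) \<odot>\<^bsub>M\<^esub> m)"
      using smult_assoc1 [OF R.nat_pow_closed [OF dc(1)] R.nat_pow_closed [OF fc] mc] by simp
    also have "\<dots> \<in> carrier N"
      using module.smult_closed [OF module_truncation R.nat_pow_closed [OF dc(1)] l] by simp
    finally have in_N: "(whole.denom J [^]\<^bsub>R\<^esub> l) \<odot>\<^bsub>M\<^esub> m \<in> carrier N" .
    have dg: "whole.denom_degree J \<in> carrier G" by (rule whole.denom_degree_closed [OF J(1)])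
    have "whole.denom_degree J [^]\<^bsub>G\<^esub> l \<otimes>\<^bsub>G\<^esub> whole.frac_degree \<gamma> J k = whole.frac_degree \<gamma> J (l + k)"
      using \<gamma>c dg by (simp only: G.nat_pow_mult [OF dg, symmetric] G.m_lcomm G.nat_pow_closed)
    then have "(whole.denom J [^]\<^bsub>R\<^esub> l) \<odot>\<^bsub>M\<^esub> m \<in> hpart M (whole.frac_degree \<gamma> J (l + k))"
      using hpart_smult [OF G.nat_pow_closed [OF dg] deg
          whole.pow_hpart [OF dg whole.denom_hpart [OF J(1)]] m] by metis
    then show "\<exists>l::nat. (whole.denom J [^]\<^bsub>R\<^esub> l) \<odot>\<^bsub>M\<^esub> m \<in> hpart N (whole.frac_degree \<gamma> J (l + k))"
      using hpart_degree_partI [OF \<SS>_subset deg in_N] by blast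
  qed
qed

lemma cech_index_nonempty: "\<lbrakk> J \<in> cech_index r q; q \<noteq> 0 \<rbrakk> \<Longrightarrow> J \<noteq> {}"
  by (auto simp: cech_index_def)

text \<open>
  Lifting cocycles of degree \<open>i\<close> and primitives of degree \<open>i - 1\<close> involves nonempty \<open>J\<close> only, as \<open>i - 1 \<ge> 1\<close>.
\<close>
theorem truncation_cohomology_iso:
  assumes i: "i \<ge> 2" and \<gamma>: "\<gamma> \<in> \<SS> <#>\<^bsub>G\<^esub> Z\<Gamma>"
  shows "cech_cohomology_map (\<lambda>m. m) G R M f r i
    \<in> iso (hgroup (cech_cohomology G R N f r i) \<gamma>) (hgroup (cech_cohomology G R M f r i) \<gamma>)"
proof (rule incl.cohomology_iso [OF subsetD [OF \<SS>Z\<Gamma>_subset \<gamma>] loc_incl_onto_torsion [OF \<gamma>]])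
  fix q J assume *: "q = i \<or> Suc q = i" "J \<in> cech_index r q"
  show "J \<subseteq> {..<r}" by (rule whole.cech_index_subset [OF *(2)])
  show "J \<noteq> {}" using i * by (intro cech_index_nonempty [OF *(2)]) auto
qed

text \<open>
  Inside \<open>\<SS>\<close> the two first cohomology groups agree. Outside \<open>\<SS>\<close> the submodule is zero in degree \<open>\<gamma>\<close>, while its
  1-cochains still agree with those of \<open>M\<close>.
\<close>
theorem truncation_H1_nontrivial_iff:
  assumes \<gamma>: "\<gamma> \<in> \<SS> <#>\<^bsub>G\<^esub> Z\<Gamma>"
  shows "hpart (cech_cohomology G R N f r 1) \<gamma> \<noteq> {\<zero>\<^bsub>cech_cohomology G R N f r 1\<^esub>} \<longleftrightarrow>
    hpart (cech_cohomology G R M f r 1) \<gamma> \<noteq> {\<zero>\<^bsub>cech_cohomology G R M f r 1\<^esub>} \<or>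
    \<gamma> \<in> Supp G (quot_module M (cech_H0_submodule G R M f r)) - \<SS>"
proof (cases "\<gamma> \<in> \<SS>")
  case True
  then show ?thesis
    using hgroup_iso_trivial_iff [OF subsetD [OF \<SS>_subset True] truncation_cohomology_iso_inside [OF True]]
    by simp
next
  case False
  have "hpart (cech_cohomology G R N f r 1) \<gamma> \<noteq> {\<zero>\<^bsub>cech_cohomology G R N f r 1\<^esub>} \<longleftrightarrow>
    hpart (cech_cohomology G R M f r 1) \<gamma> \<noteq> {\<zero>\<^bsub>cech_cohomology G R M f r 1\<^esub>} \<or>
    \<gamma> \<in> Supp G (quot_module M (cech_H0_submodule G R M f r))"
  proof (rule incl.H1_nontrivial_iff [OF subsetD [OF \<SS>Z\<Gamma>_subset \<gamma>] _ loc_incl_onto_torsion [OF \<gamma>]])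
    show "hpart N \<gamma> \<subseteq> {\<zero>\<^bsub>N\<^esub>}" using False by simp
    fix J assume J: "J \<in> cech_index r 1"
    show "J \<subseteq> {..<r}" by (rule whole.cech_index_subset [OF J])
    show "J \<noteq> {}" by (rule cech_index_nonempty [OF J]) simp
  qed
  then show ?thesis using False by blast
qed

end

section \<open>The local cohomology of truncated modules over graded polynomial rings\<close>

text \<open>
  A ring element times a coset is a union over the elements of the coset, so the product of
  \<open>f j\<^sup>k\<close> with the coset of \<open>x\<close> contains \<open>f j\<^sup>k x\<close>; where it is the zero of the quotient, it equals \<open>N\<close>.
\<close>
lemma ideal_torsion_quotientD:
  assumes L: "abelian_group L" and N: "additive_subgroup N L"
    and torsion: "ideal_torsion A (quot_module L N) f r"
    and x: "x \<in> carrier L" and j: "j < r"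
    and closed: "\<And>k. (f j [^]\<^bsub>A\<^esub> (k::nat)) \<odot>\<^bsub>L\<^esub> x \<in> carrier L"
  shows "\<exists>k::nat. (f j [^]\<^bsub>A\<^esub> k) \<odot>\<^bsub>L\<^esub> x \<in> N"
proof -
  interpret L: abelian_group L by fact
  interpret N: abelian_subgroup N L using N by (rule abelian_subgroupI3) (rule L)
  have "N +>\<^bsub>L\<^esub> x \<in> carrier (quot_module L N)"
    using x by (auto simp: quot_module_def A_RCOSETS_def')
  then obtain k :: nat where "(f j [^]\<^bsub>A\<^esub> k) \<odot>\<^bsub>quot_module L N\<^esub> (N +>\<^bsub>L\<^esub> x) = \<zero>\<^bsub>quot_module L N\<^esub>"
    using torsion j unfolding ideal_torsion_def by blast
  then have "(\<Union>y \<in> N +>\<^bsub>L\<^esub> x. N +>\<^bsub>L\<^esub> ((f j [^]\<^bsub>A\<^esub> k) \<odot>\<^bsub>L\<^esub> y)) = N"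
    by (simp add: quot_module_def)
  moreover have "x \<in> N +>\<^bsub>L\<^esub> x" by (rule N.a_rcos_self [OF x])
  moreover have "(f j [^]\<^bsub>A\<^esub> k) \<odot>\<^bsub>L\<^esub> x \<in> N +>\<^bsub>L\<^esub> ((f j [^]\<^bsub>A\<^esub> k) \<odot>\<^bsub>L\<^esub> x)"
    by (rule N.a_rcos_self [OF closed])
  ultimately show ?thesis by blast
qed

lemma (in cech_truncation) torsion_quotientD:
  assumes torsion: "ideal_torsion (degree_part R \<Gamma>)
      (quot_module (degree_part M (\<SS> <#>\<^bsub>G\<^esub> Z\<Gamma>)) (carrier N)) f r"
    and x: "x \<in> carrier (degree_part M (\<SS> <#>\<^bsub>G\<^esub> Z\<Gamma>))" and j: "j < r"
  shows "\<exists>k::nat. (f j [^]\<^bsub>R\<^esub> k) \<odot>\<^bsub>M\<^esub> x \<in> carrier N"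
proof -
  let ?D = "\<SS> <#>\<^bsub>G\<^esub> Z\<Gamma>"
  have pow: "f j [^]\<^bsub>degree_part R \<Gamma>\<^esub> k = f j [^]\<^bsub>R\<^esub> k" for k :: nat
    by (simp add: nat_pow_def)
  have mult: "\<alpha> \<otimes>\<^bsub>G\<^esub> \<beta> \<in> ?D" if \<alpha>: "\<alpha> \<in> \<Gamma>" and \<beta>: "\<beta> \<in> ?D" for \<alpha> \<beta>
  proof -
    have c: "\<alpha> \<in> carrier G" "\<beta> \<in> carrier G" using \<alpha> \<beta> \<Gamma>_subset \<SS>Z\<Gamma>_subset by auto
    show ?thesis
      unfolding G.m_comm [OF c] using \<SS>Z\<Gamma>_iff [OF c(2) subsetD [OF \<Gamma>_Z\<Gamma> \<alpha>]] \<beta> by simp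
  qed
  have "(f j [^]\<^bsub>R\<^esub> k) \<odot>\<^bsub>M\<^esub> x \<in> carrier (degree_part M ?D)" for k :: nat
  proof -
    have "f j [^]\<^bsub>R\<^esub> k \<in> hpart R (\<delta> j [^]\<^bsub>G\<^esub> k)"
      by (rule whole.pow_hpart [OF \<delta>_carrier f_hpart]) (rule j)+
    then have a: "f j [^]\<^bsub>R\<^esub> k \<in> carrier (degree_part R \<Gamma>)"
      by (rule ring.ring_parts.hpart_degree_part [OF \<Gamma>_subset
            G.nat_pow_in_submonoid [OF \<Gamma>_submonoid \<delta>_in [OF j]]])
    show ?thesis
      by (rule bilinear_degree_part [where op = "smult M", OF ring.ring_parts.graded_group_axioms
            parts.graded_group_axioms \<Gamma>_subset \<SS>Z\<Gamma>_subset \<SS>Z\<Gamma>_subset mult smult_closed smult_l_distr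
            smult_r_distr hpart_smult [OF subsetD [OF \<Gamma>_subset] subsetD [OF \<SS>Z\<Gamma>_subset]] a x])
  qed
  then show ?thesis
    using ideal_torsion_quotientD [OF parts.abelian_group_degree_part [OF \<SS>Z\<Gamma>_subset]
        parts.degree_part_subgroup [OF \<SS>Z\<Gamma>_subset \<SS>_subset_\<SS>Z\<Gamma>] torsion x j]
    by (simp add: pow)
qed

theorem lemma4p19:
  fixes G :: "('g, 'x) monoid_scheme"
    and S :: "('s, 'y) ring_scheme"
    and n :: nat
    and degX :: "nat \<Rightarrow> 'g"
    and R R\<^sub>\<Gamma> :: "('s, nat multiset \<Rightarrow> 's, 'g) gmodule"
    and f :: "nat \<Rightarrow> (nat multiset \<Rightarrow> 's)"
    and r :: nat
    and B :: "(nat multiset \<Rightarrow> 's) set"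
    and M N :: "(nat multiset \<Rightarrow> 's, 'm, 'g) gmodule"
    and \<C> \<Gamma> Z\<Gamma> \<SS> :: "'g set"
    and H :: "nat \<Rightarrow> (nat multiset \<Rightarrow> 's, 'm, 'g) gmodule \<Rightarrow>
        (nat multiset \<Rightarrow> 's, (nat set \<Rightarrow> ('m \<times> nat) set) set, 'g) gmodule"
    and incl :: "nat \<Rightarrow> (nat set \<Rightarrow> ('m \<times> nat) set) set \<Rightarrow> (nat set \<Rightarrow> ('m \<times> nat) set) set"
  assumes "comm_group G"
    and "cring S"
    and "degX \<in> {1..n} \<rightarrow> carrier G"
    and R: "R = graded_poly_ring G degX S n"
    and \<C>: "\<C> = submonoid_gen G (degX ` {1..n})"
    and f: "\<And>j. j < r \<Longrightarrow> \<exists>\<delta> \<in> carrier G. f j \<in> hpart R \<delta>"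
    and B: "B = genideal R (f ` {..<r})"
    and "B \<subseteq> genideal R (ring.indexed_var S ` {1..n})"
    and M: "graded_module G R M"
    and \<Gamma>: "\<Gamma> = submonoid_gen G {\<delta> \<in> carrier G. \<exists>b \<in> B. b \<noteq> \<zero>\<^bsub>R\<^esub> \<and> b \<in> hpart R \<delta>}"
    and Z\<Gamma>: "Z\<Gamma> = generate G \<Gamma>"
    and R\<^sub>\<Gamma>: "R\<^sub>\<Gamma> = degree_part R \<Gamma>"
    and "\<SS> \<subseteq> carrier G"
    and "\<SS> <#>\<^bsub>G\<^esub> \<C> = \<SS>"
    and N: "N = degree_part M \<SS>"
    and torsion:
      "ideal_torsion R\<^sub>\<Gamma> (quot_module (degree_part M (\<SS> <#>\<^bsub>G\<^esub> Z\<Gamma>)) (carrier N)) f r"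
    and H: "H = (\<lambda>i L. cech_cohomology G R L f r i)"
    and incl: "incl = (\<lambda>i. cech_cohomology_map (\<lambda>m. m) G R M f r i)"
  shows
    "(\<forall>i. \<forall>\<gamma> \<in> carrier G.
       incl i \<in> iso (hgroup (cech_cohomology G R\<^sub>\<Gamma> (degree_part M (\<gamma> <#\<^bsub>G\<^esub> Z\<Gamma>)) f r i) \<gamma>)
                     (hgroup (H i M) \<gamma>))
     \<and>
     (\<forall>i. \<forall>\<gamma> \<in> carrier G. \<gamma> \<notin> \<SS> <#>\<^bsub>G\<^esub> Z\<Gamma> \<longrightarrow> hpart (H i N) \<gamma> = {\<zero>\<^bsub>H i N\<^esub>})
     \<and>
     (\<forall>i \<ge> 2. \<forall>\<gamma> \<in> \<SS> <#>\<^bsub>G\<^esub> Z\<Gamma>. incl i \<in> iso (hgroup (H i N) \<gamma>) (hgroup (H i M) \<gamma>))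
     \<and>
     (\<forall>\<gamma> \<in> \<SS> <#>\<^bsub>G\<^esub> Z\<Gamma>.
       hpart (H 1 N) \<gamma> \<noteq> {\<zero>\<^bsub>H 1 N\<^esub>} \<longleftrightarrow>
         hpart (H 1 M) \<gamma> \<noteq> {\<zero>\<^bsub>H 1 M\<^esub>} \<or>
         \<gamma> \<in> Supp G (quot_module M (cech_H0_submodule G R M f r)) - \<SS>)
     \<and>
     (Supp G (H 0 N) = Supp G (H 0 M) \<inter> \<SS> \<and>
     (\<forall>\<gamma> \<in> carrier G. hpart (H 0 N) \<gamma> \<noteq> {\<zero>\<^bsub>H 0 N\<^esub>} \<longrightarrow>
        incl 0 \<in> iso (hgroup (H 0 N) \<gamma>) (hgroup (H 0 M) \<gamma>)))"
proof -
  interpret G: comm_group G by fact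
  interpret M: graded_module G R M by fact
  interpret P: graded_polynomials G degX S n
    using assms(1-3) M.R.cring_axioms unfolding R
    by (intro graded_polynomials.intro graded_polynomials_axioms.intro)
  interpret R: homogeneous_ring G R unfolding R by (rule P.homogeneous_poly_ring)
  have \<C>_eq: "\<C> = P.degrees" by (rule \<C>)
  define gens where "gens = {\<delta> \<in> carrier G. \<exists>b \<in> B. b \<noteq> \<zero>\<^bsub>R\<^esub> \<and> b \<in> hpart R \<delta>}"
  have gens_sub: "gens \<subseteq> carrier G" by (auto simp: gens_def)
  have \<Gamma>_gens: "\<Gamma> = submonoid_gen G gens" by (simp add: \<Gamma> gens_def)
  have \<Gamma>_sub: "submonoid \<Gamma> G" unfolding \<Gamma>_gens by (rule submonoid_gen_submonoid [OF assms(1) gens_sub])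
  have gens_\<Gamma>: "gens \<subseteq> \<Gamma>" unfolding \<Gamma>_gens by (rule submonoid_gen_incl)
  have "gens \<subseteq> \<C>"
  proof
    fix \<delta> assume "\<delta> \<in> gens"
    then obtain b where "b \<noteq> \<zero>\<^bsub>R\<^esub>" "b \<in> hpart R \<delta>" by (auto simp: gens_def)
    then show "\<delta> \<in> \<C>" unfolding \<C>_eq R by (intro P.degree_in_degrees)
  qed
  then have \<Gamma>_\<C>: "\<Gamma> \<subseteq> \<C>"
    unfolding \<Gamma>_gens by (intro submonoid_gen_least) (simp_all only: \<C>_eq P.degrees_submonoid)
  have f_carrier: "f j \<in> carrier R" if "j < r" for j
    using f [OF that] R.ring_parts.hpart_carrier by blast
  \<comment> \<open>A zero \<open>f j\<close> has every degree; degree 0 is chosen, so that the chosen degrees lie in \<open>\<Gamma>\<close>.\<close>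
  have "\<exists>d. d \<in> \<Gamma> \<and> f j \<in> hpart R d" if j: "j < r" for j
  proof (cases "f j = \<zero>\<^bsub>R\<^esub>")
    case True
    have "f j \<in> hpart R \<one>\<^bsub>G\<^esub>" unfolding True by (rule R.ring_parts.hpart_zero) simp
    then show ?thesis using submonoid.one_closed [OF \<Gamma>_sub] by blast
  next
    case False
    obtain d where d: "d \<in> carrier G" "f j \<in> hpart R d" using f [OF j] by blast
    have "f ` {..<r} \<subseteq> carrier R" using f_carrier by auto
    then have "f ` {..<r} \<subseteq> B" unfolding B by (rule M.R.genideal_self)
    then have "f j \<in> B" using j by auto
    then have "d \<in> gens" using d False by (auto simp: gens_def)
    then show ?thesis using gens_\<Gamma> d(2) by blast
  qed
  then obtain \<delta> where \<delta>: "\<And>j. j < r \<Longrightarrow> \<delta> j \<in> \<Gamma>" "\<And>j. j < r \<Longrightarrow> f j \<in> hpart R (\<delta> j)" by metis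
  have \<SS>_\<C>: "s \<otimes>\<^bsub>G\<^esub> c \<in> \<SS>" if "s \<in> \<SS>" "c \<in> \<C>" for s c
  proof -
    have "s \<otimes>\<^bsub>G\<^esub> c \<in> \<SS> <#>\<^bsub>G\<^esub> \<C>" using that unfolding set_mult_def by blast
    then show ?thesis unfolding \<open>\<SS> <#>\<^bsub>G\<^esub> \<C> = \<SS>\<close> .
  qed
  have \<C>_sub: "\<C> \<subseteq> carrier G" unfolding \<C>_eq by (rule submonoid.subset [OF P.degrees_submonoid])
  note \<SS>_sub = \<open>\<SS> \<subseteq> carrier G\<close>
  have \<C>_\<SS>: "c \<otimes>\<^bsub>G\<^esub> s \<in> \<SS>" if "c \<in> \<C>" "s \<in> \<SS>" for s c
    using \<SS>_\<C> [OF that(2,1)] that \<C>_sub \<SS>_sub G.m_comm [of c s] by (simp add: subset_iff)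
  have R_spanned: "carrier (degree_part R \<C>) = carrier R"
    unfolding R \<C>_eq by (rule P.poly_ring_spanned)
  have N_module: "module R (degree_part M \<SS>)"
  proof (rule M.module_degree_part [OF M.R.cring_axioms refl refl refl subset_refl \<SS>_sub])
    fix a x assume a: "a \<in> carrier R" and x: "x \<in> carrier (degree_part M \<SS>)"
    have a': "a \<in> carrier (degree_part R \<C>)" unfolding R_spanned by (rule a)
    show "a \<odot>\<^bsub>M\<^esub> x \<in> carrier (degree_part M \<SS>)"
      by (rule bilinear_degree_part [where op = "smult M", OF R.ring_parts.graded_group_axioms
            M.parts.graded_group_axioms \<C>_sub \<SS>_sub \<SS>_sub \<C>_\<SS> M.smult_closed M.smult_l_distr M.smult_r_distr
            M.hpart_smult [OF subsetD [OF \<C>_sub] subsetD [OF \<SS>_sub]] a' x])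
  qed
  interpret cech_grading G R M f r \<delta> \<Gamma>
    by (rule cech_grading.intro [OF assms(1) \<open>graded_module G R M\<close> R.homogeneous_ring_axioms
          cech_grading_axioms.intro [OF \<Gamma>_sub \<delta>]])
  interpret cech_truncation G R M f r \<delta> \<Gamma> \<SS>
    by (rule cech_truncation.intro [OF cech_grading_axioms
          cech_truncation_axioms.intro [OF \<SS>_sub \<SS>_\<C> [OF _ subsetD [OF \<Gamma>_\<C>]] N_module]])
  have "ideal_torsion (degree_part R \<Gamma>)
      (quot_module (degree_part M (\<SS> <#>\<^bsub>G\<^esub> generate G \<Gamma>)) (carrier (degree_part M \<SS>))) f r"
    using torsion unfolding N R\<^sub>\<Gamma> Z\<Gamma> .
  then interpret torsion_truncation G R M f r \<delta> \<Gamma> \<SS>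
    by (intro torsion_truncation.intro cech_truncation_axioms torsion_truncation_axioms.intro)
      (rule torsion_quotientD)
  show ?thesis
    unfolding H incl N R\<^sub>\<Gamma> Z\<Gamma>
  proof (intro conjI allI ballI impI)
    fix i \<gamma> assume \<gamma>: "\<gamma> \<in> carrier G"
    show "cech_cohomology_map (\<lambda>m. m) G R M f r i
      \<in> iso (hgroup (cech_cohomology G (degree_part R \<Gamma>) (degree_part M (\<gamma> <#\<^bsub>G\<^esub> generate G \<Gamma>)) f r i) \<gamma>)
            (hgroup (cech_cohomology G R M f r i) \<gamma>)"
      by (rule cohomology_coset_iso [OF \<gamma>])
  next
    fix i \<gamma> assume "\<gamma> \<in> carrier G" "\<gamma> \<notin> \<SS> <#>\<^bsub>G\<^esub> generate G \<Gamma>"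
    then show "hpart (cech_cohomology G R (degree_part M \<SS>) f r i) \<gamma> =
        {\<zero>\<^bsub>cech_cohomology G R (degree_part M \<SS>) f r i\<^esub>}"
      by (rule truncation_cohomology_trivial)
  next
    fix i :: nat and \<gamma> assume "2 \<le> i" "\<gamma> \<in> \<SS> <#>\<^bsub>G\<^esub> generate G \<Gamma>"
    then show "cech_cohomology_map (\<lambda>m. m) G R M f r i
      \<in> iso (hgroup (cech_cohomology G R (degree_part M \<SS>) f r i) \<gamma>)
            (hgroup (cech_cohomology G R M f r i) \<gamma>)"
      by (rule truncation_cohomology_iso)
  next
    fix \<gamma> assume "\<gamma> \<in> \<SS> <#>\<^bsub>G\<^esub> generate G \<Gamma>"
    then show "hpart (cech_cohomology G R (degree_part M \<SS>) f r 1) \<gamma>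
          \<noteq> {\<zero>\<^bsub>cech_cohomology G R (degree_part M \<SS>) f r 1\<^esub>} \<longleftrightarrow>
        hpart (cech_cohomology G R M f r 1) \<gamma> \<noteq> {\<zero>\<^bsub>cech_cohomology G R M f r 1\<^esub>} \<or>
        \<gamma> \<in> Supp G (quot_module M (cech_H0_submodule G R M f r)) - \<SS>"
      by (rule truncation_H1_nontrivial_iff)
  next
    show "Supp G (cech_cohomology G R (degree_part M \<SS>) f r 0) =
        Supp G (cech_cohomology G R M f r 0) \<inter> \<SS>"
      by (rule Supp_H0_truncation)
  next
    fix \<gamma> assume "\<gamma> \<in> carrier G" "hpart (cech_cohomology G R (degree_part M \<SS>) f r 0) \<gamma>
        \<noteq> {\<zero>\<^bsub>cech_cohomology G R (degree_part M \<SS>) f r 0\<^esub>}"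
    then have "\<gamma> \<in> Supp G (cech_cohomology G R (degree_part M \<SS>) f r 0)" by (simp add: Supp_def)
    then have "\<gamma> \<in> \<SS>" unfolding Supp_H0_truncation by blast
    then show "cech_cohomology_map (\<lambda>m. m) G R M f r 0
      \<in> iso (hgroup (cech_cohomology G R (degree_part M \<SS>) f r 0) \<gamma>)
            (hgroup (cech_cohomology G R M f r 0) \<gamma>)"
      by (rule truncation_cohomology_iso_inside)
  qed
qed

end
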